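(* Let $\mathcal C$ be a spherical fusion category over $\Bbbk$, and $\mathbf X$ a simple object of $Z(\mathcal C)$. For $m,l\in\mathbb Z$ and $V\in\mathcal C$, we have $$\nu^{\mathbf X}_{m,l}(V)=\frac1{d(\mathbf X)}\,\mathrm{ptr}\big(\kappa_V^{(m,l)}\circ z_{\mathbf X}\big),$$ where $z_{\mathbf X}$ is the natural projection of $K(V^m)$ onto the isotypic component of $\mathbf X$.
   Context: $\Bbbk$ is an algebraically closed field of characteristic zero. Monoidal categories have a strict unit object $I$; associativity isomorphisms are suppressed below; an object also denotes its identity morphism in tensor products. A pivotal category is a left rigid monoidal category (left duals $V^\vee$ with $\mathrm{ev}:V^\vee\otimes V\to I$, $\mathrm{db}:I\to V\otimes V^\vee$) with an isomorphism of monoidal functors $j:\mathrm{Id}\to(-)^{\vee\vee}$. Put $\overline{\mathrm{ev}}_V=\mathrm{ev}_{V^\vee}(j_V\otimes V^\vee)$ and $\overline{\mathrm{db}}_V=(V^\vee\otimes j_V^{-1})\mathrm{db}_{V^\vee}$. For $f:V\to V$, $\mathrm{ptr}^r(f)=\overline{\mathrm{ev}}(f\otimes V^\vee)\mathrm{db}$ and $\mathrm{ptr}^\ell(f)=\mathrm{ev}(V^\vee\otimes f)\overline{\mathrm{db}}$; spherical means these always agree, written $\mathrm{ptr}$; $d(V)=\mathrm{ptr}(\mathrm{id}_V)$. A fusion category over $\Bbbk$ is a semisimple left rigid $\Bbbk$-linear monoidal category with finite-dimensional morphism spaces, simple unit and finitely many simple objects up to isomorphism. The center $\mathcal D=Z(\mathcal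 C)$ has objects $\mathbf X=(X,\sigma_X)$ with natural isomorphisms $\sigma_X(V):X\otimes V\to V\otimes X$ satisfying $\sigma_X(I)=\mathrm{id}$ and $\sigma_X(V\otimes W)=(V\otimes\sigma_X(W))(\sigma_X(V)\otimes W)$; it is a spherical fusion category with pivotal structure inherited from $\mathcal C$. Powers: $V^0=I$, $V^m=V\otimes V^{m-1}$ for $m>0$, $V^m=(V^\vee)^{-m}$ for $m<0$. Via the canonical isomorphisms $V^{-m}\cong(V^m)^\vee$ (built from coherence isomorphisms and $j$) one has $\mathrm{ev}_m:V^{-m}\otimes V^m\to I$ and $\mathrm{db}_m:I\to V^m\otimes V^{-m}$ for all $m\in\mathbb Z$. Let $J_{m,l}:V^{-l}\otimes V^m\otimes V^l\to V^m$ be: regroup as $(V^{-l}\otimes V^l)\otimes V^m$ and apply $\mathrm{ev}_l\otimes\mathrm{id}$ if $ml\ge0$; regroup as $V^m\otimes(V^{-l}\otimes V^l)$ and apply $\mathrm{id}\otimes\mathrm{ev}_l$ if $ml\le0$. For $\mathbf X=(X,\sigma_X)\in Z(\mathcal C)$ and $f\in\mathcal C(X,V^m)$ set $$E^{(m,l)}_{\mathbf X,V}(f)=J_{m,l}\circ(V^{-l}\otimes f\otimes V^l)\circ(\sigma_X(V^{-l})\otimes V^l)\circ(X\otimes\mathrm{db}_{-l}).$$ The generalized Frobenius–Schur indicator is $\nu^{\mathbf X}_{m,l}(V)=\mathrm{Tr}(E^{(m,l)}_{\mathbf X,V})$. Let $K:\mathcal C\to\mathcal D$ be the two-sided adjoint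 of the forgetful functor and $\Psi_{\mathbf X,W}:\mathcal D(\mathbf X,K(W))\to\mathcal C(X,W)$ the natural adjunction isomorphism exhibiting $K$ as right adjoint. Define $\kappa_V^{(m,l)}\in\mathrm{End}_{\mathcal D}(K(V^m))$ by $$\kappa_V^{(m,l)}=\Psi^{-1}_{K(V^m),V^m}\Big(E^{(m,l)}_{K(V^m),V}\big(\Psi_{K(V^m),V^m}(\mathrm{id}_{K(V^m)})\big)\Big).$$ *)

theory Defs
  imports Complex_Main "HOL-Library.FuncSet" "HOL-Computational_Algebra.Polynomial"
begin

section \<open>Linear categories\<close>

text \<open>
  The hom-spaces of a linear category are subspaces of one ambient vector space \<open>'m\<close>, and all typing
  is by membership in \<open>hom X Y\<close>. Different hom-spaces may overlap (they share the zero
  morphism); nothing is assumed about \<open>g \<cdot> f\<close> for operands that are not composable. Every small linear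
  category has this form: take \<open>'m\<close> to be the direct sum of its hom-spaces.
\<close>

record ('o, 'm, 'k) linear_category =
  obj :: "'o set"
  hom :: "'o \<Rightarrow> 'o \<Rightarrow> 'm set"
  cmp :: "'m \<Rightarrow> 'm \<Rightarrow> 'm" (infixr \<open>\<cdot>\<index>\<close> 68)
  idn :: "'o \<Rightarrow> 'm" (\<open>\<one>\<index>\<close>)
  scl :: "'k \<Rightarrow> 'm \<Rightarrow> 'm"

locale linear_category =
  fixes C :: "('o, 'm::ab_group_add, 'k::field, 'z) linear_category_scheme" (structure)
  assumes scl_vector_space: "vector_space (scl C)"
    and hom_subspace: "\<lbrakk>X \<in> obj C; Y \<in> obj C\<rbrakk> \<Longrightarrow> module.subspace (scl C) (hom C X Y)"
    and idn_hom: "X \<in> obj C \<Longrightarrow> \<one> X \<in> hom C X X"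
    and cmp_hom: "\<lbrakk>X \<in> obj C; Y \<in> obj C; Z \<in> obj C; f \<in> hom C X Y; g \<in> hom C Y Z\<rbrakk>
      \<Longrightarrow> g \<cdot> f \<in> hom C X Z"
    and cmp_idn: "\<lbrakk>X \<in> obj C; Y \<in> obj C; f \<in> hom C X Y\<rbrakk> \<Longrightarrow> f \<cdot> \<one> X = f"
    and idn_cmp: "\<lbrakk>X \<in> obj C; Y \<in> obj C; f \<in> hom C X Y\<rbrakk> \<Longrightarrow> \<one> Y \<cdot> f = f"
    and cmp_assoc: "\<lbrakk>X \<in> obj C; Y \<in> obj C; Z \<in> obj C; W \<in> obj C;
        f \<in> hom C X Y; g \<in> hom C Y Z; h \<in> hom C Z W\<rbrakk> \<Longrightarrow> (h \<cdot> g) \<cdot> f = h \<cdot> (g \<cdot> f)"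
    and cmp_add_left: "\<lbrakk>X \<in> obj C; Y \<in> obj C; Z \<in> obj C;
        f \<in> hom C X Y; g \<in> hom C Y Z; g' \<in> hom C Y Z\<rbrakk> \<Longrightarrow> (g + g') \<cdot> f = g \<cdot> f + g' \<cdot> f"
    and cmp_add_right: "\<lbrakk>X \<in> obj C; Y \<in> obj C; Z \<in> obj C;
        f \<in> hom C X Y; f' \<in> hom C X Y; g \<in> hom C Y Z\<rbrakk> \<Longrightarrow> g \<cdot> (f + f') = g \<cdot> f + g \<cdot> f'"
    and cmp_scl_left: "\<lbrakk>X \<in> obj C; Y \<in> obj C; Z \<in> obj C; f \<in> hom C X Y; g \<in> hom C Y Z\<rbrakk>
      \<Longrightarrow> scl C c g \<cdot> f = scl C c (g \<cdot> f)"
    and cmp_scl_right: "\<lbrakk>X \<in> obj C; Y \<in> obj C; Z \<in> obj C; f \<in> hom C X Y; g \<in> hom C Y Z\<rbrakk>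
      \<Longrightarrow> g \<cdot> scl C c f = scl C c (g \<cdot> f)"

context
  fixes C :: "('o, 'm::ab_group_add, 'k::field, 'z) linear_category_scheme" (structure)
begin

definition inverse_of :: "'o \<Rightarrow> 'o \<Rightarrow> 'm \<Rightarrow> 'm \<Rightarrow> bool" where
  "inverse_of X Y f g \<longleftrightarrow> g \<in> hom C Y X \<and> g \<cdot> f = \<one> X \<and> f \<cdot> g = \<one> Y"

definition is_iso :: "'o \<Rightarrow> 'o \<Rightarrow> 'm \<Rightarrow> bool" where
  "is_iso X Y f \<longleftrightarrow> f \<in> hom C X Y \<and> (\<exists>g. inverse_of X Y f g)"

definition minv :: "'o \<Rightarrow> 'o \<Rightarrow> 'm \<Rightarrow> 'm" where
  "minv X Y f = (THE g. inverse_of X Y f g)"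

definition isomorphic :: "'o \<Rightarrow> 'o \<Rightarrow> bool" where
  "isomorphic X Y \<longleftrightarrow> (\<exists>f. is_iso X Y f)"

definition monic :: "'o \<Rightarrow> 'o \<Rightarrow> 'm \<Rightarrow> bool" where
  "monic X Y f \<longleftrightarrow> f \<in> hom C X Y \<and>
    (\<forall>Z\<in>obj C. \<forall>g\<in>hom C Z X. \<forall>h\<in>hom C Z X. f \<cdot> g = f \<cdot> h \<longrightarrow> g = h)"

definition epic :: "'o \<Rightarrow> 'o \<Rightarrow> 'm \<Rightarrow> bool" where
  "epic X Y f \<longleftrightarrow> f \<in> hom C X Y \<and>
    (\<forall>Z\<in>obj C. \<forall>g\<in>hom C Y Z. \<forall>h\<in>hom C Y Z. g \<cdot> f = h \<cdot> f \<longrightarrow> g = h)"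

definition is_kernel :: "'o \<Rightarrow> 'o \<Rightarrow> 'm \<Rightarrow> 'o \<Rightarrow> 'm \<Rightarrow> bool" where
  "is_kernel X Y f K k \<longleftrightarrow> K \<in> obj C \<and> k \<in> hom C K X \<and> f \<cdot> k = 0 \<and>
    (\<forall>Z\<in>obj C. \<forall>g\<in>hom C Z X. f \<cdot> g = 0 \<longrightarrow> (\<exists>!h. h \<in> hom C Z K \<and> k \<cdot> h = g))"

definition is_cokernel :: "'o \<Rightarrow> 'o \<Rightarrow> 'm \<Rightarrow> 'o \<Rightarrow> 'm \<Rightarrow> bool" where
  "is_cokernel X Y f Q q \<longleftrightarrow> Q \<in> obj C \<and> q \<in> hom C Y Q \<and> q \<cdot> f = 0 \<and>
    (\<forall>Z\<in>obj C. \<forall>g\<in>hom C Y Z. g \<cdot> f = 0 \<longrightarrow> (\<exists>!h. h \<in> hom C Q Z \<and> h \<cdot> q = g))"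

definition direct_sum :: "nat \<Rightarrow> (nat \<Rightarrow> 'o) \<Rightarrow> (nat \<Rightarrow> 'm) \<Rightarrow> (nat \<Rightarrow> 'm) \<Rightarrow> 'o \<Rightarrow> bool" where
  "direct_sum n S \<iota> \<pi> A \<longleftrightarrow> A \<in> obj C \<and>
    (\<forall>i<n. S i \<in> obj C \<and> \<iota> i \<in> hom C (S i) A \<and> \<pi> i \<in> hom C A (S i)) \<and>
    (\<forall>i<n. \<forall>j<n. \<pi> i \<cdot> \<iota> j = (if i = j then \<one> (S i) else 0)) \<and>
    (\<Sum>i<n. \<iota> i \<cdot> \<pi> i) = \<one> A"

definition simple :: "'o \<Rightarrow> bool" where
  "simple X \<longleftrightarrow> X \<in> obj C \<and> \<one> X \<noteq> 0 \<and>
    (\<forall>Y\<in>obj C. \<forall>f. monic Y X f \<longrightarrow> f = 0 \<or> is_iso Y X f)"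

definition isotypic_projection :: "'o \<Rightarrow> 'o \<Rightarrow> 'm \<Rightarrow> bool" where
  "isotypic_projection X A z \<longleftrightarrow> (\<exists>n S \<iota> \<pi>. direct_sum n S \<iota> \<pi> A \<and> (\<forall>i<n. simple (S i)) \<and>
    z = (\<Sum>i | i < n \<and> isomorphic (S i) X. \<iota> i \<cdot> \<pi> i))"

end

locale abelian_category = linear_category +
  assumes zero_object: "\<exists>X\<in>obj C. \<one> X = 0"
    and biproducts: "\<lbrakk>X \<in> obj C; Y \<in> obj C\<rbrakk>
      \<Longrightarrow> \<exists>\<iota> \<pi> A. direct_sum C 2 (\<lambda>i. if i = 0 then X else Y) \<iota> \<pi> A"
    and kernels: "\<lbrakk>X \<in> obj C; Y \<in> obj C; f \<in> hom C X Y\<rbrakk> \<Longrightarrow> \<exists>K k. is_kernel C X Y f K k"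
    and cokernels: "\<lbrakk>X \<in> obj C; Y \<in> obj C; f \<in> hom C X Y\<rbrakk> \<Longrightarrow> \<exists>Q q. is_cokernel C X Y f Q q"
    and mono_normal: "\<lbrakk>X \<in> obj C; Y \<in> obj C; monic C X Y f\<rbrakk>
      \<Longrightarrow> \<exists>Z\<in>obj C. \<exists>g\<in>hom C Y Z. is_kernel C Y Z g X f"
    and epi_normal: "\<lbrakk>X \<in> obj C; Y \<in> obj C; epic C X Y f\<rbrakk>
      \<Longrightarrow> \<exists>Z\<in>obj C. \<exists>g\<in>hom C Z X. is_cokernel C Z X g Y f"

text \<open>The empty direct sum is allowed: it is a zero object.\<close>

locale semisimple_category = abelian_category +
  assumes semisimple: "A \<in> obj C
    \<Longrightarrow> \<exists>n S \<iota> \<pi>. direct_sum C n S \<iota> \<pi> A \<and> (\<forall>i<n. simple C (S i))"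

definition lin_trace :: "('k::field \<Rightarrow> 'm::ab_group_add \<Rightarrow> 'm) \<Rightarrow> 'm set \<Rightarrow> ('m \<Rightarrow> 'm) \<Rightarrow> 'k" where
  "lin_trace s S f =
    (let B = (SOME B. B \<subseteq> S \<and> \<not> module.dependent s B \<and> S \<subseteq> module.span s B)
     in \<Sum>b\<in>B. module.representation s B (f b) b)"


section \<open>Monoidal and pivotal categories\<close>

text \<open>The associator is \<open>\<alpha> X Y Z : (X \<odot> Y) \<odot> Z \<rightarrow> X \<odot> (Y \<odot> Z)\<close>; the unit object is strict.\<close>

record ('o, 'm, 'k) monoidal_category = "('o, 'm, 'k) linear_category" +
  tens :: "'o \<Rightarrow> 'o \<Rightarrow> 'o" (infix \<open>\<odot>\<index>\<close> 70)
  tensm :: "'m \<Rightarrow> 'm \<Rightarrow> 'm" (infix \<open>\<otimes>\<index>\<close> 70)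
  unit :: 'o (\<open>\<I>\<index>\<close>)
  assoc :: "'o \<Rightarrow> 'o \<Rightarrow> 'o \<Rightarrow> 'm" (\<open>\<alpha>\<index>\<close>)

locale monoidal_category = linear_category C
  for C :: "('o, 'm::ab_group_add, 'k::field, 'z) monoidal_category_scheme" (structure) +
  assumes tens_obj: "\<lbrakk>X \<in> obj C; Y \<in> obj C\<rbrakk> \<Longrightarrow> X \<odot> Y \<in> obj C"
    and unit_obj: "\<I> \<in> obj C"
    and tensm_hom: "\<lbrakk>X \<in> obj C; Y \<in> obj C; X' \<in> obj C; Y' \<in> obj C;
        f \<in> hom C X Y; f' \<in> hom C X' Y'\<rbrakk> \<Longrightarrow> f \<otimes> f' \<in> hom C (X \<odot> X') (Y \<odot> Y')"
    and tensm_idn: "\<lbrakk>X \<in> obj C; Y \<in> obj C\<rbrakk> \<Longrightarrow> \<one> X \<otimes> \<one> Y = \<one> (X \<odot> Y)"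
    and tensm_cmp: "\<lbrakk>X \<in> obj C; Y \<in> obj C; Z \<in> obj C; X' \<in> obj C; Y' \<in> obj C; Z' \<in> obj C;
        f \<in> hom C X Y; g \<in> hom C Y Z; f' \<in> hom C X' Y'; g' \<in> hom C Y' Z'\<rbrakk>
      \<Longrightarrow> (g \<cdot> f) \<otimes> (g' \<cdot> f') = (g \<otimes> g') \<cdot> (f \<otimes> f')"
    and tensm_add_left: "\<lbrakk>X \<in> obj C; Y \<in> obj C; X' \<in> obj C; Y' \<in> obj C;
        f \<in> hom C X Y; g \<in> hom C X Y; h \<in> hom C X' Y'\<rbrakk> \<Longrightarrow> (f + g) \<otimes> h = f \<otimes> h + g \<otimes> h"
    and tensm_add_right: "\<lbrakk>X \<in> obj C; Y \<in> obj C; X' \<in> obj C; Y' \<in> obj C;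
        h \<in> hom C X Y; f \<in> hom C X' Y'; g \<in> hom C X' Y'\<rbrakk> \<Longrightarrow> h \<otimes> (f + g) = h \<otimes> f + h \<otimes> g"
    and tensm_scl_left: "\<lbrakk>X \<in> obj C; Y \<in> obj C; X' \<in> obj C; Y' \<in> obj C;
        f \<in> hom C X Y; g \<in> hom C X' Y'\<rbrakk> \<Longrightarrow> scl C c f \<otimes> g = scl C c (f \<otimes> g)"
    and tensm_scl_right: "\<lbrakk>X \<in> obj C; Y \<in> obj C; X' \<in> obj C; Y' \<in> obj C;
        f \<in> hom C X Y; g \<in> hom C X' Y'\<rbrakk> \<Longrightarrow> f \<otimes> scl C c g = scl C c (f \<otimes> g)"
    and tens_unit: "X \<in> obj C \<Longrightarrow> X \<odot> \<I> = X"
    and unit_tens: "X \<in> obj C \<Longrightarrow> \<I> \<odot> X = X"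
    and tensm_unit: "\<lbrakk>X \<in> obj C; Y \<in> obj C; f \<in> hom C X Y\<rbrakk> \<Longrightarrow> f \<otimes> \<one> \<I> = f"
    and unit_tensm: "\<lbrakk>X \<in> obj C; Y \<in> obj C; f \<in> hom C X Y\<rbrakk> \<Longrightarrow> \<one> \<I> \<otimes> f = f"
    and assoc_iso: "\<lbrakk>X \<in> obj C; Y \<in> obj C; Z \<in> obj C\<rbrakk>
      \<Longrightarrow> is_iso C ((X \<odot> Y) \<odot> Z) (X \<odot> (Y \<odot> Z)) (\<alpha> X Y Z)"
    and assoc_natural: "\<lbrakk>X \<in> obj C; Y \<in> obj C; Z \<in> obj C; X' \<in> obj C; Y' \<in> obj C; Z' \<in> obj C;
        f \<in> hom C X X'; g \<in> hom C Y Y'; h \<in> hom C Z Z'\<rbrakk>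
      \<Longrightarrow> \<alpha> X' Y' Z' \<cdot> ((f \<otimes> g) \<otimes> h) = (f \<otimes> (g \<otimes> h)) \<cdot> \<alpha> X Y Z"
    and pentagon: "\<lbrakk>W \<in> obj C; X \<in> obj C; Y \<in> obj C; Z \<in> obj C\<rbrakk>
      \<Longrightarrow> \<alpha> W X (Y \<odot> Z) \<cdot> \<alpha> (W \<odot> X) Y Z
        = (\<one> W \<otimes> \<alpha> X Y Z) \<cdot> \<alpha> W (X \<odot> Y) Z \<cdot> (\<alpha> W X Y \<otimes> \<one> Z)"
    and triangle: "\<lbrakk>X \<in> obj C; Y \<in> obj C\<rbrakk> \<Longrightarrow> \<alpha> X \<I> Y = \<one> (X \<odot> Y)"

definition iassoc ::
  "('o, 'm::ab_group_add, 'k::field, 'z) monoidal_category_scheme \<Rightarrow> 'o \<Rightarrow> 'o \<Rightarrow> 'o \<Rightarrow> 'm"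
  (\<open>\<alpha>''\<index>\<close>) where
  "iassoc C X Y Z = minv C (tens C (tens C X Y) Z) (tens C X (tens C Y Z)) (assoc C X Y Z)"

text \<open>
  \<open>piv X : X \<rightarrow> dual (dual X)\<close> is the pivotal structure.
\<close>

record ('o, 'm, 'k) pivotal_category = "('o, 'm, 'k) monoidal_category" +
  dual :: "'o \<Rightarrow> 'o"
  ev :: "'o \<Rightarrow> 'm"
  db :: "'o \<Rightarrow> 'm"
  piv :: "'o \<Rightarrow> 'm"

locale left_rigid_category = monoidal_category C
  for C :: "('o, 'm::ab_group_add, 'k::field, 'z) pivotal_category_scheme" (structure) +
  assumes dual_obj: "X \<in> obj C \<Longrightarrow> dual C X \<in> obj C"
    and ev_hom: "X \<in> obj C \<Longrightarrow> ev C X \<in> hom C (dual C X \<odot> X) \<I>"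
    and db_hom: "X \<in> obj C \<Longrightarrow> db C X \<in> hom C \<I> (X \<odot> dual C X)"
    and zigzag1: "X \<in> obj C
      \<Longrightarrow> (\<one> X \<otimes> ev C X) \<cdot> \<alpha> X (dual C X) X \<cdot> (db C X \<otimes> \<one> X) = \<one> X"
    and zigzag2: "X \<in> obj C
      \<Longrightarrow> (ev C X \<otimes> \<one> (dual C X)) \<cdot> \<alpha>' (dual C X) X (dual C X) \<cdot> (\<one> (dual C X) \<otimes> db C X)
        = \<one> (dual C X)"

context
  fixes C :: "('o, 'm::ab_group_add, 'k::field, 'z) pivotal_category_scheme" (structure)
begin

definition dualm :: "'o \<Rightarrow> 'o \<Rightarrow> 'm \<Rightarrow> 'm" where
  "dualm X Y f = (ev C Y \<otimes> \<one> (dual C X)) \<cdot> ((\<one> (dual C Y) \<otimes> f) \<otimes> \<one> (dual C X))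
    \<cdot> \<alpha>' (dual C Y) X (dual C X) \<cdot> (\<one> (dual C Y) \<otimes> db C X)"

text \<open>
  For \<open>e : A \<odot> X \<rightarrow> \<I>\<close> the evaluation of a left dual \<open>A\<close> of \<open>X\<close>, this is the unique
  \<open>\<theta> : A \<rightarrow> dual X\<close> with \<open>ev X \<cdot> (\<theta> \<otimes> X) = e\<close>.
\<close>

definition dual_comparison :: "'o \<Rightarrow> 'o \<Rightarrow> 'm \<Rightarrow> 'm" where
  "dual_comparison X A e =
    (e \<otimes> \<one> (dual C X)) \<cdot> \<alpha>' A X (dual C X) \<cdot> (\<one> A \<otimes> db C X)"

definition ev_tens :: "'o \<Rightarrow> 'o \<Rightarrow> 'm" where
  "ev_tens X Y = ev C Y \<cdot> (\<one> (dual C Y) \<otimes> ((ev C X \<otimes> \<one> Y) \<cdot> \<alpha>' (dual C X) X Y))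
    \<cdot> \<alpha> (dual C Y) (dual C X) (X \<odot> Y)"

text \<open>The canonical isomorphism \<open>dual Y \<odot> dual X \<rightarrow> dual (X \<odot> Y)\<close>.\<close>

definition dual_tens :: "'o \<Rightarrow> 'o \<Rightarrow> 'm" where
  "dual_tens X Y = dual_comparison (X \<odot> Y) (dual C Y \<odot> dual C X) (ev_tens X Y)"

text \<open>
  The monoidal structure of the double dual functor: \<open>ddual_tens X Y\<close> maps
  \<open>dual (dual X) \<odot> dual (dual Y)\<close> via \<open>dual (dual Y \<odot> dual X)\<close> to \<open>dual (dual (X \<odot> Y))\<close>, and
  \<open>ddual_unit\<close> maps \<open>\<I>\<close> via \<open>dual \<I>\<close> to \<open>dual (dual \<I>)\<close>. Since the unit is strict, \<open>db \<I>\<close> and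
  \<open>ev \<I>\<close> are mutually inverse isomorphisms between \<open>\<I>\<close> and \<open>dual \<I>\<close>.
\<close>

definition ddual_tens :: "'o \<Rightarrow> 'o \<Rightarrow> 'm" where
  "ddual_tens X Y =
    dualm (dual C (X \<odot> Y)) (dual C Y \<odot> dual C X)
      (minv C (dual C Y \<odot> dual C X) (dual C (X \<odot> Y)) (dual_tens X Y))
    \<cdot> dual_tens (dual C Y) (dual C X)"

definition ddual_unit :: 'm where
  "ddual_unit = dualm (dual C \<I>) \<I> (ev C \<I>) \<cdot> db C \<I>"

definition piv_inv :: "'o \<Rightarrow> 'm" where
  "piv_inv X = minv C X (dual C (dual C X)) (piv C X)"

definition ev_bar :: "'o \<Rightarrow> 'm" where
  "ev_bar X = ev C (dual C X) \<cdot> (piv C X \<otimes> \<one> (dual C X))"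

definition db_bar :: "'o \<Rightarrow> 'm" where
  "db_bar X = (\<one> (dual C X) \<otimes> piv_inv X) \<cdot> db C (dual C X)"

definition ptr_right :: "'o \<Rightarrow> 'm \<Rightarrow> 'm" where
  "ptr_right X f = ev_bar X \<cdot> (f \<otimes> \<one> (dual C X)) \<cdot> db C X"

definition ptr_left :: "'o \<Rightarrow> 'm \<Rightarrow> 'm" where
  "ptr_left X f = ev C X \<cdot> (\<one> (dual C X) \<otimes> f) \<cdot> db_bar X"

text \<open>The scalar value of the (right) pivotal trace, under the identification of \<open>End \<I>\<close> with the base field.\<close>

definition ptr :: "'o \<Rightarrow> 'm \<Rightarrow> 'k" where
  "ptr X f = (THE c. ptr_right X f = scl C c (\<one> \<I>))"

definition qdim :: "'o \<Rightarrow> 'k" where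
  "qdim X = ptr X (\<one> X)"

end

locale pivotal_category = left_rigid_category +
  assumes piv_iso: "X \<in> obj C \<Longrightarrow> is_iso C X (dual C (dual C X)) (piv C X)"
    and piv_natural: "\<lbrakk>X \<in> obj C; Y \<in> obj C; f \<in> hom C X Y\<rbrakk>
      \<Longrightarrow> piv C Y \<cdot> f = dualm C (dual C Y) (dual C X) (dualm C X Y f) \<cdot> piv C X"
    and piv_tens: "\<lbrakk>X \<in> obj C; Y \<in> obj C\<rbrakk>
      \<Longrightarrow> piv C (X \<odot> Y) = ddual_tens C X Y \<cdot> (piv C X \<otimes> piv C Y)"
    and piv_unit: "piv C \<I> = ddual_unit C"

locale spherical_category = pivotal_category +
  assumes spherical: "\<lbrakk>X \<in> obj C; f \<in> hom C X X\<rbrakk> \<Longrightarrow> ptr_right C X f = ptr_left C X f"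

locale fusion_category = left_rigid_category + semisimple_category +
  assumes hom_findim: "\<lbrakk>X \<in> obj C; Y \<in> obj C\<rbrakk>
      \<Longrightarrow> \<exists>B. finite B \<and> hom C X Y = module.span (scl C) B"
    and unit_simple: "simple C \<I>"
    and finitely_many_simples: "\<exists>S. finite S \<and> S \<subseteq> obj C \<and>
      (\<forall>X. simple C X \<longrightarrow> (\<exists>Y\<in>S. isomorphic C X Y))"

locale spherical_fusion_category = spherical_category + fusion_category


section \<open>The center\<close>

context
  fixes C :: "('o, 'm::ab_group_add, 'k::field) pivotal_category" (structure)
begin

text \<open>Half-braidings are extensional, so that they are determined by their values on objects of \<open>C\<close>.\<close>

definition half_braiding :: "'o \<Rightarrow> ('o \<Rightarrow> 'm) \<Rightarrow> bool" where
  "half_braiding X \<sigma> \<longleftrightarrow> \<sigma> \<in> extensional (obj C) \<and>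
    (\<forall>V\<in>obj C. is_iso C (X \<odot> V) (V \<odot> X) (\<sigma> V)) \<and>
    (\<forall>V\<in>obj C. \<forall>W\<in>obj C. \<forall>f\<in>hom C V W. \<sigma> W \<cdot> (\<one> X \<otimes> f) = (f \<otimes> \<one> X) \<cdot> \<sigma> V) \<and>
    \<sigma> \<I> = \<one> X \<and>
    (\<forall>V\<in>obj C. \<forall>W\<in>obj C.
      \<sigma> (V \<odot> W) = \<alpha>' V W X \<cdot> (\<one> V \<otimes> \<sigma> W) \<cdot> \<alpha> V X W \<cdot> (\<sigma> V \<otimes> \<one> W) \<cdot> \<alpha>' X V W)"

definition tens_half_braiding :: "'o \<Rightarrow> ('o \<Rightarrow> 'm) \<Rightarrow> 'o \<Rightarrow> ('o \<Rightarrow> 'm) \<Rightarrow> 'o \<Rightarrow> 'm" where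
  "tens_half_braiding X \<sigma> Y \<tau> = (\<lambda>V\<in>obj C.
    \<alpha> V X Y \<cdot> (\<sigma> V \<otimes> \<one> Y) \<cdot> \<alpha>' X V Y \<cdot> (\<one> X \<otimes> \<tau> V) \<cdot> \<alpha> X Y V)"

text \<open>
  Up to associators, this is \<open>(ev \<otimes> V \<otimes> X\<^sup>\<or>) (X\<^sup>\<or> \<otimes> \<sigma>(V)\<^sup>-\<^sup>1 \<otimes> X\<^sup>\<or>) (X\<^sup>\<or> \<otimes> V \<otimes> db)\<close>.
\<close>

definition dual_half_braiding :: "'o \<Rightarrow> ('o \<Rightarrow> 'm) \<Rightarrow> 'o \<Rightarrow> 'm" where
  "dual_half_braiding X \<sigma> = (\<lambda>V\<in>obj C. let X' = dual C X in
    ((ev C X \<otimes> \<one> V) \<otimes> \<one> X')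
    \<cdot> (\<alpha>' X' X V \<otimes> \<one> X')
    \<cdot> ((\<one> X' \<otimes> minv C (X \<odot> V) (V \<odot> X) (\<sigma> V)) \<otimes> \<one> X')
    \<cdot> (\<alpha> X' V X \<otimes> \<one> X')
    \<cdot> \<alpha>' (X' \<odot> V) X X'
    \<cdot> (\<one> (X' \<odot> V) \<otimes> db C X))"

definition center :: "('o \<times> ('o \<Rightarrow> 'm), 'm, 'k) pivotal_category" where
  "center = \<lparr>
    obj = {(X, \<sigma>). X \<in> obj C \<and> half_braiding X \<sigma>},
    hom = (\<lambda>(X, \<sigma>) (Y, \<tau>).
      {f \<in> hom C X Y. \<forall>V\<in>obj C. (\<one> V \<otimes> f) \<cdot> \<sigma> V = \<tau> V \<cdot> (f \<otimes> \<one> V)}),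
    cmp = cmp C,
    idn = (\<lambda>(X, \<sigma>). \<one> X),
    scl = scl C,
    tens = (\<lambda>(X, \<sigma>) (Y, \<tau>). (X \<odot> Y, tens_half_braiding X \<sigma> Y \<tau>)),
    tensm = tensm C,
    unit = (\<I>, \<lambda>V\<in>obj C. \<one> V),
    assoc = (\<lambda>(X, _) (Y, _) (Z, _). \<alpha> X Y Z),
    dual = (\<lambda>(X, \<sigma>). (dual C X, dual_half_braiding X \<sigma>)),
    ev = (\<lambda>(X, _). ev C X),
    db = (\<lambda>(X, _). db C X),
    piv = (\<lambda>(X, _). piv C X)\<rparr>"

end


section \<open>Functors and adjunctions\<close>

locale category_functor = A: linear_category A + B: linear_category B
  for A :: "('a, 'm::ab_group_add, 'k::field, 'x) linear_category_scheme" (structure)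
    and B :: "('b, 'n::ab_group_add, 'k, 'y) linear_category_scheme" (structure) +
  fixes F :: "'a \<Rightarrow> 'b" and Fm :: "'a \<Rightarrow> 'a \<Rightarrow> 'm \<Rightarrow> 'n"
  assumes F_obj: "X \<in> obj A \<Longrightarrow> F X \<in> obj B"
    and Fm_hom: "\<lbrakk>X \<in> obj A; Y \<in> obj A; f \<in> hom A X Y\<rbrakk> \<Longrightarrow> Fm X Y f \<in> hom B (F X) (F Y)"
    and Fm_idn: "X \<in> obj A \<Longrightarrow> Fm X X (idn A X) = idn B (F X)"
    and Fm_cmp: "\<lbrakk>X \<in> obj A; Y \<in> obj A; Z \<in> obj A; f \<in> hom A X Y; g \<in> hom A Y Z\<rbrakk>
      \<Longrightarrow> Fm X Z (cmp A g f) = cmp B (Fm Y Z g) (Fm X Y f)"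

text \<open>\<open>\<Psi> X W : A(X, G W) \<rightarrow> B(F X, W)\<close> exhibits \<open>F\<close> as left adjoint to \<open>G\<close>.\<close>

locale adjunction = F: category_functor A B F Fm + G: category_functor B A G Gm
  for A :: "('a, 'm::ab_group_add, 'k::field, 'x) linear_category_scheme"
    and B :: "('b, 'n::ab_group_add, 'k, 'y) linear_category_scheme"
    and F :: "'a \<Rightarrow> 'b" and Fm :: "'a \<Rightarrow> 'a \<Rightarrow> 'm \<Rightarrow> 'n"
    and G :: "'b \<Rightarrow> 'a" and Gm :: "'b \<Rightarrow> 'b \<Rightarrow> 'n \<Rightarrow> 'm" +
  fixes \<Psi> :: "'a \<Rightarrow> 'b \<Rightarrow> 'm \<Rightarrow> 'n"
  assumes adj_bij: "\<lbrakk>X \<in> obj A; W \<in> obj B\<rbrakk>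
      \<Longrightarrow> bij_betw (\<Psi> X W) (hom A X (G W)) (hom B (F X) W)"
    and adj_natural: "\<lbrakk>X \<in> obj A; X' \<in> obj A; W \<in> obj B; W' \<in> obj B;
        f \<in> hom A X (G W); g \<in> hom A X' X; h \<in> hom B W W'\<rbrakk>
      \<Longrightarrow> \<Psi> X' W' (cmp A (Gm W W' h) (cmp A f g)) = cmp B h (cmp B (\<Psi> X W f) (Fm X' X g))"

text \<open>\<open>K\<close> is a right adjoint (via \<open>\<Psi>\<close>) and a left adjoint (via \<open>\<Theta>\<close>) of the forgetful functor.\<close>

definition two_sided_adjoint_of_forgetful ::
  "('o, 'm::ab_group_add, 'k::field) pivotal_category
    \<Rightarrow> ('o \<Rightarrow> 'o \<times> ('o \<Rightarrow> 'm)) \<Rightarrow> ('o \<Rightarrow> 'o \<Rightarrow> 'm \<Rightarrow> 'm)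
    \<Rightarrow> ('o \<times> ('o \<Rightarrow> 'm) \<Rightarrow> 'o \<Rightarrow> 'm \<Rightarrow> 'm) \<Rightarrow> bool" where
  "two_sided_adjoint_of_forgetful C K Km \<Psi> \<longleftrightarrow>
    adjunction (center C) C fst (\<lambda>_ _ f. f) K Km \<Psi> \<and>
    (\<exists>\<Theta>. adjunction C (center C) K Km fst (\<lambda>_ _ f. f) \<Theta>)"


section \<open>Generalized Frobenius--Schur indicators\<close>

context
  fixes C :: "('o, 'm::ab_group_add, 'k::field) pivotal_category" (structure)
begin

fun npow :: "'o \<Rightarrow> nat \<Rightarrow> 'o" where
  "npow V 0 = \<I>"
| "npow V (Suc n) = V \<odot> npow V n"

fun npowm :: "'m \<Rightarrow> nat \<Rightarrow> 'm" where
  "npowm f 0 = \<one> \<I>"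
| "npowm f (Suc n) = f \<otimes> npowm f n"

definition vpow :: "'o \<Rightarrow> int \<Rightarrow> 'o" where
  "vpow V m = (if m \<ge> 0 then npow V (nat m) else npow (dual C V) (nat (- m)))"

text \<open>The composite of associators \<open>V\<^sup>a \<odot> V\<^sup>b \<rightarrow> V\<^sup>a\<^sup>+\<^sup>b\<close>.\<close>

fun npow_merge :: "'o \<Rightarrow> nat \<Rightarrow> nat \<Rightarrow> 'm" where
  "npow_merge V 0 b = \<one> (npow V b)"
| "npow_merge V (Suc a) b = (\<one> V \<otimes> npow_merge V a b) \<cdot> \<alpha> V (npow V a) (npow V b)"

text \<open>
  The rebracketing \<open>V\<^sup>a \<odot> V\<^sup>b \<rightarrow> V\<^sup>a\<^sup>+\<^sup>b = V\<^sup>b\<^sup>+\<^sup>a \<rightarrow> V\<^sup>b \<odot> V\<^sup>a\<close>; no braiding is involved.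
\<close>

definition npow_regroup :: "'o \<Rightarrow> nat \<Rightarrow> nat \<Rightarrow> 'm" where
  "npow_regroup V a b =
    minv C (npow V b \<odot> npow V a) (npow V (b + a)) (npow_merge V b a) \<cdot> npow_merge V a b"

text \<open>For exponents \<open>i\<close> and \<open>j\<close> of the same sign.\<close>

definition vpow_regroup :: "'o \<Rightarrow> int \<Rightarrow> int \<Rightarrow> 'm" where
  "vpow_regroup V i j =
    (if i \<ge> 0 \<and> j \<ge> 0 then npow_regroup V (nat i) (nat j)
     else npow_regroup (dual C V) (nat (- i)) (nat (- j)))"

text \<open>
  The canonical isomorphism \<open>(V\<^sup>\<or>)\<^sup>n \<rightarrow> (V\<^sup>n)\<^sup>\<or>\<close>, using
  \<open>V\<^sup>\<or> \<odot> (V\<^sup>\<or>)\<^sup>n \<rightarrow> (V\<^sup>\<or>)\<^sup>n \<odot> V\<^sup>\<or> \<rightarrow> (V\<^sup>n)\<^sup>\<or> \<odot> V\<^sup>\<or> \<rightarrow> (V \<odot> V\<^sup>n)\<^sup>\<or>\<close> in the inductive step.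
\<close>

fun npow_dual :: "'o \<Rightarrow> nat \<Rightarrow> 'm" where
  "npow_dual V 0 = db C \<I>"
| "npow_dual V (Suc n) = dual_tens C V (npow V n) \<cdot> (npow_dual V n \<otimes> \<one> (dual C V))
    \<cdot> npow_regroup (dual C V) 1 n"

text \<open>
  The canonical isomorphism \<open>V\<^sup>-\<^sup>m \<rightarrow> (V\<^sup>m)\<^sup>\<or>\<close>; for \<open>m = -n < 0\<close> it is
  \<open>V\<^sup>n \<rightarrow> (V\<^sup>\<or>\<^sup>\<or>)\<^sup>n \<rightarrow> ((V\<^sup>\<or>)\<^sup>n)\<^sup>\<or>\<close>.
\<close>

definition vpow_dual :: "'o \<Rightarrow> int \<Rightarrow> 'm" where
  "vpow_dual V m =
    (if m \<ge> 0 then npow_dual V (nat m)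
     else npow_dual (dual C V) (nat (- m)) \<cdot> npowm (piv C V) (nat (- m)))"

definition ev_pow :: "'o \<Rightarrow> int \<Rightarrow> 'm" where
  "ev_pow V m = ev C (vpow V m) \<cdot> (vpow_dual V m \<otimes> \<one> (vpow V m))"

definition db_pow :: "'o \<Rightarrow> int \<Rightarrow> 'm" where
  "db_pow V m =
    (\<one> (vpow V m) \<otimes> minv C (vpow V (- m)) (dual C (vpow V m)) (vpow_dual V m)) \<cdot> db C (vpow V m)"

text \<open>
  \<open>J_map V m l : (V\<^sup>-\<^sup>l \<odot> V\<^sup>m) \<odot> V\<^sup>l \<rightarrow> V\<^sup>m\<close>. For \<open>m l = 0\<close> the two defining clauses agree (by coherence).
\<close>

definition J_map :: "'o \<Rightarrow> int \<Rightarrow> int \<Rightarrow> 'm" where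
  "J_map V m l = (let P = vpow V m; Q = vpow V l; Q' = vpow V (- l) in
    if m * l \<ge> 0
    then (ev_pow V l \<otimes> \<one> P) \<cdot> \<alpha>' Q' Q P \<cdot> (\<one> Q' \<otimes> vpow_regroup V m l) \<cdot> \<alpha> Q' P Q
    else (\<one> P \<otimes> ev_pow V l) \<cdot> \<alpha> P Q' Q \<cdot> (vpow_regroup V (- l) m \<otimes> \<one> Q))"

definition E_map :: "'o \<times> ('o \<Rightarrow> 'm) \<Rightarrow> 'o \<Rightarrow> int \<Rightarrow> int \<Rightarrow> 'm \<Rightarrow> 'm" where
  "E_map \<X> V m l f = (let X = fst \<X>; \<sigma> = snd \<X>; Q = vpow V l; Q' = vpow V (- l) in
    J_map V m l \<cdot> ((\<one> Q' \<otimes> f) \<otimes> \<one> Q) \<cdot> (\<sigma> Q' \<otimes> \<one> Q) \<cdot> \<alpha>' X Q' Q \<cdot> (\<one> X \<otimes> db_pow V (- l)))"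

definition fs_indicator :: "'o \<times> ('o \<Rightarrow> 'm) \<Rightarrow> 'o \<Rightarrow> int \<Rightarrow> int \<Rightarrow> 'k" where
  "fs_indicator \<X> V m l = lin_trace (scl C) (hom C (fst \<X>) (vpow V m)) (E_map \<X> V m l)"

definition kappa :: "('o \<Rightarrow> 'o \<times> ('o \<Rightarrow> 'm)) \<Rightarrow> ('o \<times> ('o \<Rightarrow> 'm) \<Rightarrow> 'o \<Rightarrow> 'm \<Rightarrow> 'm)
    \<Rightarrow> 'o \<Rightarrow> int \<Rightarrow> int \<Rightarrow> 'm" where
  "kappa K \<Psi> V m l = (let W = vpow V m; \<A> = K W; \<D> = center C in
    inv_into (hom \<D> \<A> \<A>) (\<Psi> \<A> W) (E_map \<A> V m l (\<Psi> \<A> W (idn \<D> \<A>))))"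

end

end

theory Submission
  imports Defs
begin

text \<open>
  The indicator is the trace of \<open>E\<close> on \<open>C(X, V\<^sup>m)\<close>. By naturality of the adjunction, every morphism
  \<open>X \<rightarrow> V\<^sup>m\<close> is \<open>\<psi> u\<close> for a unique central \<open>u : X \<rightarrow> K(V\<^sup>m)\<close>, where \<open>\<psi>\<close> corresponds to the identity of
  \<open>K(V\<^sup>m)\<close>. The operator \<open>E\<close> is natural with respect to central morphisms (\<open>E_map_natural\<close>), so
  \<open>E(\<psi> u) = E(\<psi>) u = \<psi> \<kappa> u\<close>: the indicator is the trace of composition with \<open>\<kappa>\<close> on \<open>Z(C)(X, K(V\<^sup>m))\<close>.
  Decompose \<open>K(V\<^sup>m)\<close> into simple objects \<open>S\<^sub>i\<close> of the center. By Schur's lemma there, the trace is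
  the sum of the scalars \<open>c\<^sub>i\<close> by which \<open>\<kappa>\<close> acts on the diagonal at the summands \<open>S\<^sub>i \<cong> X\<close>, while
  cyclicity of the pivotal trace gives \<open>ptr (\<kappa> z) = \<Sum> c\<^sub>i d(S\<^sub>i) = d(X) \<Sum> c\<^sub>i\<close>.

  Two facts about the center carry the rest. Schur's lemma needs kernels: a kernel in \<open>C\<close> of a central
  morphism splits and inherits the half braiding (\<open>center_kernel\<close>). Division needs \<open>d(X) \<noteq> 0\<close>
  (\<open>center_qdim_nonzero\<close>), and this is the deeper part. For an endomorphism \<open>w\<close> of the underlying
  object, surround \<open>w\<close> by loops coloured by the simple objects of \<open>C\<close>, weighted by their dimensions. The
  result is central (\<open>avg_central\<close>), hence a scalar \<open>c\<close> times the identity, and its trace is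
  \<open>gdim\<close> times the trace of \<open>w\<close>, where \<open>gdim = \<Sum> d(V)\<^sup>2\<close> is the global dimension (\<open>tr_avg\<close>). So
  \<open>c d(X) = gdim \<cdot> tr w\<close>, and \<open>w\<close> can be chosen with nonzero trace (\<open>trace_nondegenerate\<close>).

  Centrality is the handle slide. It rests on the resolution of the identity of \<open>W \<otimes> V\<close> by rotated
  summands of \<open>W\<^sup>\<or> \<otimes> V'\<close> (\<open>rotated_resolution\<close>). Taking traces of the decomposition of
  \<open>W\<^sup>\<or> \<otimes> V'\<close> and of this resolution gives two fusion rules, and from them \<open>gdim \<noteq> 0\<close> in characteristic
  zero (\<open>gdim_nonzero\<close>).

  Everything about traces reduces to three facts: the pivotal trace is cyclic (\<open>TrA_cyclic\<close>); the trace
  over a tensor product is an iterated partial trace (\<open>TrA_pR\<close>, \<open>TrA_pL\<close>), by monoidality of the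
  pivotal structure and sphericity; and a strand \<open>W\<^sup>\<or>\<close> may be closed with \<open>W\<close> on either side
  (\<open>EV_eq_Evb\<close>, \<open>pL_dual\<close>). These are proved as string diagrams, in a calculus of right-nested
  tensor products in which associators occur only where a diagram is regrouped.
\<close>

section \<open>Linear algebra\<close>

lemma additive_on_subspace_sum:
  assumes "vector_space s" and S: "module.subspace s S" and "\<And>i. i \<in> I \<Longrightarrow> e i \<in> S"
    and add: "\<And>x y. x \<in> S \<Longrightarrow> y \<in> S \<Longrightarrow> f (x + y) = f x + f y"
    and scale: "\<And>c x. x \<in> S \<Longrightarrow> f (s c x) = t c (f x)" and t0: "\<And>x. t 0 x = (0::'b::comm_monoid_add)"
  shows "f (\<Sum>i\<in>I. s (c i) (e i)) = (\<Sum>i\<in>I. t (c i) (f (e i)))"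
proof -
  interpret vector_space s by fact
  have f0: "f 0 = 0" using scale[of 0 0] t0 subspace_0[OF S] by simp
  show ?thesis using assms(3)
  proof (induction I rule: infinite_finite_induct)
    case (insert j J)
    have "(\<Sum>i\<in>J. s (c i) (e i)) \<in> S"
      using insert.prems S by (auto intro!: subspace_sum subspace_scale)
    moreover have "s (c j) (e j) \<in> S" using insert.prems S by (auto intro: subspace_scale)
    ultimately show ?case using insert by (simp add: add scale)
  qed (auto simp: f0)
qed

text \<open>Coordinates \<open>x = \<Sum> \<xi> i x \<cdot> e i\<close> and the basis hidden in \<open>lin_trace\<close> present the map as products
  \<open>A B\<close> and \<open>B A\<close> of the same two rectangular matrices, which have the same trace.\<close>

lemma lin_trace_coords:
  fixes s :: "'k::field \<Rightarrow> 'm::ab_group_add \<Rightarrow> 'm" and \<xi> :: "'i \<Rightarrow> 'm \<Rightarrow> 'k"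
  assumes vs: "vector_space s" and S: "module.subspace s S" and I: "finite I"
    and e: "\<And>i. i \<in> I \<Longrightarrow> e i \<in> S"
    and coords: "\<And>x. x \<in> S \<Longrightarrow> x = (\<Sum>i\<in>I. s (\<xi> i x) (e i))"
    and \<xi>_add: "\<And>i x y. i \<in> I \<Longrightarrow> x \<in> S \<Longrightarrow> y \<in> S \<Longrightarrow> \<xi> i (x + y) = \<xi> i x + \<xi> i y"
    and \<xi>_scale: "\<And>i c x. i \<in> I \<Longrightarrow> x \<in> S \<Longrightarrow> \<xi> i (s c x) = c * \<xi> i x"
    and f: "\<And>x. x \<in> S \<Longrightarrow> f x \<in> S"
    and f_add: "\<And>x y. x \<in> S \<Longrightarrow> y \<in> S \<Longrightarrow> f (x + y) = f x + f y"
    and f_scale: "\<And>c x. x \<in> S \<Longrightarrow> f (s c x) = s c (f x)"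
  shows "lin_trace s S f = (\<Sum>i\<in>I. \<xi> i (f (e i)))"
proof -
  interpret vector_space s by fact
  define B where "B = (SOME B. B \<subseteq> S \<and> \<not> dependent B \<and> S \<subseteq> span B)"
  have "\<exists>B. B \<subseteq> S \<and> \<not> dependent B \<and> S \<subseteq> span B"
    using basis_exists[of S] by metis
  then have B: "B \<subseteq> S" "independent B" "S \<subseteq> span B"
    unfolding B_def by (metis (mono_tags, lifting) someI_ex)+
  have "S \<subseteq> span (e ` I)"
  proof
    fix x assume "x \<in> S"
    then show "x \<in> span (e ` I)"
      by (subst coords) (auto intro: span_sum span_scale span_base)
  qed
  with B have finB: "finite B"
    by (meson I finite_imageI independent_span_bound subset_trans)
  define r where "r = representation B"
  have "lin_trace s S f = (\<Sum>b\<in>B. r (f b) b)"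
    unfolding lin_trace_def Let_def B_def r_def ..
  also have "\<dots> = (\<Sum>b\<in>B. \<Sum>i\<in>I. \<xi> i (f b) * r (e i) b)"
  proof (rule sum.cong[OF refl])
    fix b assume "b \<in> B"
    have "r (f b) b = r (\<Sum>i\<in>I. s (\<xi> i (f b)) (e i)) b"
      using coords[OF f[of b]] \<open>b \<in> B\<close> B(1) by auto
    also have "\<dots> = (\<Sum>i\<in>I. \<xi> i (f b) * r (e i) b)"
      using B e unfolding r_def
      by (subst additive_on_subspace_sum[where f = "\<lambda>x. representation B x b" and S = "span B" and t = "(*)"])
        (auto simp: representation_add representation_scale vs intro: S)
    finally show "r (f b) b = (\<Sum>i\<in>I. \<xi> i (f b) * r (e i) b)" .
  qed
  also have "\<dots> = (\<Sum>i\<in>I. \<Sum>b\<in>B. r (e i) b * \<xi> i (f b))"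
    by (subst sum.swap) (simp add: mult.commute)
  also have "\<dots> = (\<Sum>i\<in>I. \<xi> i (f (e i)))"
  proof (rule sum.cong[OF refl])
    fix i assume i: "i \<in> I"
    have "(\<Sum>b\<in>B. s (r (e i) b) b) = e i"
      unfolding r_def using finB B e[OF i] by (intro sum_representation_eq) auto
    then have "\<xi> i (f (e i)) = \<xi> i (f (\<Sum>b\<in>B. s (r (e i) b) b))" by simp
    also have "\<dots> = (\<Sum>b\<in>B. r (e i) b * \<xi> i (f b))"
      using B i by (subst additive_on_subspace_sum[where f = "\<lambda>x. \<xi> i (f x)" and S = S and t = "(*)"])
         (auto simp: vs S f_add f_scale \<xi>_add \<xi>_scale f)
    finally show "(\<Sum>b\<in>B. r (e i) b * \<xi> i (f b)) = \<xi> i (f (e i))" ..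
  qed
  finally show ?thesis .
qed

text \<open>A field of characteristic zero is a rational vector space, and \<open>1\<close> extends to a basis of it. The
  resulting functional transports linear relations with integer coefficients to the ordered field of
  rational numbers, where a vanishing sum of squares is informative.\<close>

lemma rational_functional:
  obtains \<phi> :: "'k::field_char_0 \<Rightarrow> rat"
  where "\<And>x y. \<phi> (x + y) = \<phi> x + \<phi> y" and "\<And>n x. \<phi> (of_nat n * x) = of_nat n * \<phi> x" and "\<phi> 1 = 1"
proof -
  interpret vector_space_pair "\<lambda>q (x::'k). of_rat q * x" "(*) :: rat \<Rightarrow> rat \<Rightarrow> rat"
    by unfold_locales (auto simp: algebra_simps of_rat_add of_rat_mult)
  have "vs1.independent {1 :: 'k}" by simp
  then obtain g where g: "Vector_Spaces.linear (\<lambda>q (x::'k). of_rat q * x) ((*) :: rat \<Rightarrow> rat \<Rightarrow> rat) g" "g 1 = 1"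
    using linear_independent_extend[of "{1}" "\<lambda>_. 1"] by auto
  interpret g: Vector_Spaces.linear "\<lambda>q (x::'k). of_rat q * x" "(*) :: rat \<Rightarrow> rat \<Rightarrow> rat" g by fact
  show thesis
  proof
    show "g (x + y) = g x + g y" for x y by (rule g.add)
    show "g (of_nat n * x) = of_nat n * g x" for n x using g.scale[of "of_nat n" x] by simp
    show "g 1 = 1" by (rule g(2))
  qed
qed

section \<open>Linear categories\<close>

context linear_category
begin

sublocale vs: vector_space "scl C" by (rule scl_vector_space)

lemma hom_zero: "\<lbrakk>X \<in> obj C; Y \<in> obj C\<rbrakk> \<Longrightarrow> 0 \<in> hom C X Y"
  and hom_add: "\<lbrakk>X \<in> obj C; Y \<in> obj C; f \<in> hom C X Y; g \<in> hom C X Y\<rbrakk> \<Longrightarrow> f + g \<in> hom C X Y"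
  and hom_diff: "\<lbrakk>X \<in> obj C; Y \<in> obj C; f \<in> hom C X Y; g \<in> hom C X Y\<rbrakk> \<Longrightarrow> f - g \<in> hom C X Y"
  and hom_scl: "\<lbrakk>X \<in> obj C; Y \<in> obj C; f \<in> hom C X Y\<rbrakk> \<Longrightarrow> scl C c f \<in> hom C X Y"
  and hom_sum: "\<lbrakk>X \<in> obj C; Y \<in> obj C; \<And>i. i \<in> I \<Longrightarrow> F i \<in> hom C X Y\<rbrakk> \<Longrightarrow> sum F I \<in> hom C X Y"
  using hom_subspace
  by (auto intro: vs.subspace_0 vs.subspace_add vs.subspace_diff vs.subspace_scale vs.subspace_sum)

lemma cmp_zero_left: "\<lbrakk>X \<in> obj C; Y \<in> obj C; Z \<in> obj C; f \<in> hom C X Y\<rbrakk> \<Longrightarrow> 0 \<cdot> f = 0"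
  using cmp_scl_left[of X Y Z f 0 0] by (simp add: hom_zero)

lemma cmp_zero_right: "\<lbrakk>X \<in> obj C; Y \<in> obj C; Z \<in> obj C; g \<in> hom C Y Z\<rbrakk> \<Longrightarrow> g \<cdot> 0 = 0"
  using cmp_scl_right[of X Y Z 0 g 0] by (simp add: hom_zero)

lemma cmp_diff_left:
  assumes "X \<in> obj C" "Y \<in> obj C" "Z \<in> obj C" "f \<in> hom C X Y" "g \<in> hom C Y Z" "g' \<in> hom C Y Z"
  shows "(g - g') \<cdot> f = g \<cdot> f - g' \<cdot> f"
  using cmp_add_left[of X Y Z f "g - g'" g'] assms by (simp add: hom_diff)

lemma cmp_diff_right:
  assumes "X \<in> obj C" "Y \<in> obj C" "Z \<in> obj C" "f \<in> hom C X Y" "f' \<in> hom C X Y" "g \<in> hom C Y Z"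
  shows "g \<cdot> (f - f') = g \<cdot> f - g \<cdot> f'"
  using cmp_add_right[of X Y Z "f - f'" f' g] assms by (simp add: hom_diff)

lemma cmp_sum_left:
  assumes "X \<in> obj C" "Y \<in> obj C" "Z \<in> obj C" "f \<in> hom C X Y" "\<And>i. i \<in> I \<Longrightarrow> g i \<in> hom C Y Z"
  shows "(\<Sum>i\<in>I. g i) \<cdot> f = (\<Sum>i\<in>I. g i \<cdot> f)"
  using assms(5)
proof (induction I rule: infinite_finite_induct)
  case (insert i I)
  then show ?case using assms by (simp add: cmp_add_left[of X Y Z] hom_sum)
qed (use assms cmp_zero_left in auto)

lemma cmp_sum_right:
  assumes "X \<in> obj C" "Y \<in> obj C" "Z \<in> obj C" "\<And>i. i \<in> I \<Longrightarrow> f i \<in> hom C X Y" "g \<in> hom C Y Z"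
  shows "g \<cdot> (\<Sum>i\<in>I. f i) = (\<Sum>i\<in>I. g \<cdot> f i)"
  using assms(4)
proof (induction I rule: infinite_finite_induct)
  case (insert i I)
  then show ?case using assms by (simp add: cmp_add_right[of X Y Z] hom_sum)
qed (use assms cmp_zero_right in auto)


lemma inverse_unique:
  assumes "X \<in> obj C" "Y \<in> obj C" "f \<in> hom C X Y" "inverse_of C X Y f g" "inverse_of C X Y f h"
  shows "g = h"
proof -
  have gh: "g \<in> hom C Y X" "h \<in> hom C Y X" "g \<cdot> f = \<one> X" "f \<cdot> h = \<one> Y"
    using assms by (auto simp: inverse_of_def)
  have "g = g \<cdot> (f \<cdot> h)" using cmp_idn[of Y X g] assms gh by simp
  also have "\<dots> = (g \<cdot> f) \<cdot> h" using cmp_assoc[of Y X Y X h f g] assms gh by simp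
  also have "\<dots> = h" using idn_cmp[of Y X h] assms gh by simp
  finally show ?thesis .
qed

lemma minv_eq:
  assumes "X \<in> obj C" "Y \<in> obj C" "f \<in> hom C X Y" "inverse_of C X Y f g"
  shows "minv C X Y f = g"
  unfolding minv_def using assms inverse_unique by (intro the_equality) blast+

lemma minv_inverse:
  assumes "X \<in> obj C" "Y \<in> obj C" "is_iso C X Y f"
  shows "inverse_of C X Y f (minv C X Y f)"
  using assms minv_eq[OF assms(1,2)] unfolding is_iso_def by metis

lemma is_iso_idn: "X \<in> obj C \<Longrightarrow> is_iso C X X (\<one> X)"
  using idn_hom[of X] cmp_idn[of X X "\<one> X"] unfolding is_iso_def inverse_of_def by blast

lemma is_iso_sym: "inverse_of C X Y f g \<Longrightarrow> f \<in> hom C X Y \<Longrightarrow> is_iso C Y X g"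
  by (auto simp: is_iso_def inverse_of_def)

lemma is_iso_cmp:
  assumes o: "X \<in> obj C" "Y \<in> obj C" "Z \<in> obj C" and "is_iso C X Y f" "is_iso C Y Z g"
  shows "is_iso C X Z (g \<cdot> f)"
proof -
  obtain f' g' where i: "inverse_of C X Y f f'" "inverse_of C Y Z g g'" and fg: "f \<in> hom C X Y" "g \<in> hom C Y Z"
    using assms by (auto simp: is_iso_def)
  then have h: "f' \<in> hom C Y X" "g' \<in> hom C Z Y" by (auto simp: inverse_of_def)
  have "(f' \<cdot> g') \<cdot> (g \<cdot> f) = f' \<cdot> ((g' \<cdot> g) \<cdot> f)"
    using o h fg cmp_hom cmp_assoc[of X Z Y X "g \<cdot> f" g' f'] cmp_assoc[of X Y Z Y f g g'] by simp
  moreover have "(g \<cdot> f) \<cdot> (f' \<cdot> g') = g \<cdot> ((f \<cdot> f') \<cdot> g')"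
    using o h fg cmp_hom cmp_assoc[of Z X Y Z "f' \<cdot> g'" f g] cmp_assoc[of Z Y X Y g' f' f] by simp
  ultimately show ?thesis
    using i fg h o unfolding is_iso_def inverse_of_def
    by (intro conjI exI[of _ "f' \<cdot> g'"]) (simp_all add: cmp_hom[of X Y Z] cmp_hom[of Z Y X] idn_cmp[of X Y] idn_cmp[of Z Y])
qed

lemma isomorphic_refl: "X \<in> obj C \<Longrightarrow> isomorphic C X X"
  using is_iso_idn by (auto simp: isomorphic_def)

lemma isomorphic_sym: "isomorphic C X Y \<Longrightarrow> isomorphic C Y X"
  unfolding isomorphic_def using is_iso_sym by (metis inverse_of_def is_iso_def)

lemma isomorphic_trans:
  "\<lbrakk>X \<in> obj C; Y \<in> obj C; Z \<in> obj C; isomorphic C X Y; isomorphic C Y Z\<rbrakk> \<Longrightarrow> isomorphic C X Z"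
  using is_iso_cmp unfolding isomorphic_def by blast

lemma is_iso_zero:
  assumes "X \<in> obj C" "Y \<in> obj C" "is_iso C X Y 0" shows "\<one> X = 0" "\<one> Y = 0"
proof -
  obtain g where "g \<in> hom C Y X" "g \<cdot> 0 = \<one> X" "0 \<cdot> g = \<one> Y"
    using assms by (auto simp: is_iso_def inverse_of_def)
  then show "\<one> X = 0" "\<one> Y = 0"
    using cmp_zero_right[of X Y X g] cmp_zero_left[of Y X Y g] assms by auto
qed

lemma simple_obj: "simple C X \<Longrightarrow> X \<in> obj C"
  and simple_nonzero: "simple C X \<Longrightarrow> \<one> X \<noteq> 0"
  by (auto simp: simple_def)

lemma kernel_monic:
  assumes "X \<in> obj C" "Y \<in> obj C" "f \<in> hom C X Y" and k: "is_kernel C X Y f K k"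
  shows "monic C K X k"
proof -
  have K: "K \<in> obj C" "k \<in> hom C K X" "f \<cdot> k = 0" using k by (auto simp: is_kernel_def)
  show ?thesis unfolding monic_def
  proof (intro conjI ballI impI K)
    fix Z g h assume Z: "Z \<in> obj C" and gh: "g \<in> hom C Z K" "h \<in> hom C Z K" "k \<cdot> g = k \<cdot> h"
    have "f \<cdot> (k \<cdot> g) = 0"
      using cmp_assoc[of Z K X Y g k f] cmp_zero_left[of Z K Y g] Z K gh assms by simp
    moreover have "k \<cdot> g \<in> hom C Z X" using cmp_hom[of Z K X] Z K gh assms by simp
    ultimately have "\<exists>!u. u \<in> hom C Z K \<and> k \<cdot> u = k \<cdot> g"
      using k Z by (auto simp: is_kernel_def)
    then show "g = h" using gh by metis
  qed
qed

lemma zero_kernel_monic: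
  assumes o: "X \<in> obj C" "Y \<in> obj C" and f: "f \<in> hom C X Y" and k: "is_kernel C X Y f K 0"
  shows "monic C X Y f"
  unfolding monic_def
proof (intro conjI ballI impI f)
  fix Z g h assume Z: "Z \<in> obj C" and gh: "g \<in> hom C Z X" "h \<in> hom C Z X" "f \<cdot> g = f \<cdot> h"
  then have "f \<cdot> (g - h) = 0" using cmp_diff_right[of Z X Y g h f] o f by simp
  moreover have "g - h \<in> hom C Z X" using hom_diff Z gh o by blast
  ultimately have "\<exists>!u. u \<in> hom C Z K \<and> 0 \<cdot> u = g - h"
    using k Z unfolding is_kernel_def by blast
  then obtain u where "u \<in> hom C Z K" "0 \<cdot> u = g - h" by blast
  then show "g = h" using cmp_zero_left[of Z K X u] k Z o by (auto simp: is_kernel_def)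
qed

text \<open>The kernel of \<open>f\<close> is a subobject of the simple object \<open>X\<close>, hence all of \<open>X\<close> or zero; in the second
  case \<open>f\<close> is monic and makes \<open>X\<close> a subobject of \<open>Y\<close>.\<close>

lemma schur:
  assumes X: "simple C X" and Y: "simple C Y" and f: "f \<in> hom C X Y" and k: "is_kernel C X Y f K k"
  shows "f = 0 \<or> is_iso C X Y f"
proof -
  have o: "X \<in> obj C" "Y \<in> obj C" using X Y by (auto simp: simple_def)
  have K: "K \<in> obj C" "k \<in> hom C K X" "f \<cdot> k = 0" using k by (auto simp: is_kernel_def)
  have "monic C K X k" using kernel_monic o f k by blast
  then have "k = 0 \<or> is_iso C K X k" using X K by (auto simp: simple_def)
  then show ?thesis
  proof
    assume "k = 0"
    then have "monic C X Y f" using zero_kernel_monic o f k by blast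
    then show ?thesis using Y o by (auto simp: simple_def)
  next
    assume "is_iso C K X k"
    then obtain g where g: "g \<in> hom C X K" "k \<cdot> g = \<one> X" by (auto simp: is_iso_def inverse_of_def)
    have "f = f \<cdot> (k \<cdot> g)" using cmp_idn[of X Y f] o f g by simp
    also have "\<dots> = 0" using cmp_assoc[of X K X Y g k f] cmp_zero_left[of X K Y g] o f g K by simp
    finally show ?thesis ..
  qed
qed

end

text \<open>The setting of Schur's lemma; it will be used for the given category and for its center.\<close>

locale schur_category = linear_category C
  for C :: "('o, 'm::ab_group_add, 'k::alg_closed_field, 'z) linear_category_scheme" (structure) +
  assumes has_kernels: "\<lbrakk>X \<in> obj C; Y \<in> obj C; f \<in> hom C X Y\<rbrakk> \<Longrightarrow> \<exists>K k. is_kernel C X Y f K k"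
    and hom_finite_dim: "\<lbrakk>X \<in> obj C; Y \<in> obj C\<rbrakk>
      \<Longrightarrow> \<exists>B. finite B \<and> hom C X Y \<subseteq> module.span (scl C) B"
begin

lemma schur_iso:
  assumes "simple C X" "simple C Y" "f \<in> hom C X Y" "f \<noteq> 0"
  shows "is_iso C X Y f"
  using assms schur has_kernels simple_obj by metis

primrec iterate :: "'o \<Rightarrow> 'm \<Rightarrow> nat \<Rightarrow> 'm" where
  "iterate X f 0 = \<one> X"
| "iterate X f (Suc n) = f \<cdot> iterate X f n"

lemma iterate_hom: "X \<in> obj C \<Longrightarrow> f \<in> hom C X X \<Longrightarrow> iterate X f n \<in> hom C X X"
  by (induction n) (auto intro: idn_hom cmp_hom)

definition poly_at :: "'o \<Rightarrow> 'm \<Rightarrow> 'k poly \<Rightarrow> 'm" where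
  "poly_at X f p = (\<Sum>i\<le>degree p. scl C (coeff p i) (iterate X f i))"

lemma poly_at_upto: "degree p \<le> n \<Longrightarrow> poly_at X f p = (\<Sum>i\<le>n. scl C (coeff p i) (iterate X f i))"
  unfolding poly_at_def by (rule sum.mono_neutral_left) (auto simp: coeff_eq_0)

lemma poly_at_hom: "X \<in> obj C \<Longrightarrow> f \<in> hom C X X \<Longrightarrow> poly_at X f p \<in> hom C X X"
  unfolding poly_at_def by (auto intro!: hom_sum hom_scl iterate_hom)

lemma poly_at_linear_factor:
  assumes X: "X \<in> obj C" and f: "f \<in> hom C X X"
  shows "poly_at X f ([:- c, 1:] * q) = (f - scl C c (\<one> X)) \<cdot> poly_at X f q"
proof -
  let ?n = "degree q"
  let ?F = "iterate X f"
  have F: "?F i \<in> hom C X X" for i using iterate_hom X f by blast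
  have sF: "scl C a (?F i) \<in> hom C X X" for a i using F X hom_scl by blast
  have eq: "coeff ([:- c, 1:] * q) i = (case i of 0 \<Rightarrow> 0 | Suc j \<Rightarrow> coeff q j) - c * coeff q i" for i
    by (simp add: coeff_pCons split: nat.split)
  have "degree ([:- c, 1:] * q) \<le> Suc ?n"
    using degree_mult_le[of "[:- c, 1:]" q] by simp
  then have "poly_at X f ([:- c, 1:] * q) = (\<Sum>i\<le>Suc ?n. scl C (coeff ([:- c, 1:] * q) i) (?F i))"
    by (rule poly_at_upto)
  also have "\<dots> = (\<Sum>i\<le>Suc ?n. scl C (case i of 0 \<Rightarrow> 0 | Suc j \<Rightarrow> coeff q j) (?F i))
      - (\<Sum>i\<le>Suc ?n. scl C (c * coeff q i) (?F i))"
    unfolding eq by (simp add: vs.scale_left_diff_distrib sum_subtractf del: sum.atMost_Suc)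
  also have "(\<Sum>i\<le>Suc ?n. scl C (case i of 0 \<Rightarrow> 0 | Suc j \<Rightarrow> coeff q j) (?F i))
      = (\<Sum>i\<le>?n. f \<cdot> scl C (coeff q i) (?F i))"
    using X f F by (subst sum.atMost_Suc_shift) (simp add: cmp_scl_right[of X X X])
  also have "\<dots> = f \<cdot> poly_at X f q"
    unfolding poly_at_def using X f sF by (simp add: cmp_sum_right[of X X X])
  also have "(\<Sum>i\<le>Suc ?n. scl C (c * coeff q i) (?F i)) = scl C c (poly_at X f q)"
    unfolding poly_at_def by (simp add: coeff_eq_0 vs.scale_sum_right)
  also have "\<dots> = scl C c (\<one> X) \<cdot> poly_at X f q"
    using poly_at_hom[OF X f] X idn_hom by (simp add: cmp_scl_left[of X X X] idn_cmp[of X X])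
  also have "f \<cdot> poly_at X f q - scl C c (\<one> X) \<cdot> poly_at X f q = (f - scl C c (\<one> X)) \<cdot> poly_at X f q"
    using poly_at_hom[OF X f] X idn_hom hom_scl f by (simp add: cmp_diff_left[of X X X])
  finally show ?thesis .
qed

text \<open>Either two powers of \<open>f\<close> coincide, or they form an infinite family in a finite-dimensional space.\<close>

lemma annihilating_poly:
  assumes X: "X \<in> obj C" and f: "f \<in> hom C X X"
  obtains p where "p \<noteq> 0" "poly_at X f p = 0"
proof (cases "inj (iterate X f)")
  case False
  then obtain i j where ij: "i < j" "iterate X f i = iterate X f j"
    by (metis injI linorder_neqE_nat)
  let ?p = "monom 1 j - monom 1 i :: 'k poly"
  have "coeff ?p j = 1" using ij by simp
  then have p: "?p \<noteq> 0" by (metis coeff_0 zero_neq_one)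
  have "degree ?p \<le> j" using ij by (intro degree_diff_le) (auto simp: degree_monom_eq)
  then have "poly_at X f ?p = (\<Sum>n\<le>j. scl C (coeff ?p n) (iterate X f n))" by (rule poly_at_upto)
  also have "\<dots> = (\<Sum>n\<le>j. scl C (if n = j then 1 else 0) (iterate X f n)) - (\<Sum>n\<le>j. scl C (if n = i then 1 else 0) (iterate X f n))"
    by (simp add: vs.scale_left_diff_distrib sum_subtractf eq_commute)
  also have "\<dots> = 0" using ij by (simp add: if_distrib[of "\<lambda>c. scl C c _"] cong: if_cong)
  finally show ?thesis using that p by blast
next
  case True
  obtain B where B: "finite B" "hom C X X \<subseteq> vs.span B" using hom_finite_dim X by blast
  have "range (iterate X f) \<subseteq> vs.span B" using B iterate_hom[OF X f] by auto
  moreover have "infinite (range (iterate X f))" using True by (simp add: range_inj_infinite)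
  ultimately have "vs.dependent (range (iterate X f))"
    using vs.independent_span_bound B by blast
  then obtain T u where T: "finite T" "T \<subseteq> range (iterate X f)" "(\<Sum>v\<in>T. scl C (u v) v) = 0" "\<exists>v\<in>T. u v \<noteq> 0"
    unfolding vs.dependent_explicit by blast
  obtain N where N: "T = iterate X f ` N" using T by (auto simp: subset_image_iff)
  have finN: "finite N" using T N True by (metis finite_imageD inj_on_subset subset_UNIV)
  define p where "p = (\<Sum>n\<in>N. monom (u (iterate X f n)) n)"
  have cf: "coeff p n = (if n \<in> N then u (iterate X f n) else 0)" for n
    unfolding p_def coeff_sum using finN by (simp)
  have "p \<noteq> 0" using T(4) N cf by (metis coeff_0 imageE)
  define d where "d = Max (insert (degree p) N)"
  have d: "degree p \<le> d" "\<forall>n\<in>N. n \<le> d" unfolding d_def using finN by auto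
  have "poly_at X f p = (\<Sum>n\<le>d. scl C (coeff p n) (iterate X f n))" using d by (intro poly_at_upto)
  also have "\<dots> = (\<Sum>n\<in>N. scl C (u (iterate X f n)) (iterate X f n))"
    using d finN by (intro sum.mono_neutral_cong_right) (auto simp: cf)
  also have "\<dots> = (\<Sum>v\<in>T. scl C (u v) v)" unfolding N
    using True by (subst sum.reindex) (auto intro: inj_on_subset)
  finally show ?thesis using that \<open>p \<noteq> 0\<close> T by simp
qed

text \<open>The field being algebraically closed, a polynomial annihilating \<open>f\<close> has a linear factor; if
  \<open>f - c\<close> is not zero, it is invertible and can be cancelled, which lowers the degree.\<close>

lemma schur_scalar:
  assumes S: "simple C X" and f: "f \<in> hom C X X"
  obtains c where "f = scl C c (\<one> X)"
proof -
  have X: "X \<in> obj C" using S simple_obj by blast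
  have "\<exists>c. f = scl C c (\<one> X)" if "p \<noteq> 0" "poly_at X f p = 0" for p
    using that
  proof (induction "degree p" arbitrary: p rule: less_induct)
    case less
    show ?case
    proof (cases "degree p = 0")
      case True
      then obtain a where "p = [:a:]" by (rule degree_eq_zeroE)
      then have "a \<noteq> 0" "scl C a (\<one> X) = 0" using less by (auto simp: poly_at_def)
      then show ?thesis using simple_nonzero[OF S] by simp
    next
      case False
      then obtain c where "poly p c = 0" using alg_closed_imp_poly_has_root[of p] by auto
      then obtain q where q: "p = [:- c, 1:] * q" by (metis dvdE poly_eq_0_iff_dvd)
      with less.prems have "q \<noteq> 0" by auto
      then have deg: "degree q < degree p" unfolding q by (subst degree_mult_eq) auto
      let ?g = "f - scl C c (\<one> X)"
      have g: "?g \<in> hom C X X" using f X idn_hom hom_scl hom_diff by simp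
      have gq: "?g \<cdot> poly_at X f q = 0" using less.prems poly_at_linear_factor[OF X f] q by simp
      show ?thesis
      proof (cases "?g = 0")
        case True
        then show ?thesis by auto
      next
        case False
        then obtain h where h: "h \<in> hom C X X" "h \<cdot> ?g = \<one> X"
          using schur_iso[OF S S g] by (auto simp: is_iso_def inverse_of_def)
        have qh: "poly_at X f q \<in> hom C X X" using poly_at_hom X f by blast
        have "poly_at X f q = (h \<cdot> ?g) \<cdot> poly_at X f q" using h qh X by (simp add: idn_cmp[of X X])
        also have "\<dots> = 0" using cmp_assoc[of X X X X "poly_at X f q" ?g h] cmp_zero_right[of X X X h] h g qh gq X by simp
        finally show ?thesis using less.hyps[OF deg \<open>q \<noteq> 0\<close>] by blast
      qed
    qed
  qed
  then show ?thesis using annihilating_poly[OF X f] that by metis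
qed

lemma scl_idn_inject: "simple C X \<Longrightarrow> scl C a (\<one> X) = scl C b (\<one> X) \<longleftrightarrow> a = b"
  using simple_nonzero by simp


lemma direct_sum_parts:
  assumes "direct_sum C n S \<iota> \<pi> A"
  shows "A \<in> obj C" and "\<And>i. i < n \<Longrightarrow> S i \<in> obj C" and "\<And>i. i < n \<Longrightarrow> \<iota> i \<in> hom C (S i) A"
    and "\<And>i. i < n \<Longrightarrow> \<pi> i \<in> hom C A (S i)" and "\<And>i. i < n \<Longrightarrow> \<pi> i \<cdot> \<iota> i = \<one> (S i)"
    and "\<And>i j. i < n \<Longrightarrow> j < n \<Longrightarrow> i \<noteq> j \<Longrightarrow> \<pi> i \<cdot> \<iota> j = 0" and "(\<Sum>i<n. \<iota> i \<cdot> \<pi> i) = \<one> A"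
  using assms unfolding direct_sum_def by auto

text \<open>By Schur's lemma, a morphism from \<open>X\<close> into a direct sum of simple objects is a family of scalars,
  one for each summand isomorphic to \<open>X\<close>, relative to fixed isomorphisms \<open>\<phi> i\<close>.\<close>

lemma isotypic_coordinates:
  assumes X: "simple C X" and dec: "direct_sum C n S \<iota> \<pi> A" and S: "\<And>i. i < n \<Longrightarrow> simple C (S i)"
    and I: "I = {i. i < n \<and> isomorphic C (S i) X}"
  obtains \<phi> \<zeta> where
    "\<And>i. i \<in> I \<Longrightarrow> is_iso C X (S i) (\<phi> i)"
    "\<And>u i. u \<in> hom C X A \<Longrightarrow> i \<in> I \<Longrightarrow> \<pi> i \<cdot> u = scl C (\<zeta> i u) (\<phi> i)"
    "\<And>u. u \<in> hom C X A \<Longrightarrow> u = (\<Sum>i\<in>I. scl C (\<zeta> i u) (\<iota> i \<cdot> \<phi> i))"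
    "\<And>i u c. i \<in> I \<Longrightarrow> u \<in> hom C X A \<Longrightarrow> \<pi> i \<cdot> u = scl C c (\<phi> i) \<Longrightarrow> \<zeta> i u = c"
proof -
  note d = direct_sum_parts[OF dec]
  have o: "X \<in> obj C" using X simple_obj by blast
  have "\<exists>\<phi>. \<forall>i\<in>I. is_iso C X (S i) (\<phi> i)"
    using isomorphic_sym unfolding I isomorphic_def by (intro bchoice) blast
  then obtain \<phi> where \<phi>: "\<And>i. i \<in> I \<Longrightarrow> is_iso C X (S i) (\<phi> i)" by blast
  have scalar: "\<exists>c. \<pi> i \<cdot> u = scl C c (\<phi> i)" if i: "i \<in> I" and u: "u \<in> hom C X A" for i u
  proof -
    obtain g where g: "g \<in> hom C (S i) X" "\<phi> i \<cdot> g = \<one> (S i)" and h: "\<phi> i \<in> hom C X (S i)"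
      using \<phi>[OF i] by (auto simp: is_iso_def inverse_of_def)
    have n: "i < n" using i I by auto
    have pu: "\<pi> i \<cdot> u \<in> hom C X (S i)" using cmp_hom[of X A "S i"] d o u n by simp
    then have gpu: "g \<cdot> (\<pi> i \<cdot> u) \<in> hom C X X" using cmp_hom[of X "S i" X] d o g n by simp
    obtain c where c: "g \<cdot> (\<pi> i \<cdot> u) = scl C c (\<one> X)"
      using schur_scalar[OF X gpu] .
    have "\<pi> i \<cdot> u = (\<phi> i \<cdot> g) \<cdot> (\<pi> i \<cdot> u)" using g pu idn_cmp[of X "S i"] o d n by simp
    also have "\<dots> = \<phi> i \<cdot> (g \<cdot> (\<pi> i \<cdot> u))"
      using cmp_assoc[of X "S i" X "S i" "\<pi> i \<cdot> u" g "\<phi> i"] o d n g h pu by simp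
    also have "\<dots> = scl C c (\<phi> i)"
      unfolding c using cmp_scl_right[of X X "S i" "\<one> X" "\<phi> i"] cmp_idn[of X "S i"] o d n h idn_hom by simp
    finally show ?thesis by blast
  qed
  define \<zeta> where "\<zeta> i u = (SOME c. \<pi> i \<cdot> u = scl C c (\<phi> i))" for i u
  have \<zeta>: "\<pi> i \<cdot> u = scl C (\<zeta> i u) (\<phi> i)" if "i \<in> I" "u \<in> hom C X A" for i u
    unfolding \<zeta>_def using scalar[OF that] by (rule someI_ex)
  have off: "\<pi> i \<cdot> u = 0" if "i < n" "i \<notin> I" "u \<in> hom C X A" for i u
  proof (rule ccontr)
    assume "\<pi> i \<cdot> u \<noteq> 0"
    moreover have "\<pi> i \<cdot> u \<in> hom C X (S i)" using cmp_hom[of X A "S i"] d o that by simp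
    ultimately have "is_iso C X (S i) (\<pi> i \<cdot> u)" using schur_iso X S that by blast
    then show False using that isomorphic_sym unfolding I isomorphic_def by blast
  qed
  have nz: "\<phi> i \<noteq> 0" if "i \<in> I" for i
    using \<phi>[OF that] is_iso_zero[of X "S i"] simple_nonzero[OF X] d o that I by auto
  have "u = (\<Sum>i\<in>I. scl C (\<zeta> i u) (\<iota> i \<cdot> \<phi> i))" if u: "u \<in> hom C X A" for u
  proof -
    have "u = (\<Sum>i<n. \<iota> i \<cdot> \<pi> i) \<cdot> u" using d u o by (simp add: idn_cmp[of X A])
    also have "\<dots> = (\<Sum>i<n. (\<iota> i \<cdot> \<pi> i) \<cdot> u)"
      using d u o by (intro cmp_sum_left[of X A A]) (auto intro: cmp_hom[of A "S _" A])
    also have "\<dots> = (\<Sum>i<n. \<iota> i \<cdot> (\<pi> i \<cdot> u))"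
      using d u o by (intro sum.cong refl cmp_assoc[of X A "S _" A]) auto
    also have "\<dots> = (\<Sum>i\<in>I. \<iota> i \<cdot> (\<pi> i \<cdot> u))"
      using d u by (intro sum.mono_neutral_right) (auto simp: I off cmp_zero_right[OF o d(2,1,3)])
    also have "\<dots> = (\<Sum>i\<in>I. scl C (\<zeta> i u) (\<iota> i \<cdot> \<phi> i))"
      using d u o \<phi> by (intro sum.cong refl) (auto simp: \<zeta> I is_iso_def cmp_scl_right[OF o d(2,1) _ d(3)])
    finally show ?thesis .
  qed
  moreover have "\<zeta> i u = c" if "i \<in> I" "u \<in> hom C X A" "\<pi> i \<cdot> u = scl C c (\<phi> i)" for i u c
    using that \<zeta>[OF that(1,2)] nz[OF that(1)] by simp
  ultimately show ?thesis using that \<phi> \<zeta> by blast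
qed

end

locale schur_semisimple_category = schur_category + semisimple_category
begin

lemma simple_source_split:
  assumes S: "simple C S" and B: "B \<in> obj C" and f: "f \<in> hom C S B" "f \<noteq> 0"
  obtains p where "p \<in> hom C B S" "p \<cdot> f = \<one> S"
proof -
  obtain n T \<iota> \<pi> where dec: "direct_sum C n T \<iota> \<pi> B" and T: "\<forall>i<n. simple C (T i)"
    using semisimple[OF B] by blast
  note d = direct_sum_parts[OF dec]
  have o: "S \<in> obj C" using S simple_obj by blast
  have "\<exists>i<n. \<pi> i \<cdot> f \<noteq> 0"
  proof (rule ccontr)
    assume "\<not> (\<exists>i<n. \<pi> i \<cdot> f \<noteq> 0)"
    then have z: "\<And>i. i < n \<Longrightarrow> \<pi> i \<cdot> f = 0" by blast
    have "f = (\<Sum>i<n. \<iota> i \<cdot> \<pi> i) \<cdot> f" using d f o by (simp add: idn_cmp[of S B])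
    also have "\<dots> = (\<Sum>i<n. (\<iota> i \<cdot> \<pi> i) \<cdot> f)"
      using d f o by (intro cmp_sum_left[of S B B]) (auto intro: cmp_hom[of B "T _" B])
    also have "\<dots> = (\<Sum>i<n. \<iota> i \<cdot> (\<pi> i \<cdot> f))"
      using d f o by (intro sum.cong refl cmp_assoc[of S B "T _" B]) auto
    also have "\<dots> = 0" using z by (intro sum.neutral) (simp add: cmp_zero_right[OF o d(2,1,3)])
    finally show False using f by simp
  qed
  then obtain i where i: "i < n" "\<pi> i \<cdot> f \<noteq> 0" by blast
  moreover have "\<pi> i \<cdot> f \<in> hom C S (T i)" using cmp_hom[of S B "T i"] d o f i by simp
  ultimately obtain g where g: "g \<in> hom C (T i) S" "g \<cdot> (\<pi> i \<cdot> f) = \<one> S"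
    using schur_iso[OF S, of "T i"] T by (auto simp: is_iso_def inverse_of_def)
  show ?thesis
  proof
    show "g \<cdot> \<pi> i \<in> hom C B S" using cmp_hom[of B "T i" S] d i g o by simp
    show "(g \<cdot> \<pi> i) \<cdot> f = \<one> S" using cmp_assoc[of S B "T i" S f "\<pi> i" g] d i g o f by simp
  qed
qed

text \<open>A simple summand of the source on which \<open>f\<close> does not vanish is mapped onto a direct summand of the
  target. Subtracting this part of \<open>f\<close> leaves a morphism that vanishes on more summands.\<close>

lemma von_neumann_regular:
  assumes A: "A \<in> obj C" and B: "B \<in> obj C" and f: "f \<in> hom C A B"
  obtains s where "s \<in> hom C B A" "f \<cdot> s \<cdot> f = f"
proof -
  obtain n T \<iota> \<pi> where dec: "direct_sum C n T \<iota> \<pi> A" and T: "\<forall>i<n. simple C (T i)"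
    using semisimple[OF A] by blast
  note d = direct_sum_parts[OF dec]
  have "\<exists>s\<in>hom C B A. f \<cdot> s \<cdot> f = f" if "f \<in> hom C A B" for f
    using that
  proof (induction "card {i. i < n \<and> f \<cdot> \<iota> i \<noteq> 0}" arbitrary: f rule: less_induct)
    case less
    note f = less.prems
    show ?case
    proof (cases "\<exists>i<n. f \<cdot> \<iota> i \<noteq> 0")
      case False
      have "f = f \<cdot> (\<Sum>i<n. \<iota> i \<cdot> \<pi> i)" using d f B by (simp add: cmp_idn[of A B])
      also have "\<dots> = (\<Sum>i<n. f \<cdot> \<iota> i \<cdot> \<pi> i)"
        using d f B by (intro cmp_sum_right[of A A B]) (auto intro: cmp_hom[of A "T _" A])
      also have "\<dots> = (\<Sum>i<n. (f \<cdot> \<iota> i) \<cdot> \<pi> i)"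
        using d f B by (intro sum.cong refl cmp_assoc[symmetric, of A "T _" A B]) auto
      also have "\<dots> = 0" using False by (intro sum.neutral) (simp add: cmp_zero_left[OF d(1,2) B d(4)])
      finally have "f = 0" .
      then show ?thesis using hom_zero[OF B A] cmp_zero_left[of A B B] cmp_zero_right[of A B A] A B
        by (intro bexI[of _ 0]) (auto simp: hom_zero cmp_zero_left[of A A B])
    next
      case True
      then obtain i where i: "i < n" "f \<cdot> \<iota> i \<noteq> 0" by blast
      note di = d(2-4)[OF i(1)]
      have fi: "f \<cdot> \<iota> i \<in> hom C (T i) B" using cmp_hom[of "T i" A B] di A B f by simp
      obtain p where p: "p \<in> hom C B (T i)" "p \<cdot> f \<cdot> \<iota> i = \<one> (T i)"
        using simple_source_split[of "T i" B "f \<cdot> \<iota> i"] T i B fi by auto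
      define t where "t = \<iota> i \<cdot> p"
      have t: "t \<in> hom C B A" unfolding t_def using cmp_hom[of B "T i" A] p di A B by simp
      have ft: "f \<cdot> t \<in> hom C B B" using cmp_hom[of B A B] f t A B by simp
      have tf: "t \<cdot> f \<in> hom C A A" using cmp_hom[of A B A] f t A B by simp
      have ftf: "f \<cdot> t \<cdot> f \<in> hom C A B" using cmp_hom[of A A B] f tf A B by simp
      define g where "g = f - f \<cdot> t \<cdot> f"
      have g: "g \<in> hom C A B" unfolding g_def using f ftf A B hom_diff by blast
      have g\<iota>: "g \<cdot> \<iota> j = f \<cdot> \<iota> j - f \<cdot> \<iota> i \<cdot> p \<cdot> f \<cdot> \<iota> j" if j: "j < n" for j
      proof -
        note dj = d(2-4)[OF j]
        have fj: "f \<cdot> \<iota> j \<in> hom C (T j) B" using cmp_hom[of "T j" A B] dj A B f by simp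
        have "g \<cdot> \<iota> j = f \<cdot> \<iota> j - (f \<cdot> t \<cdot> f) \<cdot> \<iota> j"
          unfolding g_def using cmp_diff_left[of "T j" A B] dj A B f ftf by simp
        also have "(f \<cdot> t \<cdot> f) \<cdot> \<iota> j = f \<cdot> (t \<cdot> f) \<cdot> \<iota> j"
          using cmp_assoc[of "T j" A A B "\<iota> j" "t \<cdot> f" f] dj A B f tf by simp
        also have "(t \<cdot> f) \<cdot> \<iota> j = t \<cdot> f \<cdot> \<iota> j"
          using cmp_assoc[of "T j" A B A "\<iota> j" f t] dj A B f t by simp
        also have "\<dots> = \<iota> i \<cdot> p \<cdot> f \<cdot> \<iota> j"
          unfolding t_def using cmp_assoc[of "T j" B "T i" A "f \<cdot> \<iota> j" p "\<iota> i"] dj di A B p fj by simp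
        finally show ?thesis .
      qed
      have "g \<cdot> \<iota> i = 0" using g\<iota>[OF i(1)] p(2) cmp_idn[of "T i" A "\<iota> i"] di A by simp
      moreover have "g \<cdot> \<iota> j = 0" if "j < n" "f \<cdot> \<iota> j = 0" for j
        using g\<iota>[OF that(1)] that d(2)[OF that(1)] cmp_zero_right[of "T j" B "T i" p] cmp_zero_right[of "T j" "T i" A "\<iota> i"]
          cmp_zero_right[of "T j" A B f] p di A B f by simp
      ultimately have "{j. j < n \<and> g \<cdot> \<iota> j \<noteq> 0} \<subset> {j. j < n \<and> f \<cdot> \<iota> j \<noteq> 0}"
        using i by blast
      then have "card {j. j < n \<and> g \<cdot> \<iota> j \<noteq> 0} < card {j. j < n \<and> f \<cdot> \<iota> j \<noteq> 0}"
        by (intro psubset_card_mono) auto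
      from less.hyps[OF this g] obtain s where s: "s \<in> hom C B A" and gsg: "g \<cdot> s \<cdot> g = g" by blast
      \<comment> \<open>McCoy's lemma: \<open>g = f - f t f\<close> being regular with pseudo-inverse \<open>s\<close>, so is \<open>f\<close>, with
        pseudo-inverse \<open>(1 - t f) s (1 - f t) + t\<close>.\<close>
      define a where "a = \<one> A - t \<cdot> f"
      define b where "b = \<one> B - f \<cdot> t"
      have ab: "a \<in> hom C A A" "b \<in> hom C B B"
        unfolding a_def b_def using A B tf ft idn_hom hom_diff by auto
      have fa: "f \<cdot> a = g" unfolding a_def g_def
        using cmp_diff_right[of A A B] cmp_idn[of A B f] A B f tf idn_hom by simp
      have bf: "b \<cdot> f = g" unfolding b_def g_def
        using cmp_diff_left[of A B B] idn_cmp[of A B f] cmp_assoc[of A B A B f t f] A B f ft t idn_hom by simp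
      have sb: "s \<cdot> b \<in> hom C B A" using cmp_hom[of B B A] s ab A B by simp
      then have asb: "a \<cdot> s \<cdot> b \<in> hom C B A" using cmp_hom[of B A A] ab A B by simp
      have sg: "s \<cdot> g \<in> hom C A A" using cmp_hom[of A B A] s g A B by simp
      have e1: "f \<cdot> (a \<cdot> s \<cdot> b) \<cdot> f = g"
      proof -
        have "(a \<cdot> s \<cdot> b) \<cdot> f = a \<cdot> (s \<cdot> b) \<cdot> f"
          using cmp_assoc[of A B A A f "s \<cdot> b" a] A B f sb ab by simp
        also have "(s \<cdot> b) \<cdot> f = s \<cdot> g"
          using cmp_assoc[of A B B A f b s] A B f s ab bf by simp
        finally have "f \<cdot> (a \<cdot> s \<cdot> b) \<cdot> f = f \<cdot> a \<cdot> s \<cdot> g" by simp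
        also have "\<dots> = g \<cdot> s \<cdot> g" using cmp_assoc[of A A A B "s \<cdot> g" a f] A B f sg ab fa by simp
        finally show ?thesis using gsg by simp
      qed
      have "f \<cdot> (a \<cdot> s \<cdot> b + t) \<cdot> f = f \<cdot> (a \<cdot> s \<cdot> b) \<cdot> f + f \<cdot> t \<cdot> f"
        using cmp_add_left[of A B A f "a \<cdot> s \<cdot> b" t] cmp_add_right[of A A B "(a \<cdot> s \<cdot> b) \<cdot> f" "t \<cdot> f" f]
          cmp_hom[of A B A f "a \<cdot> s \<cdot> b"] A B f t tf asb by simp
      also have "\<dots> = f" unfolding e1 g_def by simp
      finally show ?thesis using hom_add[OF B A asb t] by blast
    qed
  qed
  then show ?thesis using f that by blast
qed

end

section \<open>Arrows with source and target\<close>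

text \<open>A bare morphism does not determine its source and target. An arrow carries them along, and
  ill-typed composites and tensor products are \<open>Null\<close>: composition is then associative without side
  conditions, typing conditions are computed by rewriting, and a chain of string diagrams becomes a
  chain of equations between arrows.\<close>

datatype ('o, 'm) arrow = Null | Arr (dm: 'o) (mor: 'm) (cd: 'o)

context monoidal_category
begin

definition ar :: "('o, 'm) arrow \<Rightarrow> bool" where
  "ar a \<longleftrightarrow> a \<noteq> Null \<and> dm a \<in> obj C \<and> cd a \<in> obj C \<and> mor a \<in> hom C (dm a) (cd a)"

definition acmp :: "('o, 'm) arrow \<Rightarrow> ('o, 'm) arrow \<Rightarrow> ('o, 'm) arrow" (infixr \<open>\<bullet>\<close> 60) where
  "g \<bullet> f = (if ar g \<and> ar f \<and> dm g = cd f then Arr (dm f) (mor g \<cdot> mor f) (cd g) else Null)"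

definition aten :: "('o, 'm) arrow \<Rightarrow> ('o, 'm) arrow \<Rightarrow> ('o, 'm) arrow" (infixr \<open>\<star>\<close> 65) where
  "f \<star> g = (if ar f \<and> ar g then Arr (dm f \<odot> dm g) (mor f \<otimes> mor g) (cd f \<odot> cd g) else Null)"

definition aid :: "'o \<Rightarrow> ('o, 'm) arrow" where
  "aid X = Arr X (\<one> X) X"

lemma ar_Arr [simp]: "ar (Arr X f Y) \<longleftrightarrow> X \<in> obj C \<and> Y \<in> obj C \<and> f \<in> hom C X Y"
  by (auto simp: ar_def)

lemma ar_Null [simp]: "\<not> ar Null" by (simp add: ar_def)

lemma ar_obj [simp]: "ar f \<Longrightarrow> dm f \<in> obj C" "ar f \<Longrightarrow> cd f \<in> obj C"
  and ar_mor: "ar f \<Longrightarrow> mor f \<in> hom C (dm f) (cd f)"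
  by (auto simp: ar_def)

lemma arrow_eqI: "ar f \<Longrightarrow> ar g \<Longrightarrow> dm f = dm g \<Longrightarrow> cd f = cd g \<Longrightarrow> mor f = mor g \<Longrightarrow> f = g"
  by (cases f; cases g) auto

lemma Arr_mor: "ar f \<Longrightarrow> dm f = X \<Longrightarrow> cd f = Y \<Longrightarrow> Arr X (mor f) Y = f"
  by (cases f) auto

lemma ar_cmp [simp]: "ar (g \<bullet> f) \<longleftrightarrow> ar g \<and> ar f \<and> dm g = cd f"
  by (auto simp: acmp_def intro: cmp_hom ar_mor) (metis ar_mor ar_obj cmp_hom)

lemma dm_cmp [simp]: "ar g \<Longrightarrow> ar f \<Longrightarrow> dm g = cd f \<Longrightarrow> dm (g \<bullet> f) = dm f"
  and cd_cmp [simp]: "ar g \<Longrightarrow> ar f \<Longrightarrow> dm g = cd f \<Longrightarrow> cd (g \<bullet> f) = cd g"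
  and mor_cmp [simp]: "ar g \<Longrightarrow> ar f \<Longrightarrow> dm g = cd f \<Longrightarrow> mor (g \<bullet> f) = mor g \<cdot> mor f"
  by (auto simp: acmp_def)

lemma not_ar_cmp: "\<not> ar (g \<bullet> f) \<Longrightarrow> g \<bullet> f = Null"
  by (metis acmp_def ar_cmp)

lemma acmp_assoc: "(h \<bullet> g) \<bullet> f = h \<bullet> (g \<bullet> f)"
proof (cases "ar h \<and> ar g \<and> ar f \<and> dm h = cd g \<and> dm g = cd f")
  case True
  then have t: "ar h" "ar g" "ar f" "dm h = cd g" "dm g = cd f" by auto
  then have "(mor h \<cdot> mor g) \<cdot> mor f = mor h \<cdot> mor g \<cdot> mor f"
    using ar_mor[of f] ar_mor[of g] ar_mor[of h] by (intro cmp_assoc[of "dm f" "cd f" "cd g" "cd h"]) auto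
  then show ?thesis using t by (intro arrow_eqI) auto
next
  case False
  have "\<not> ar ((h \<bullet> g) \<bullet> f)" "\<not> ar (h \<bullet> g \<bullet> f)"
    using False by (metis ar_cmp dm_cmp, metis ar_cmp cd_cmp)
  then show ?thesis by (metis not_ar_cmp)
qed

lemma aid_simps [simp]: "X \<in> obj C \<Longrightarrow> ar (aid X)" "dm (aid X) = X" "cd (aid X) = X" "mor (aid X) = \<one> X"
  by (auto simp: aid_def idn_hom)

lemma cmp_aid [simp]: "ar f \<Longrightarrow> dm f = X \<Longrightarrow> f \<bullet> aid X = f"
  and aid_cmp [simp]: "ar f \<Longrightarrow> cd f = X \<Longrightarrow> aid X \<bullet> f = f"
  using ar_mor[of f] cmp_idn[of "dm f" "cd f" "mor f"] idn_cmp[of "dm f" "cd f" "mor f"]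
  by (auto intro!: arrow_eqI)

lemma ar_ten [simp]: "ar (f \<star> g) \<longleftrightarrow> ar f \<and> ar g"
  by (auto simp: aten_def tens_obj intro: tensm_hom ar_mor)

lemma dm_ten [simp]: "ar f \<Longrightarrow> ar g \<Longrightarrow> dm (f \<star> g) = dm f \<odot> dm g"
  and cd_ten [simp]: "ar f \<Longrightarrow> ar g \<Longrightarrow> cd (f \<star> g) = cd f \<odot> cd g"
  and mor_ten [simp]: "ar f \<Longrightarrow> ar g \<Longrightarrow> mor (f \<star> g) = mor f \<otimes> mor g"
  by (auto simp: aten_def)

lemma aid_ten [simp]: "X \<in> obj C \<Longrightarrow> Y \<in> obj C \<Longrightarrow> aid X \<star> aid Y = aid (X \<odot> Y)"
  by (auto intro!: arrow_eqI simp: tens_obj tensm_idn)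

lemma interchange: "dm g = cd f \<Longrightarrow> dm g' = cd f' \<Longrightarrow> (g \<bullet> f) \<star> (g' \<bullet> f') = (g \<star> g') \<bullet> (f \<star> f')"
proof (cases "ar g \<and> ar f \<and> ar g' \<and> ar f'")
  case True
  assume "dm g = cd f" "dm g' = cd f'"
  with True show ?thesis
    using ar_mor[of f] ar_mor[of g] ar_mor[of f'] ar_mor[of g']
    by (intro arrow_eqI) (auto simp: tensm_cmp[of "dm f" "cd f" "cd g" "dm f'" "cd f'" "cd g'"])
qed (auto simp: acmp_def aten_def)

lemma obj_simps [simp]: "X \<in> obj C \<Longrightarrow> Y \<in> obj C \<Longrightarrow> X \<odot> Y \<in> obj C" "\<I> \<in> obj C"
  "X \<in> obj C \<Longrightarrow> X \<odot> \<I> = X" "X \<in> obj C \<Longrightarrow> \<I> \<odot> X = X"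
  by (auto simp: tens_obj unit_obj tens_unit unit_tens)

lemma ten_aid_unit [simp]: "ar f \<Longrightarrow> f \<star> aid \<I> = f" "ar f \<Longrightarrow> aid \<I> \<star> f = f"
  using ar_mor[of f] tensm_unit[of "dm f" "cd f" "mor f"] unit_tensm[of "dm f" "cd f" "mor f"]
  by (auto intro!: arrow_eqI)

text \<open>Whiskering is functorial; these rules push whiskers inwards.\<close>

lemma lwhisker: "X \<in> obj C \<Longrightarrow> dm g = cd f \<Longrightarrow> aid X \<star> (g \<bullet> f) = (aid X \<star> g) \<bullet> (aid X \<star> f)"
  using interchange[of "aid X" "aid X" g f] by simp

lemma rwhisker: "X \<in> obj C \<Longrightarrow> dm g = cd f \<Longrightarrow> (g \<bullet> f) \<star> aid X = (g \<star> aid X) \<bullet> (f \<star> aid X)"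
  using interchange[of g f "aid X" "aid X"] by simp

text \<open>The interchange law for two strands: \<open>f\<close> on the left and \<open>g\<close> on the right pass each other.\<close>

lemma slide: "ar f \<Longrightarrow> ar g \<Longrightarrow> dm f = X \<Longrightarrow> cd f = X' \<Longrightarrow> dm g = Y \<Longrightarrow> cd g = Y'
    \<Longrightarrow> (f \<star> aid Y') \<bullet> (aid X \<star> g) = (aid X' \<star> g) \<bullet> (f \<star> aid Y)"
  using interchange[of f "aid X" "aid Y'" g] interchange[of "aid X'" f g "aid Y"] by auto

lemma slide_cmp: "ar f \<Longrightarrow> ar g \<Longrightarrow> dm f = X \<Longrightarrow> cd f = X' \<Longrightarrow> dm g = Y \<Longrightarrow> cd g = Y'
    \<Longrightarrow> (f \<star> aid Y') \<bullet> (aid X \<star> g) \<bullet> t = (aid X' \<star> g) \<bullet> (f \<star> aid Y) \<bullet> t"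
  using slide[of f g X X' Y Y'] by (simp add: acmp_assoc[symmetric])

lemma ten_split: "ar f \<Longrightarrow> ar g \<Longrightarrow> dm f = X \<Longrightarrow> cd g = Y \<Longrightarrow> f \<star> g = (f \<star> aid Y) \<bullet> (aid X \<star> g)"
  using interchange[of f "aid X" "aid Y" g] by auto

definition As :: "'o \<Rightarrow> 'o \<Rightarrow> 'o \<Rightarrow> ('o, 'm) arrow" where
  "As X Y Z = Arr ((X \<odot> Y) \<odot> Z) (\<alpha> X Y Z) (X \<odot> (Y \<odot> Z))"
definition As' :: "'o \<Rightarrow> 'o \<Rightarrow> 'o \<Rightarrow> ('o, 'm) arrow" where
  "As' X Y Z = Arr (X \<odot> (Y \<odot> Z)) (\<alpha>' X Y Z) ((X \<odot> Y) \<odot> Z)"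

lemma iassoc_inverse:
  "\<lbrakk>X \<in> obj C; Y \<in> obj C; Z \<in> obj C\<rbrakk> \<Longrightarrow> inverse_of C ((X \<odot> Y) \<odot> Z) (X \<odot> (Y \<odot> Z)) (\<alpha> X Y Z) (\<alpha>' X Y Z)"
  unfolding iassoc_def by (rule minv_inverse) (auto simp: assoc_iso)

lemma As_simps [simp]:
  assumes "X \<in> obj C" "Y \<in> obj C" "Z \<in> obj C"
  shows "ar (As X Y Z)" "ar (As' X Y Z)" "As X Y Z \<bullet> As' X Y Z = aid (X \<odot> (Y \<odot> Z))"
    "As' X Y Z \<bullet> As X Y Z = aid ((X \<odot> Y) \<odot> Z)"
    "As X Y Z \<bullet> As' X Y Z \<bullet> t = aid (X \<odot> (Y \<odot> Z)) \<bullet> t"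
    "As' X Y Z \<bullet> As X Y Z \<bullet> t = aid ((X \<odot> Y) \<odot> Z) \<bullet> t"
proof -
  show 1: "ar (As X Y Z)" "ar (As' X Y Z)"
    using iassoc_inverse[OF assms] assoc_iso[OF assms] assms
    by (auto simp: As_def As'_def inverse_of_def is_iso_def)
  with iassoc_inverse[OF assms] show 2: "As X Y Z \<bullet> As' X Y Z = aid (X \<odot> (Y \<odot> Z))"
    "As' X Y Z \<bullet> As X Y Z = aid ((X \<odot> Y) \<odot> Z)"
    by (auto simp: As_def As'_def inverse_of_def acmp_def aid_def)
  show "As X Y Z \<bullet> As' X Y Z \<bullet> t = aid (X \<odot> (Y \<odot> Z)) \<bullet> t"
    "As' X Y Z \<bullet> As X Y Z \<bullet> t = aid ((X \<odot> Y) \<odot> Z) \<bullet> t"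
    using 2 by (simp_all add: acmp_assoc[symmetric])
qed

lemma As_dm_cd [simp]: "dm (As X Y Z) = (X \<odot> Y) \<odot> Z" "cd (As X Y Z) = X \<odot> (Y \<odot> Z)" "mor (As X Y Z) = \<alpha> X Y Z"
  "dm (As' X Y Z) = X \<odot> (Y \<odot> Z)" "cd (As' X Y Z) = (X \<odot> Y) \<odot> Z" "mor (As' X Y Z) = \<alpha>' X Y Z"
  by (simp_all add: As_def As'_def)

lemma As_natural:
  assumes "ar f" "ar g" "ar h"
  shows "As (cd f) (cd g) (cd h) \<bullet> ((f \<star> g) \<star> h) = (f \<star> (g \<star> h)) \<bullet> As (dm f) (dm g) (dm h)"
  using assms ar_mor[of f] ar_mor[of g] ar_mor[of h]
  by (intro arrow_eqI) (auto simp: assoc_natural[of "dm f" "dm g" "dm h"])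

lemma triple_ten: "ar f \<Longrightarrow> ar g \<Longrightarrow> ar h \<Longrightarrow>
    (f \<star> g) \<star> h = As' (cd f) (cd g) (cd h) \<bullet> (f \<star> (g \<star> h)) \<bullet> As (dm f) (dm g) (dm h)"
  by (simp add: As_natural[symmetric])

lemma As_pentagon:
  assumes "W \<in> obj C" "X \<in> obj C" "Y \<in> obj C" "Z \<in> obj C"
  shows "As W X (Y \<odot> Z) \<bullet> As (W \<odot> X) Y Z
    = (aid W \<star> As X Y Z) \<bullet> As W (X \<odot> Y) Z \<bullet> (As W X Y \<star> aid Z)"
  using assms by (intro arrow_eqI) (auto simp: pentagon)

text \<open>The associator with middle entry \<open>I\<close> is trivial by the triangle axiom. The pentagon with two
  adjacent entries \<open>I\<close> makes the other two idempotent, and an invertible idempotent is an identity.\<close>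

lemma As_unit [simp]:
  assumes "X \<in> obj C" "Y \<in> obj C"
  shows "As X \<I> Y = aid (X \<odot> Y)" "As \<I> X Y = aid (X \<odot> Y)" "As X Y \<I> = aid (X \<odot> Y)"
    "As' X \<I> Y = aid (X \<odot> Y)" "As' \<I> X Y = aid (X \<odot> Y)" "As' X Y \<I> = aid (X \<odot> Y)"
proof -
  have inv: "As' a b c = aid (X \<odot> Y)" if "As a b c = aid (X \<odot> Y)" "a \<in> obj C" "b \<in> obj C" "c \<in> obj C" for a b c
  proof -
    have e: "(a \<odot> b) \<odot> c = X \<odot> Y" "a \<odot> (b \<odot> c) = X \<odot> Y" using that by (auto simp: As_def aid_def)
    have "As' a b c = aid ((a \<odot> b) \<odot> c) \<bullet> As' a b c" using that by simp
    also have "aid ((a \<odot> b) \<odot> c) = As a b c" using that(1) e(1) by metis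
    also have "As a b c \<bullet> As' a b c = aid (X \<odot> Y)" using that e As_simps(3)[of a b c] by metis
    finally show ?thesis .
  qed
  have 1: "As X \<I> Y = aid (X \<odot> Y)" if "X \<in> obj C" "Y \<in> obj C" for X Y
    using that by (simp add: As_def aid_def triangle)
  have idem: "t = aid (X \<odot> Y)" if "t = t \<bullet> t" "t \<bullet> s = aid (X \<odot> Y)" "ar t" "cd t = X \<odot> Y" for t s
  proof -
    have "ar (t \<bullet> t)" using that(1,3) by metis
    then have "dm t = X \<odot> Y" using that(4) unfolding ar_cmp by simp
    then have "t = t \<bullet> (t \<bullet> s)" using that(2,3) by simp
    also have "\<dots> = t \<bullet> s" by (metis acmp_assoc that(1))
    finally show ?thesis using that(2) by simp
  qed
  have "As \<I> X Y = As \<I> \<I> (X \<odot> Y) \<bullet> As (\<I> \<odot> \<I>) X Y" using assms by (simp add: 1)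
  also have "\<dots> = (aid \<I> \<star> As \<I> X Y) \<bullet> As \<I> (\<I> \<odot> X) Y \<bullet> (As \<I> \<I> X \<star> aid Y)"
    using assms by (intro As_pentagon) auto
  also have "\<dots> = As \<I> X Y \<bullet> As \<I> X Y" using assms by (simp add: 1)
  finally have "As \<I> X Y = As \<I> X Y \<bullet> As \<I> X Y" .
  moreover have "As \<I> X Y \<bullet> As' \<I> X Y = aid (X \<odot> Y)" using assms by simp
  ultimately show 2: "As \<I> X Y = aid (X \<odot> Y)" by (rule idem) (use assms in auto)
  have "As X Y \<I> = As X Y (\<I> \<odot> \<I>) \<bullet> As (X \<odot> Y) \<I> \<I>" using assms by (simp add: 1)
  also have "\<dots> = (aid X \<star> As Y \<I> \<I>) \<bullet> As X (Y \<odot> \<I>) \<I> \<bullet> (As X Y \<I> \<star> aid \<I>)"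
    using assms by (intro As_pentagon) auto
  also have "\<dots> = As X Y \<I> \<bullet> As X Y \<I>" using assms by (simp add: 1)
  finally have "As X Y \<I> = As X Y \<I> \<bullet> As X Y \<I>" .
  moreover have "As X Y \<I> \<bullet> As' X Y \<I> = aid (X \<odot> Y)" using assms by simp
  ultimately show 3: "As X Y \<I> = aid (X \<odot> Y)" by (rule idem) (use assms in auto)
  show "As X \<I> Y = aid (X \<odot> Y)" using assms by (rule 1)
  show "As' X \<I> Y = aid (X \<odot> Y)" "As' \<I> X Y = aid (X \<odot> Y)" "As' X Y \<I> = aid (X \<odot> Y)"
    by (rule inv[OF 1[OF assms] assms(1) unit_obj assms(2)] inv[OF 2 unit_obj assms] inv[OF 3 assms unit_obj])+
qed


lemma As'_natural:
  assumes "ar f" "ar g" "ar h"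
  shows "As' (cd f) (cd g) (cd h) \<bullet> (f \<star> (g \<star> h)) = ((f \<star> g) \<star> h) \<bullet> As' (dm f) (dm g) (dm h)"
  using assms by (simp add: triple_ten acmp_assoc)

lemma lwhisker_inverse [simp]:
  assumes "W \<in> obj C" "ar f" "ar g" "dm f = cd g" "f \<bullet> g = aid (dm g)"
  shows "(aid W \<star> f) \<bullet> (aid W \<star> g) = aid (W \<odot> dm g)"
    and "(aid W \<star> f) \<bullet> (aid W \<star> g) \<bullet> t = aid (W \<odot> dm g) \<bullet> t"
proof -
  show "(aid W \<star> f) \<bullet> (aid W \<star> g) = aid (W \<odot> dm g)"
    using assms by (simp add: lwhisker[symmetric])
  then show "(aid W \<star> f) \<bullet> (aid W \<star> g) \<bullet> t = aid (W \<odot> dm g) \<bullet> t"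
    by (simp only: acmp_assoc[symmetric])
qed

lemma rwhisker_inverse [simp]:
  assumes "W \<in> obj C" "ar f" "ar g" "dm f = cd g" "f \<bullet> g = aid (dm g)"
  shows "(f \<star> aid W) \<bullet> (g \<star> aid W) = aid (dm g \<odot> W)"
    and "(f \<star> aid W) \<bullet> (g \<star> aid W) \<bullet> t = aid (dm g \<odot> W) \<bullet> t"
proof -
  show "(f \<star> aid W) \<bullet> (g \<star> aid W) = aid (dm g \<odot> W)"
    using assms by (simp add: rwhisker[symmetric])
  then show "(f \<star> aid W) \<bullet> (g \<star> aid W) \<bullet> t = aid (dm g \<odot> W) \<bullet> t"
    by (simp only: acmp_assoc[symmetric])
qed

text \<open>Two ways of solving the pentagon for the associators that arise when an associator is tensored with \<open>Z\<close>.\<close>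

lemma pentagon_mid:
  assumes "W \<in> obj C" "X \<in> obj C" "Y \<in> obj C" "Z \<in> obj C"
  shows "As (W \<odot> X) Y Z \<bullet> (As' W X Y \<star> aid Z) = As' W X (Y \<odot> Z) \<bullet> (aid W \<star> As X Y Z) \<bullet> As W (X \<odot> Y) Z"
proof -
  have "As (W \<odot> X) Y Z \<bullet> (As' W X Y \<star> aid Z)
      = As' W X (Y \<odot> Z) \<bullet> (As W X (Y \<odot> Z) \<bullet> As (W \<odot> X) Y Z) \<bullet> (As' W X Y \<star> aid Z)"
    using assms by (simp add: acmp_assoc)
  then show ?thesis using assms by (simp add: acmp_assoc As_pentagon)
qed

lemma pentagon_mid':
  assumes "W \<in> obj C" "X \<in> obj C" "Y \<in> obj C" "Z \<in> obj C"
  shows "(As W X Y \<star> aid Z) \<bullet> As' (W \<odot> X) Y Z = As' W (X \<odot> Y) Z \<bullet> (aid W \<star> As' X Y Z) \<bullet> As W X (Y \<odot> Z)"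
proof -
  have "As' W (X \<odot> Y) Z \<bullet> (aid W \<star> As' X Y Z) \<bullet> As W X (Y \<odot> Z)
     = As' W (X \<odot> Y) Z \<bullet> (aid W \<star> As' X Y Z) \<bullet> (As W X (Y \<odot> Z) \<bullet> As (W \<odot> X) Y Z) \<bullet> As' (W \<odot> X) Y Z"
    using assms by (simp add: acmp_assoc)
  then show ?thesis using assms by (simp add: acmp_assoc As_pentagon)
qed

end

section \<open>Duals acting on the head of a tensor product\<close>

context left_rigid_category
begin

abbreviation dl :: "'o \<Rightarrow> 'o" where "dl X \<equiv> dual C X"

definition EV :: "'o \<Rightarrow> ('o, 'm) arrow" where "EV X = Arr (dl X \<odot> X) (ev C X) \<I>"
definition DB :: "'o \<Rightarrow> ('o, 'm) arrow" where "DB X = Arr \<I> (db C X) (X \<odot> dl X)"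

text \<open>Evaluation and coevaluation in front of a further object \<open>Z\<close>, all brackets nested to the right. In
  this form they are natural in \<open>Z\<close>, and the zigzag identities contain no associators, so that string
  diagrams can be computed as in a strict category.\<close>

definition Ev :: "'o \<Rightarrow> 'o \<Rightarrow> ('o, 'm) arrow" where
  "Ev X Z = (EV X \<star> aid Z) \<bullet> As' (dl X) X Z"
definition Db :: "'o \<Rightarrow> 'o \<Rightarrow> ('o, 'm) arrow" where
  "Db X Z = As X (dl X) Z \<bullet> (DB X \<star> aid Z)"

lemma dl_obj [simp]: "X \<in> obj C \<Longrightarrow> dl X \<in> obj C"
  by (rule dual_obj)

lemma EV_simps [simp]: "X \<in> obj C \<Longrightarrow> ar (EV X)" "dm (EV X) = dl X \<odot> X" "cd (EV X) = \<I>" "mor (EV X) = ev C X"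
  and DB_simps [simp]: "X \<in> obj C \<Longrightarrow> ar (DB X)" "dm (DB X) = \<I>" "cd (DB X) = X \<odot> dl X" "mor (DB X) = db C X"
  by (auto simp: EV_def DB_def ev_hom db_hom)

lemma Ev_simps [simp]:
  assumes "X \<in> obj C" "Z \<in> obj C"
  shows "ar (Ev X Z)" "dm (Ev X Z) = dl X \<odot> (X \<odot> Z)" "cd (Ev X Z) = Z"
    "ar (Db X Z)" "dm (Db X Z) = Z" "cd (Db X Z) = X \<odot> (dl X \<odot> Z)"
  using assms by (auto simp: Ev_def Db_def)

lemma Ev_unit: "X \<in> obj C \<Longrightarrow> Ev X \<I> = EV X" and Db_unit: "X \<in> obj C \<Longrightarrow> Db X \<I> = DB X"
  by (auto simp: Ev_def Db_def)

lemma tail_natural: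
  assumes "ar e" "dm e = N \<odot> A" "cd e = \<I>" "N \<in> obj C" "A \<in> obj C" "ar t" "dm t = Z" "cd t = Z'"
  shows "t \<bullet> (e \<star> aid Z) \<bullet> As' N A Z = ((e \<star> aid Z') \<bullet> As' N A Z') \<bullet> (aid N \<star> (aid A \<star> t))"
proof -
  have "t \<bullet> (e \<star> aid Z) \<bullet> As' N A Z = (aid \<I> \<star> t) \<bullet> (e \<star> aid Z) \<bullet> As' N A Z"
    using assms by (simp)
  also have "\<dots> = (e \<star> aid Z') \<bullet> (aid (N \<odot> A) \<star> t) \<bullet> As' N A Z"
    using assms by (subst slide_cmp[of e t "N \<odot> A" \<I> Z Z']) auto
  also have "\<dots> = (e \<star> aid Z') \<bullet> As' N A Z' \<bullet> (aid N \<star> (aid A \<star> t))"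
    using As'_natural[of "aid N" "aid A" t] assms by simp
  finally show ?thesis by (simp add: acmp_assoc)
qed

lemma Ev_natural:
  assumes "X \<in> obj C" "ar t" "dm t = Z" "cd t = Z'"
  shows "t \<bullet> Ev X Z = Ev X Z' \<bullet> (aid (dl X) \<star> (aid X \<star> t))"
  unfolding Ev_def using assms by (intro tail_natural) auto

lemma Db_natural:
  assumes "X \<in> obj C" "ar t" "dm t = Z" "cd t = Z'"
  shows "(aid X \<star> (aid (dl X) \<star> t)) \<bullet> Db X Z = Db X Z' \<bullet> t"
proof -
  have "(aid X \<star> (aid (dl X) \<star> t)) \<bullet> Db X Z = As X (dl X) Z' \<bullet> (aid (X \<odot> dl X) \<star> t) \<bullet> (DB X \<star> aid Z)"
    unfolding Db_def using As_natural[of "aid X" "aid (dl X)" t] assms by (simp add: acmp_assoc[symmetric])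
  also have "(aid (X \<odot> dl X) \<star> t) \<bullet> (DB X \<star> aid Z) = (DB X \<star> aid Z') \<bullet> (aid \<I> \<star> t)"
    using slide[of "DB X" t \<I> "X \<odot> dl X" Z Z'] assms by simp
  finally show ?thesis unfolding Db_def using assms by (simp add: acmp_assoc)
qed

lemma Ev_natural_cmp:
  assumes "X \<in> obj C" "ar t" "dm t = Z" "cd t = Z'"
  shows "t \<bullet> Ev X Z \<bullet> r = Ev X Z' \<bullet> (aid (dl X) \<star> (aid X \<star> t)) \<bullet> r"
  using Ev_natural[OF assms] by (metis acmp_assoc)

lemma zigzag_arrow:
  assumes "X \<in> obj C"
  shows "(aid X \<star> EV X) \<bullet> As X (dl X) X \<bullet> (DB X \<star> aid X) = aid X"
    and "(EV X \<star> aid (dl X)) \<bullet> As' (dl X) X (dl X) \<bullet> (aid (dl X) \<star> DB X) = aid (dl X)"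
  using assms zigzag1 zigzag2 by (auto intro!: arrow_eqI)

text \<open>The zigzag identity tensored with \<open>Z\<close>; the pentagon brings it into right-nested form.\<close>

lemma zz1 [simp]:
  assumes X: "X \<in> obj C" and Z: "Z \<in> obj C"
  shows "(aid X \<star> Ev X Z) \<bullet> Db X (X \<odot> Z) = aid (X \<odot> Z)"
proof -
  let ?Y = "dl X"
  have "aid (X \<odot> Z) = ((aid X \<star> EV X) \<bullet> As X ?Y X \<bullet> (DB X \<star> aid X)) \<star> aid Z"
    using X Z by (simp only: zigzag_arrow aid_ten)
  also have "\<dots> = ((aid X \<star> EV X) \<star> aid Z) \<bullet> (As X ?Y X \<star> aid Z) \<bullet> ((DB X \<star> aid X) \<star> aid Z)"
    using X Z by (simp add: rwhisker)
  also have "\<dots> = (aid X \<star> (EV X \<star> aid Z)) \<bullet> As X (?Y \<odot> X) Z \<bullet> (As X ?Y X \<star> aid Z) \<bullet> As' (X \<odot> ?Y) X Z \<bullet> (DB X \<star> aid (X \<odot> Z))"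
    using X Z by (simp add: triple_ten[of "aid X" "EV X" "aid Z"] triple_ten[of "DB X" "aid X" "aid Z"] acmp_assoc)
  also have "\<dots> = (aid X \<star> (EV X \<star> aid Z)) \<bullet> As X (?Y \<odot> X) Z \<bullet> ((As X ?Y X \<star> aid Z) \<bullet> As' (X \<odot> ?Y) X Z) \<bullet> (DB X \<star> aid (X \<odot> Z))"
    by (simp only: acmp_assoc)
  also have "\<dots> = (aid X \<star> Ev X Z) \<bullet> Db X (X \<odot> Z)"
    using X Z by (simp add: pentagon_mid' acmp_assoc Ev_def Db_def lwhisker)
  finally show ?thesis ..
qed

lemma zz2 [simp]:
  assumes X: "X \<in> obj C" and Z: "Z \<in> obj C"
  shows "Ev X (dl X \<odot> Z) \<bullet> (aid (dl X) \<star> Db X Z) = aid (dl X \<odot> Z)"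
proof -
  let ?Y = "dl X"
  have "aid (?Y \<odot> Z) = ((EV X \<star> aid ?Y) \<bullet> As' ?Y X ?Y \<bullet> (aid ?Y \<star> DB X)) \<star> aid Z"
    using X Z by (simp only: zigzag_arrow aid_ten dl_obj)
  also have "\<dots> = ((EV X \<star> aid ?Y) \<star> aid Z) \<bullet> (As' ?Y X ?Y \<star> aid Z) \<bullet> ((aid ?Y \<star> DB X) \<star> aid Z)"
    using X Z by (simp add: rwhisker)
  also have "\<dots> = (EV X \<star> aid (?Y \<odot> Z)) \<bullet> (As (?Y \<odot> X) ?Y Z \<bullet> (As' ?Y X ?Y \<star> aid Z)) \<bullet> As' ?Y (X \<odot> ?Y) Z \<bullet> (aid ?Y \<star> (DB X \<star> aid Z))"
    using X Z by (simp add: triple_ten[of "aid ?Y" "DB X" "aid Z"] triple_ten[of "EV X" "aid ?Y" "aid Z"] acmp_assoc)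
  also have "\<dots> = Ev X (?Y \<odot> Z) \<bullet> (aid ?Y \<star> Db X Z)"
    using X Z by (simp add: pentagon_mid acmp_assoc Ev_def Db_def lwhisker)
  finally show ?thesis ..
qed

lemma zz_cmp [simp]:
  assumes X: "X \<in> obj C" and Z: "Z \<in> obj C"
  shows "(aid X \<star> Ev X Z) \<bullet> Db X (X \<odot> Z) \<bullet> t = aid (X \<odot> Z) \<bullet> t"
   and "Ev X (dl X \<odot> Z) \<bullet> (aid (dl X) \<star> Db X Z) \<bullet> t = aid (dl X \<odot> Z) \<bullet> t"
  using zz1[OF assms] zz2[OF assms] by (simp_all only: acmp_assoc[symmetric])

lemma Ev_rwhisker:
  assumes "X \<in> obj C" "Z \<in> obj C" "D \<in> obj C"
  shows "Ev X Z \<star> aid D = Ev X (Z \<odot> D) \<bullet> (aid (dl X) \<star> As X Z D) \<bullet> As (dl X) (X \<odot> Z) D"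
  using assms by (simp add: Ev_def rwhisker triple_ten[of "EV X" "aid Z" "aid D"] acmp_assoc pentagon_mid)

lemma Db_rwhisker:
  assumes "X \<in> obj C" "Z \<in> obj C" "D \<in> obj C"
  shows "Db X Z \<star> aid D = As' X (dl X \<odot> Z) D \<bullet> (aid X \<star> As' (dl X) Z D) \<bullet> Db X (Z \<odot> D)"
  using assms
  by (simp add: Db_def rwhisker triple_ten[of "DB X" "aid Z" "aid D"])
    (simp add: acmp_assoc[symmetric] pentagon_mid')

end

section \<open>Comparison of duals\<close>

lemma (in monoidal_category) pre2: "a \<bullet> b = c \<Longrightarrow> a \<bullet> b \<bullet> t = c \<bullet> t"
  by (metis acmp_assoc)

lemma (in monoidal_category) pre3: "a \<bullet> b \<bullet> c = d \<Longrightarrow> a \<bullet> b \<bullet> c \<bullet> t = d \<bullet> t"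
  by (metis acmp_assoc)

context left_rigid_category
begin

definition dcmp :: "'o \<Rightarrow> 'o \<Rightarrow> ('o, 'm) arrow \<Rightarrow> ('o, 'm) arrow" where
  "dcmp A N e = (e \<star> aid (dl A)) \<bullet> As' N A (dl A) \<bullet> (aid N \<star> DB A)"

lemma dcmp_simps [simp]:
  assumes "A \<in> obj C" "N \<in> obj C" "ar e" "dm e = N \<odot> A" "cd e = \<I>"
  shows "ar (dcmp A N e)" "dm (dcmp A N e) = N" "cd (dcmp A N e) = dl A"
    "mor (dcmp A N e) = dual_comparison C A N (mor e)"
  using assms by (auto simp: dcmp_def dual_comparison_def)

text \<open>The comparison is characterised by \<open>ev (\<theta> \<otimes> A) = e\<close>: the new evaluation meets the coevaluation
  inside \<open>\<theta>\<close> in a zigzag.\<close>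

lemma dcmp_EV:
  assumes A: "A \<in> obj C" and N: "N \<in> obj C" and e: "ar e" "dm e = N \<odot> A" "cd e = \<I>"
  shows "EV A \<bullet> (dcmp A N e \<star> aid A) = e"
proof -
  have "dcmp A N e \<star> aid A = ((e \<star> aid (dl A)) \<star> aid A) \<bullet> (As' N A (dl A) \<star> aid A) \<bullet> ((aid N \<star> DB A) \<star> aid A)"
    unfolding dcmp_def using assms by (simp add: rwhisker)
  also have "\<dots> = (e \<star> aid (dl A \<odot> A)) \<bullet> (As (N \<odot> A) (dl A) A \<bullet> (As' N A (dl A) \<star> aid A))
      \<bullet> As' N (A \<odot> dl A) A \<bullet> (aid N \<star> (DB A \<star> aid A))"
    using assms by (simp add: triple_ten[of e "aid (dl A)" "aid A"] triple_ten[of "aid N" "DB A" "aid A"] acmp_assoc)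
  also have "\<dots> = (e \<star> aid (dl A \<odot> A)) \<bullet> As' N A (dl A \<odot> A) \<bullet> (aid N \<star> Db A A)"
    using assms by (simp add: pentagon_mid acmp_assoc Db_def lwhisker)
  finally have "EV A \<bullet> (dcmp A N e \<star> aid A)
      = EV A \<bullet> (e \<star> aid (dl A \<odot> A)) \<bullet> As' N A (dl A \<odot> A) \<bullet> (aid N \<star> Db A A)" by simp
  also have "\<dots> = (EV A \<bullet> (e \<star> aid (dl A \<odot> A)) \<bullet> As' N A (dl A \<odot> A)) \<bullet> (aid N \<star> Db A A)"
    by (simp only: acmp_assoc)
  also have "\<dots> = e \<bullet> (aid N \<star> (aid A \<star> Ev A \<I>)) \<bullet> (aid N \<star> Db A (A \<odot> \<I>))"
    using assms by (subst tail_natural[where Z' = \<I>]) (auto simp: acmp_assoc Ev_unit)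
  also have "\<dots> = e"
    using A N e zz1[OF A, of \<I>] by (subst lwhisker_inverse) auto
  finally show ?thesis .
qed

lemma dcmp_Ev:
  assumes A: "A \<in> obj C" and N: "N \<in> obj C" and e: "ar e" "dm e = N \<odot> A" "cd e = \<I>" and Z: "Z \<in> obj C"
  shows "Ev A Z \<bullet> (dcmp A N e \<star> aid (A \<odot> Z)) = (e \<star> aid Z) \<bullet> As' N A Z"
proof -
  have "As' (dl A) A Z \<bullet> (dcmp A N e \<star> aid (A \<odot> Z)) = ((dcmp A N e \<star> aid A) \<star> aid Z) \<bullet> As' N A Z"
    using As'_natural[of "dcmp A N e" "aid A" "aid Z"] assms by simp
  then have "Ev A Z \<bullet> (dcmp A N e \<star> aid (A \<odot> Z)) = (EV A \<star> aid Z) \<bullet> ((dcmp A N e \<star> aid A) \<star> aid Z) \<bullet> As' N A Z"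
    by (simp add: Ev_def acmp_assoc)
  also have "\<dots> = ((EV A \<bullet> (dcmp A N e \<star> aid A)) \<star> aid Z) \<bullet> As' N A Z"
    using assms by (simp add: rwhisker acmp_assoc)
  finally show ?thesis using dcmp_EV[OF A N e] by simp
qed

text \<open>The dual morphism of \<open>f\<close> is the comparison of \<open>ev\<close>, precomposed with \<open>f\<close>, with the evaluation of the source.\<close>

definition dmA :: "('o, 'm) arrow \<Rightarrow> ('o, 'm) arrow" where
  "dmA f = dcmp (dm f) (dl (cd f)) (EV (cd f) \<bullet> (aid (dl (cd f)) \<star> f))"

lemma dmA_simps [simp]:
  assumes "ar f"
  shows "ar (dmA f)" "dm (dmA f) = dl (cd f)" "cd (dmA f) = dl (dm f)" "mor (dmA f) = dualm C (dm f) (cd f) (mor f)"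
proof -
  let ?X = "dm f" and ?Y = "cd f"
  have "dmA f = (EV ?Y \<star> aid (dl ?X)) \<bullet> ((aid (dl ?Y) \<star> f) \<star> aid (dl ?X)) \<bullet> As' (dl ?Y) ?X (dl ?X) \<bullet> (aid (dl ?Y) \<star> DB ?X)"
    unfolding dmA_def dcmp_def using assms by (simp add: rwhisker acmp_assoc)
  then show "mor (dmA f) = dualm C ?X ?Y (mor f)"
    using assms by (simp add: dualm_def)
qed (use assms in \<open>simp_all add: dmA_def\<close>)

lemma dmA_Ev:
  assumes f: "ar f" "dm f = X" "cd f = Y" and Z: "Z \<in> obj C"
  shows "Ev X Z \<bullet> (dmA f \<star> aid (X \<odot> Z)) = Ev Y Z \<bullet> (aid (dl Y) \<star> (f \<star> aid Z))"
proof -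
  have "X \<in> obj C" "Y \<in> obj C" using f ar_obj by auto
  then have "Ev X Z \<bullet> (dmA f \<star> aid (X \<odot> Z)) = ((EV Y \<bullet> (aid (dl Y) \<star> f)) \<star> aid Z) \<bullet> As' (dl Y) X Z"
    unfolding dmA_def f(2,3) using f Z by (subst dcmp_Ev) auto
  also have "\<dots> = (EV Y \<star> aid Z) \<bullet> ((aid (dl Y) \<star> f) \<star> aid Z) \<bullet> As' (dl Y) X Z"
    using f Z \<open>Y \<in> obj C\<close> by (auto simp add: rwhisker acmp_assoc)
  also have "\<dots> = Ev Y Z \<bullet> (aid (dl Y) \<star> (f \<star> aid Z))"
    unfolding Ev_def using As'_natural[of "aid (dl Y)" f "aid Z"] f Z \<open>Y \<in> obj C\<close> by (simp add: acmp_assoc)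
  finally show ?thesis .
qed

lemma dmA_EV: "ar f \<Longrightarrow> dm f = X \<Longrightarrow> cd f = Y \<Longrightarrow> EV X \<bullet> (dmA f \<star> aid X) = EV Y \<bullet> (aid (dl Y) \<star> f)"
  using dmA_Ev[of f X Y \<I>] by (auto simp: Ev_unit)

lemma dmA_expand:
  assumes f: "ar f" "dm f = X" "cd f = Y"
  shows "dmA f = Ev Y (dl X) \<bullet> (aid (dl Y) \<star> ((f \<star> aid (dl X)) \<bullet> DB X))"
proof -
  have o: "X \<in> obj C" "Y \<in> obj C" using f ar_obj by auto
  then have "dmA f = (EV Y \<star> aid (dl X)) \<bullet> ((aid (dl Y) \<star> f) \<star> aid (dl X)) \<bullet> As' (dl Y) X (dl X) \<bullet> (aid (dl Y) \<star> DB X)"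
    unfolding dmA_def dcmp_def using f by (auto simp add: rwhisker acmp_assoc)
  also have "\<dots> = (EV Y \<star> aid (dl X)) \<bullet> (((aid (dl Y) \<star> f) \<star> aid (dl X)) \<bullet> As' (dl Y) X (dl X)) \<bullet> (aid (dl Y) \<star> DB X)"
    by (simp only: acmp_assoc)
  also have "((aid (dl Y) \<star> f) \<star> aid (dl X)) \<bullet> As' (dl Y) X (dl X) = As' (dl Y) Y (dl X) \<bullet> (aid (dl Y) \<star> (f \<star> aid (dl X)))"
    using As'_natural[of "aid (dl Y)" f "aid (dl X)"] f o by simp
  also have "(EV Y \<star> aid (dl X)) \<bullet> (As' (dl Y) Y (dl X) \<bullet> (aid (dl Y) \<star> (f \<star> aid (dl X)))) \<bullet> (aid (dl Y) \<star> DB X)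
    = Ev Y (dl X) \<bullet> (aid (dl Y) \<star> ((f \<star> aid (dl X)) \<bullet> DB X))"
    unfolding Ev_def using f o by (simp add: acmp_assoc lwhisker)
  finally show ?thesis .
qed

text \<open>A morphism slides around the cup onto the dual strand.\<close>

lemma dmA_DB:
  assumes f: "ar f" "dm f = X" "cd f = Y"
  shows "(aid Y \<star> dmA f) \<bullet> DB Y = (f \<star> aid (dl X)) \<bullet> DB X"
proof -
  have o: "X \<in> obj C" "Y \<in> obj C" using f ar_obj by auto
  define G where "G = (f \<star> aid (dl X)) \<bullet> DB X"
  have G: "ar G" "dm G = \<I>" "cd G = Y \<odot> dl X" unfolding G_def using f o by auto
  have "(aid Y \<star> dmA f) \<bullet> DB Y = (aid Y \<star> Ev Y (dl X)) \<bullet> (aid Y \<star> (aid (dl Y) \<star> G)) \<bullet> Db Y \<I>"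
    unfolding dmA_expand[OF f] G_def[symmetric] using o G by (simp add: lwhisker acmp_assoc Db_unit)
  also have "\<dots> = G" using o G by (subst Db_natural[where Z' = "Y \<odot> dl X"]) auto
  finally show ?thesis unfolding G_def .
qed

section \<open>The dual of a tensor product\<close>

definition evt :: "'o \<Rightarrow> 'o \<Rightarrow> ('o, 'm) arrow" where
  "evt X Y = EV Y \<bullet> (aid (dl Y) \<star> Ev X Y) \<bullet> As (dl Y) (dl X) (X \<odot> Y)"

text \<open>The canonical isomorphism \<open>Y\<^sup>\<or> \<otimes> X\<^sup>\<or> \<rightarrow> (X \<otimes> Y)\<^sup>\<or>\<close>. Its inverse is the mate of the nested
  coevaluation.\<close>

definition \<theta> :: "'o \<Rightarrow> 'o \<Rightarrow> ('o, 'm) arrow" where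
  "\<theta> X Y = dcmp (X \<odot> Y) (dl Y \<odot> dl X) (evt X Y)"

definition \<theta>' :: "'o \<Rightarrow> 'o \<Rightarrow> ('o, 'm) arrow" where
  "\<theta>' X Y = Ev (X \<odot> Y) (dl Y \<odot> dl X)
    \<bullet> (aid (dl (X \<odot> Y)) \<star> (As' X Y (dl Y \<odot> dl X) \<bullet> (aid X \<star> Db Y (dl X)) \<bullet> DB X))"

lemma evt_simps [simp]:
  assumes "X \<in> obj C" "Y \<in> obj C"
  shows "ar (evt X Y)" "dm (evt X Y) = (dl Y \<odot> dl X) \<odot> (X \<odot> Y)" "cd (evt X Y) = \<I>" "mor (evt X Y) = ev_tens C X Y"
  using assms by (auto simp: evt_def ev_tens_def Ev_def)

lemma \<theta>_simps [simp]:
  assumes "X \<in> obj C" "Y \<in> obj C"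
  shows "ar (\<theta> X Y)" "dm (\<theta> X Y) = dl Y \<odot> dl X" "cd (\<theta> X Y) = dl (X \<odot> Y)" "mor (\<theta> X Y) = dual_tens C X Y"
    "ar (\<theta>' X Y)" "dm (\<theta>' X Y) = dl (X \<odot> Y)" "cd (\<theta>' X Y) = dl Y \<odot> dl X"
  using assms by (auto simp: \<theta>_def \<theta>'_def dual_tens_def)

lemma evt_tail:
  assumes X: "X \<in> obj C" and Y: "Y \<in> obj C" and Z: "Z \<in> obj C"
  shows "(evt X Y \<star> aid Z) \<bullet> As' (dl Y \<odot> dl X) (X \<odot> Y) Z
    = Ev Y Z \<bullet> (aid (dl Y) \<star> Ev X (Y \<odot> Z)) \<bullet> (aid (dl Y) \<star> (aid (dl X) \<star> As X Y Z)) \<bullet> As (dl Y) (dl X) ((X \<odot> Y) \<odot> Z)"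
proof -
  have e: "EV Y \<star> aid Z = Ev Y Z \<bullet> As (dl Y) Y Z" using Y Z by (simp add: Ev_def acmp_assoc)
  have p: "(aid (dl Y) \<star> As (dl X) (X \<odot> Y) Z) \<bullet> As (dl Y) (dl X \<odot> (X \<odot> Y)) Z \<bullet> (As (dl Y) (dl X) (X \<odot> Y) \<star> aid Z)
      \<bullet> As' (dl Y \<odot> dl X) (X \<odot> Y) Z = As (dl Y) (dl X) ((X \<odot> Y) \<odot> Z)"
    using X Y Z by (subst pre3[OF As_pentagon[symmetric]]) (auto simp: acmp_assoc)
  have "(evt X Y \<star> aid Z) \<bullet> As' (dl Y \<odot> dl X) (X \<odot> Y) Z
    = (Ev Y Z \<bullet> As (dl Y) Y Z) \<bullet> ((aid (dl Y) \<star> Ev X Y) \<star> aid Z) \<bullet> (As (dl Y) (dl X) (X \<odot> Y) \<star> aid Z)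
      \<bullet> As' (dl Y \<odot> dl X) (X \<odot> Y) Z"
    unfolding evt_def using X Y Z by (simp add: rwhisker acmp_assoc e)
  also have "\<dots> = Ev Y Z \<bullet> (aid (dl Y) \<star> (Ev X Y \<star> aid Z)) \<bullet> As (dl Y) (dl X \<odot> (X \<odot> Y)) Z
      \<bullet> (As (dl Y) (dl X) (X \<odot> Y) \<star> aid Z) \<bullet> As' (dl Y \<odot> dl X) (X \<odot> Y) Z"
    using X Y Z by (simp add: triple_ten[of "aid (dl Y)" "Ev X Y" "aid Z"] acmp_assoc)
  also have "\<dots> = Ev Y Z \<bullet> (aid (dl Y) \<star> Ev X (Y \<odot> Z)) \<bullet> (aid (dl Y) \<star> (aid (dl X) \<star> As X Y Z))
      \<bullet> (aid (dl Y) \<star> As (dl X) (X \<odot> Y) Z) \<bullet> As (dl Y) (dl X \<odot> (X \<odot> Y)) Z \<bullet> (As (dl Y) (dl X) (X \<odot> Y) \<star> aid Z)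
      \<bullet> As' (dl Y \<odot> dl X) (X \<odot> Y) Z"
    using X Y Z by (simp add: Ev_rwhisker lwhisker acmp_assoc)
  finally show ?thesis unfolding p .
qed

lemma \<theta>_Ev:
  assumes X: "X \<in> obj C" and Y: "Y \<in> obj C" and Z: "Z \<in> obj C"
  shows "Ev (X \<odot> Y) Z \<bullet> (\<theta> X Y \<star> aid ((X \<odot> Y) \<odot> Z))
    = Ev Y Z \<bullet> (aid (dl Y) \<star> Ev X (Y \<odot> Z)) \<bullet> (aid (dl Y) \<star> (aid (dl X) \<star> As X Y Z)) \<bullet> As (dl Y) (dl X) ((X \<odot> Y) \<odot> Z)"
  unfolding \<theta>_def using assms by (simp add: dcmp_Ev evt_tail)

lemma \<theta>_expand:
  assumes X: "X \<in> obj C" and Y: "Y \<in> obj C"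
  shows "\<theta> X Y = Ev Y (dl (X \<odot> Y)) \<bullet> (aid (dl Y) \<star> (Ev X (Y \<odot> dl (X \<odot> Y))
    \<bullet> (aid (dl X) \<star> (As X Y (dl (X \<odot> Y)) \<bullet> DB (X \<odot> Y)))))"
proof -
  let ?z = "X \<odot> Y"
  have "As (dl Y) (dl X) (?z \<odot> dl ?z) \<bullet> (aid (dl Y \<odot> dl X) \<star> DB ?z) = (aid (dl Y) \<star> (aid (dl X) \<star> DB ?z))"
    using As_natural[of "aid (dl Y)" "aid (dl X)" "DB ?z"] X Y by simp
  moreover have "\<theta> X Y = ((evt X Y \<star> aid (dl ?z)) \<bullet> As' (dl Y \<odot> dl X) ?z (dl ?z)) \<bullet> (aid (dl Y \<odot> dl X) \<star> DB ?z)"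
    unfolding \<theta>_def dcmp_def by (simp add: acmp_assoc)
  ultimately show ?thesis using X Y by (simp add: evt_tail acmp_assoc lwhisker)
qed

text \<open>The nested coevaluation is the coevaluation of the tensor product, up to the comparison \<open>\<theta>\<close>.\<close>

lemma \<theta>_DB:
  assumes X: "X \<in> obj C" and Y: "Y \<in> obj C"
  shows "(aid X \<star> (aid Y \<star> \<theta> X Y)) \<bullet> (aid X \<star> Db Y (dl X)) \<bullet> DB X = As X Y (dl (X \<odot> Y)) \<bullet> DB (X \<odot> Y)"
proof -
  let ?z = "X \<odot> Y"
  define G where "G = As X Y (dl ?z) \<bullet> DB ?z"
  have G: "ar G" "dm G = \<I>" "cd G = X \<odot> (Y \<odot> dl ?z)" unfolding G_def using X Y by auto
  define H where "H = Ev X (Y \<odot> dl ?z) \<bullet> (aid (dl X) \<star> G)"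
  have H: "ar H" "dm H = dl X" "cd H = Y \<odot> dl ?z" unfolding H_def using X Y G by auto
  have \<theta>: "\<theta> X Y = Ev Y (dl ?z) \<bullet> (aid (dl Y) \<star> H)"
    unfolding H_def G_def by (rule \<theta>_expand[OF X Y])
  have "(aid Y \<star> \<theta> X Y) \<bullet> Db Y (dl X) = (aid Y \<star> Ev Y (dl ?z)) \<bullet> (aid Y \<star> (aid (dl Y) \<star> H)) \<bullet> Db Y (dl X)"
    unfolding \<theta> using X Y H by (simp add: lwhisker acmp_assoc)
  also have "\<dots> = H" using X Y H by (subst Db_natural[where Z' = "Y \<odot> dl ?z"]) auto
  finally have "(aid X \<star> (aid Y \<star> \<theta> X Y)) \<bullet> (aid X \<star> Db Y (dl X)) = aid X \<star> H"
    using X Y by (simp add: lwhisker[symmetric])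
  then have "(aid X \<star> (aid Y \<star> \<theta> X Y)) \<bullet> (aid X \<star> Db Y (dl X)) \<bullet> DB X = (aid X \<star> H) \<bullet> Db X \<I>"
    using X by (simp add: acmp_assoc[symmetric] Db_unit)
  also have "\<dots> = (aid X \<star> Ev X (Y \<odot> dl ?z)) \<bullet> (aid X \<star> (aid (dl X) \<star> G)) \<bullet> Db X \<I>"
    unfolding H_def using X Y G by (simp add: lwhisker acmp_assoc)
  also have "\<dots> = G" using X Y G by (subst Db_natural[where Z' = "X \<odot> (Y \<odot> dl ?z)"]) auto
  finally show ?thesis unfolding G_def .
qed

lemma \<theta>_inverse [simp]:
  assumes X: "X \<in> obj C" and Y: "Y \<in> obj C"
  shows "\<theta> X Y \<bullet> \<theta>' X Y = aid (dl (X \<odot> Y))" and "\<theta>' X Y \<bullet> \<theta> X Y = aid (dl Y \<odot> dl X)"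
proof -
  let ?z = "X \<odot> Y" and ?N = "dl Y \<odot> dl X"
  define \<delta> where "\<delta> = As' X Y ?N \<bullet> (aid X \<star> Db Y (dl X)) \<bullet> DB X"
  have \<delta>: "ar \<delta>" "dm \<delta> = \<I>" "cd \<delta> = ?z \<odot> ?N" unfolding \<delta>_def using X Y by auto
  have \<theta>': "\<theta>' X Y = Ev ?z ?N \<bullet> (aid (dl ?z) \<star> \<delta>)" unfolding \<theta>'_def \<delta>_def ..
  have "(aid ?z \<star> \<theta> X Y) \<bullet> As' X Y ?N = As' X Y (dl ?z) \<bullet> (aid X \<star> (aid Y \<star> \<theta> X Y))"
    using As'_natural[of "aid X" "aid Y" "\<theta> X Y"] X Y by simp
  then have "(aid ?z \<star> \<theta> X Y) \<bullet> \<delta> = As' X Y (dl ?z) \<bullet> (aid X \<star> (aid Y \<star> \<theta> X Y)) \<bullet> (aid X \<star> Db Y (dl X)) \<bullet> DB X"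
    unfolding \<delta>_def by (simp only: acmp_assoc[symmetric])
  also have "\<dots> = DB ?z" using X Y by (simp add: \<theta>_DB)
  finally have d: "(aid ?z \<star> \<theta> X Y) \<bullet> \<delta> = DB ?z" .
  have "\<theta> X Y \<bullet> \<theta>' X Y = Ev ?z (dl ?z) \<bullet> (aid (dl ?z) \<star> (aid ?z \<star> \<theta> X Y)) \<bullet> (aid (dl ?z) \<star> \<delta>)"
    unfolding \<theta>' using X Y by (subst Ev_natural_cmp[where Z' = "dl ?z"]) auto
  also have "\<dots> = Ev ?z (dl ?z) \<bullet> (aid (dl ?z) \<star> Db ?z \<I>)"
    using X Y \<delta> by (simp add: lwhisker[symmetric] d Db_unit)
  also have "\<dots> = aid (dl ?z)" using X Y zz2[of ?z \<I>] by simp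
  finally show "\<theta> X Y \<bullet> \<theta>' X Y = aid (dl ?z)" .
  have "\<theta>' X Y \<bullet> \<theta> X Y = Ev ?z ?N \<bullet> (aid (dl ?z) \<star> \<delta>) \<bullet> (\<theta> X Y \<star> aid \<I>)"
    unfolding \<theta>' using X Y by (simp add: acmp_assoc)
  also have "\<dots> = Ev ?z ?N \<bullet> (\<theta> X Y \<star> aid (?z \<odot> ?N)) \<bullet> (aid ?N \<star> \<delta>)"
    using X Y \<delta> slide[of "\<theta> X Y" \<delta> ?N "dl ?z" \<I> "?z \<odot> ?N"] by simp
  also have "\<dots> = Ev Y ?N \<bullet> (aid (dl Y) \<star> Ev X (Y \<odot> ?N)) \<bullet> (aid (dl Y) \<star> (aid (dl X) \<star> As X Y ?N))
      \<bullet> As (dl Y) (dl X) (?z \<odot> ?N) \<bullet> (aid ?N \<star> \<delta>)"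
    using X Y by (subst pre2[OF \<theta>_Ev]) (auto simp: acmp_assoc)
  also have "As (dl Y) (dl X) (?z \<odot> ?N) \<bullet> (aid ?N \<star> \<delta>) = aid (dl Y) \<star> (aid (dl X) \<star> \<delta>)"
    using As_natural[of "aid (dl Y)" "aid (dl X)" \<delta>] X Y \<delta> by simp
  also have "Ev Y ?N \<bullet> (aid (dl Y) \<star> Ev X (Y \<odot> ?N)) \<bullet> (aid (dl Y) \<star> (aid (dl X) \<star> As X Y ?N)) \<bullet> (aid (dl Y) \<star> (aid (dl X) \<star> \<delta>))
    = Ev Y ?N \<bullet> (aid (dl Y) \<star> (Ev X (Y \<odot> ?N) \<bullet> (aid (dl X) \<star> (As X Y ?N \<bullet> \<delta>))))"
    using X Y \<delta> by (simp add: lwhisker)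
  also have "As X Y ?N \<bullet> \<delta> = (aid X \<star> Db Y (dl X)) \<bullet> DB X"
    unfolding \<delta>_def using X Y by simp
  also have "Ev X (Y \<odot> ?N) \<bullet> (aid (dl X) \<star> ((aid X \<star> Db Y (dl X)) \<bullet> DB X))
      = Db Y (dl X) \<bullet> Ev X (dl X) \<bullet> (aid (dl X) \<star> DB X)"
    using X Y by (subst Ev_natural_cmp[where Z' = "Y \<odot> ?N"]) (auto simp: lwhisker)
  also have "\<dots> = Db Y (dl X)" using X Y zz2[of X \<I>] by (simp add: Db_unit)
  finally show "\<theta>' X Y \<bullet> \<theta> X Y = aid ?N" using X Y by simp
qed

end

section \<open>Pivotal traces\<close>

text \<open>Bending the strand \<open>W\<close> back with the coevaluation recovers \<open>t\<close> from \<open>ev (t \<otimes> W)\<close>.\<close>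

lemma (in left_rigid_category) EV_faithful:
  assumes W: "W \<in> obj C" and t: "ar t" "dm t = N" "cd t = dl W" and s: "ar s" "dm s = N" "cd s = dl W"
    and eq: "EV W \<bullet> (t \<star> aid W) = EV W \<bullet> (s \<star> aid W)"
  shows "t = s"
proof -
  have recover: "r = ((EV W \<bullet> (r \<star> aid W)) \<star> aid (dl W)) \<bullet> As' N W (dl W) \<bullet> (aid N \<star> DB W)"
    if r: "ar r" "dm r = N" "cd r = dl W" for r
  proof -
    have N: "N \<in> obj C" using r ar_obj by auto
    have "r = (Ev W (dl W) \<bullet> (aid (dl W) \<star> Db W \<I>)) \<bullet> (r \<star> aid \<I>)" using zz2[OF W, of \<I>] W r by simp
    also have "\<dots> = Ev W (dl W) \<bullet> (r \<star> aid (W \<odot> dl W)) \<bullet> (aid N \<star> DB W)"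
      using slide[of r "DB W" N "dl W" \<I> "W \<odot> dl W"] W r N by (simp add: acmp_assoc Db_unit)
    also have "\<dots> = (EV W \<star> aid (dl W)) \<bullet> (As' (dl W) W (dl W) \<bullet> (r \<star> (aid W \<star> aid (dl W)))) \<bullet> (aid N \<star> DB W)"
      unfolding Ev_def using W by (simp add: acmp_assoc)
    also have "As' (dl W) W (dl W) \<bullet> (r \<star> (aid W \<star> aid (dl W))) = ((r \<star> aid W) \<star> aid (dl W)) \<bullet> As' N W (dl W)"
      using As'_natural[of r "aid W" "aid (dl W)"] W r by (simp del: aid_ten)
    finally show ?thesis using W r by (simp add: rwhisker acmp_assoc)
  qed
  show ?thesis using recover[OF t] recover[OF s] eq by metis
qed

context pivotal_category
begin

definition PV :: "'a \<Rightarrow> ('a, 'b) arrow" where "PV X = Arr X (piv C X) (dl (dl X))"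
definition PV' :: "'a \<Rightarrow> ('a, 'b) arrow" where "PV' X = Arr (dl (dl X)) (piv_inv C X) X"
text \<open>The pivotal structure turns \<open>X\<^sup>\<or>\<close> into a dual of \<open>X\<close> on the other side as well, with these
  evaluation and coevaluation.\<close>

definition Evb :: "'a \<Rightarrow> 'a \<Rightarrow> ('a, 'b) arrow" where
  "Evb X Z = Ev (dl X) Z \<bullet> (PV X \<star> aid (dl X \<odot> Z))"
definition Dbb :: "'a \<Rightarrow> 'a \<Rightarrow> ('a, 'b) arrow" where
  "Dbb X Z = (aid (dl X) \<star> (PV' X \<star> aid Z)) \<bullet> Db (dl X) Z"

lemma PV_simps [simp]:
  assumes "X \<in> obj C"
  shows "ar (PV X)" "ar (PV' X)" "PV X \<bullet> PV' X = aid (dl (dl X))" "PV' X \<bullet> PV X = aid X"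
    "PV X \<bullet> PV' X \<bullet> t = aid (dl (dl X)) \<bullet> t" "PV' X \<bullet> PV X \<bullet> t = aid X \<bullet> t"
proof -
  have "inverse_of C X (dl (dl X)) (piv C X) (piv_inv C X)"
    unfolding piv_inv_def using assms by (intro minv_inverse piv_iso) auto
  then show 1: "ar (PV X)" "ar (PV' X)" and 2: "PV X \<bullet> PV' X = aid (dl (dl X))" "PV' X \<bullet> PV X = aid X"
    using piv_iso[OF assms] assms by (auto simp: PV_def PV'_def inverse_of_def is_iso_def acmp_def aid_def)
  show "PV X \<bullet> PV' X \<bullet> t = aid (dl (dl X)) \<bullet> t" "PV' X \<bullet> PV X \<bullet> t = aid X \<bullet> t"
    using 2 by (simp_all add: acmp_assoc[symmetric])
qed

lemma PV_dm_cd [simp]: "dm (PV X) = X" "cd (PV X) = dl (dl X)" "mor (PV X) = piv C X"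
  "dm (PV' X) = dl (dl X)" "cd (PV' X) = X" "mor (PV' X) = piv_inv C X"
  by (simp_all add: PV_def PV'_def)

lemma Evb_simps [simp]:
  assumes "X \<in> obj C" "Z \<in> obj C"
  shows "ar (Evb X Z)" "dm (Evb X Z) = X \<odot> (dl X \<odot> Z)" "cd (Evb X Z) = Z"
    "ar (Dbb X Z)" "dm (Dbb X Z) = Z" "cd (Dbb X Z) = dl X \<odot> (X \<odot> Z)"
  using assms by (auto simp: Evb_def Dbb_def)

lemma PV_natural: "ar f \<Longrightarrow> dm f = X \<Longrightarrow> cd f = Y \<Longrightarrow> PV Y \<bullet> f = dmA (dmA f) \<bullet> PV X"
  using ar_mor[of f] by (auto intro!: arrow_eqI simp: piv_natural)

lemma Evb_natural:
  assumes "X \<in> obj C" "ar t" "dm t = Z" "cd t = Z'"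
  shows "t \<bullet> Evb X Z = Evb X Z' \<bullet> (aid X \<star> (aid (dl X) \<star> t))"
proof -
  have "t \<bullet> Evb X Z = Ev (dl X) Z' \<bullet> (aid (dl (dl X)) \<star> (aid (dl X) \<star> t)) \<bullet> (PV X \<star> aid (dl X \<odot> Z))"
    unfolding Evb_def using assms by (subst Ev_natural_cmp[where Z' = Z']) auto
  then show ?thesis
    using slide[of "PV X" "aid (dl X) \<star> t" X "dl (dl X)" "dl X \<odot> Z" "dl X \<odot> Z'"] assms
    by (auto simp: Evb_def acmp_assoc)
qed

lemma Dbb_natural:
  assumes "X \<in> obj C" "ar t" "dm t = Z" "cd t = Z'"
  shows "(aid (dl X) \<star> (aid X \<star> t)) \<bullet> Dbb X Z = Dbb X Z' \<bullet> t"
proof -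
  have o: "Z \<in> obj C" "Z' \<in> obj C" using assms ar_obj[of t] by auto
  have "(aid X \<star> t) \<bullet> (PV' X \<star> aid Z) = (PV' X \<star> aid Z') \<bullet> (aid (dl (dl X)) \<star> t)"
    using slide[of "PV' X" t "dl (dl X)" X Z Z'] assms by simp
  moreover have "(aid (dl X) \<star> (aid X \<star> t)) \<bullet> Dbb X Z = (aid (dl X) \<star> ((aid X \<star> t) \<bullet> (PV' X \<star> aid Z))) \<bullet> Db (dl X) Z"
    unfolding Dbb_def using assms o by (simp add: lwhisker acmp_assoc)
  ultimately have "(aid (dl X) \<star> (aid X \<star> t)) \<bullet> Dbb X Z
      = (aid (dl X) \<star> (PV' X \<star> aid Z')) \<bullet> (aid (dl X) \<star> (aid (dl (dl X)) \<star> t)) \<bullet> Db (dl X) Z"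
    using assms o by (simp add: lwhisker acmp_assoc)
  then show ?thesis using assms o by (simp add: Db_natural[where Z' = Z'] Dbb_def acmp_assoc)
qed

lemma zz3:
  assumes X: "X \<in> obj C" and Z: "Z \<in> obj C"
  shows "Evb X (X \<odot> Z) \<bullet> (aid X \<star> Dbb X Z) = aid (X \<odot> Z)"
proof -
  let ?r = "(aid (dl X) \<star> (PV' X \<star> aid Z)) \<bullet> Db (dl X) Z"
  have "Evb X (X \<odot> Z) \<bullet> (aid X \<star> Dbb X Z) = Ev (dl X) (X \<odot> Z) \<bullet> (PV X \<star> aid (dl X \<odot> (X \<odot> Z))) \<bullet> (aid X \<star> ?r)"
    using X Z by (simp add: Evb_def Dbb_def acmp_assoc)
  also have "(PV X \<star> aid (dl X \<odot> (X \<odot> Z))) \<bullet> (aid X \<star> ?r) = (aid (dl (dl X)) \<star> ?r) \<bullet> (PV X \<star> aid Z)"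
    using slide[of "PV X" ?r X "dl (dl X)" Z "dl X \<odot> (X \<odot> Z)"] X Z by simp
  also have "Ev (dl X) (X \<odot> Z) \<bullet> (aid (dl (dl X)) \<star> ?r) \<bullet> (PV X \<star> aid Z)
      = (Ev (dl X) (X \<odot> Z) \<bullet> (aid (dl (dl X)) \<star> (aid (dl X) \<star> (PV' X \<star> aid Z)))) \<bullet> (aid (dl (dl X)) \<star> Db (dl X) Z) \<bullet> (PV X \<star> aid Z)"
    using X Z by (simp add: lwhisker acmp_assoc)
  also have "\<dots> = (PV' X \<star> aid Z) \<bullet> (PV X \<star> aid Z)"
    using X Z by (subst Ev_natural[symmetric, where Z = "dl (dl X) \<odot> Z"]) (auto simp: acmp_assoc)
  finally show ?thesis using X Z by simp
qed

lemma Evb_rwhisker: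
  assumes "X \<in> obj C" "Z \<in> obj C" "D \<in> obj C"
  shows "Evb X Z \<star> aid D = Evb X (Z \<odot> D) \<bullet> (aid X \<star> As (dl X) Z D) \<bullet> As X (dl X \<odot> Z) D"
proof -
  let ?Y = "dl X"
  have "Evb X Z \<star> aid D = Ev ?Y (Z \<odot> D) \<bullet> (aid (dl ?Y) \<star> As ?Y Z D) \<bullet> As (dl ?Y) (?Y \<odot> Z) D \<bullet> ((PV X \<star> aid (?Y \<odot> Z)) \<star> aid D)"
    unfolding Evb_def using assms by (simp add: rwhisker Ev_rwhisker acmp_assoc)
  also have "\<dots> = Ev ?Y (Z \<odot> D) \<bullet> (aid (dl ?Y) \<star> As ?Y Z D) \<bullet> (PV X \<star> aid ((?Y \<odot> Z) \<odot> D)) \<bullet> As X (?Y \<odot> Z) D"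
    using assms by (simp add: triple_ten[of "PV X"])
  also have "\<dots> = Ev ?Y (Z \<odot> D) \<bullet> (PV X \<star> aid (?Y \<odot> (Z \<odot> D))) \<bullet> (aid X \<star> As ?Y Z D) \<bullet> As X (?Y \<odot> Z) D"
    using assms slide_cmp[of "PV X" "As ?Y Z D" X "dl ?Y" "(?Y \<odot> Z) \<odot> D" "?Y \<odot> (Z \<odot> D)"] by simp
  finally show ?thesis by (simp add: Evb_def acmp_assoc)
qed

lemma Dbb_rwhisker:
  assumes "X \<in> obj C" "Z \<in> obj C" "D \<in> obj C"
  shows "Dbb X Z \<star> aid D = As' (dl X) (X \<odot> Z) D \<bullet> (aid (dl X) \<star> As' X Z D) \<bullet> Dbb X (Z \<odot> D)"
proof -
  let ?Y = "dl X"
  have "Dbb X Z \<star> aid D = ((aid ?Y \<star> (PV' X \<star> aid Z)) \<star> aid D) \<bullet> (Db ?Y Z \<star> aid D)"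
    unfolding Dbb_def using assms by (simp add: rwhisker)
  also have "\<dots> = As' ?Y (X \<odot> Z) D \<bullet> (aid ?Y \<star> ((PV' X \<star> aid Z) \<star> aid D)) \<bullet> As ?Y (dl ?Y \<odot> Z) D \<bullet> (Db ?Y Z \<star> aid D)"
    using assms by (simp add: triple_ten[of "aid ?Y"] acmp_assoc)
  also have "\<dots> = As' ?Y (X \<odot> Z) D \<bullet> (aid ?Y \<star> As' X Z D) \<bullet> (aid ?Y \<star> (PV' X \<star> aid (Z \<odot> D))) \<bullet> Db ?Y (Z \<odot> D)"
    using assms by (simp add: triple_ten[of "PV' X"] Db_rwhisker lwhisker acmp_assoc)
  finally show ?thesis by (simp add: Dbb_def)
qed

lemma PV_tens:
  assumes X: "X \<in> obj C" and Y: "Y \<in> obj C"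
  shows "PV (X \<odot> Y) = dmA (\<theta>' X Y) \<bullet> \<theta> (dl Y) (dl X) \<bullet> (PV X \<star> PV Y)"
proof -
  have "dual_tens C X Y \<cdot> mor (\<theta>' X Y) = mor (\<theta> X Y \<bullet> \<theta>' X Y)" "mor (\<theta>' X Y) \<cdot> dual_tens C X Y = mor (\<theta>' X Y \<bullet> \<theta> X Y)"
    using X Y by (simp_all del: \<theta>_inverse)
  then have "inverse_of C (dl Y \<odot> dl X) (dl (X \<odot> Y)) (dual_tens C X Y) (mor (\<theta>' X Y))"
    using ar_mor[of "\<theta>' X Y"] X Y by (simp add: inverse_of_def)
  then have "minv C (dl Y \<odot> dl X) (dl (X \<odot> Y)) (dual_tens C X Y) = mor (\<theta>' X Y)"
    using ar_mor[of "\<theta> X Y"] X Y by (intro minv_eq) auto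
  then show ?thesis using X Y
    by (intro arrow_eqI) (auto simp: piv_tens ddual_tens_def cmp_assoc ar_mor acmp_assoc[symmetric])
qed

text \<open>The nested evaluation is, up to \<open>\<theta>\<close>, the right evaluation of the tensor product, because the
  pivotal structure is monoidal.\<close>

lemma \<theta>_Evb:
  assumes X: "X \<in> obj C" and Y: "Y \<in> obj C"
  shows "Evb (X \<odot> Y) \<I> \<bullet> (aid (X \<odot> Y) \<star> \<theta> X Y) = Evb X \<I> \<bullet> (aid X \<star> Evb Y (dl X)) \<bullet> As X Y (dl Y \<odot> dl X)"
proof -
  let ?z = "X \<odot> Y" and ?N = "dl Y \<odot> dl X" and ?P = "PV X \<star> PV Y" and ?t = "\<theta> (dl Y) (dl X)"
  have "Evb ?z \<I> \<bullet> (aid ?z \<star> \<theta> X Y) = EV (dl ?z) \<bullet> (PV ?z \<star> aid (dl ?z)) \<bullet> (aid ?z \<star> \<theta> X Y)"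
    using X Y by (simp add: Evb_def Ev_unit acmp_assoc)
  also have "(PV ?z \<star> aid (dl ?z)) \<bullet> (aid ?z \<star> \<theta> X Y) = (aid (dl (dl ?z)) \<star> \<theta> X Y) \<bullet> (PV ?z \<star> aid ?N)"
    using X Y slide[of "PV ?z" "\<theta> X Y" ?z "dl (dl ?z)" ?N "dl ?z"] by simp
  also have "\<dots> = (aid (dl (dl ?z)) \<star> \<theta> X Y) \<bullet> (dmA (\<theta>' X Y) \<star> aid ?N) \<bullet> (?t \<star> aid ?N) \<bullet> (?P \<star> aid ?N)"
    using X Y by (simp add: PV_tens rwhisker)
  also have "\<dots> = (dmA (\<theta>' X Y) \<star> aid (dl ?z)) \<bullet> (aid (dl ?N) \<star> \<theta> X Y) \<bullet> (?t \<star> aid ?N) \<bullet> (?P \<star> aid ?N)"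
    using X Y slide_cmp[of "dmA (\<theta>' X Y)" "\<theta> X Y" "dl ?N" "dl (dl ?z)" ?N "dl ?z"] by simp
  also have "EV (dl ?z) \<bullet> \<dots> = (EV ?N \<bullet> (aid (dl ?N) \<star> \<theta>' X Y)) \<bullet> (aid (dl ?N) \<star> \<theta> X Y) \<bullet> (?t \<star> aid ?N) \<bullet> (?P \<star> aid ?N)"
    using X Y pre2[OF dmA_EV[of "\<theta>' X Y" "dl ?z" ?N]] by simp
  also have "\<dots> = (Ev ?N \<I> \<bullet> (?t \<star> aid (?N \<odot> \<I>))) \<bullet> (?P \<star> aid ?N)"
    using X Y by (simp add: acmp_assoc Ev_unit)
  also have "\<dots> = Ev (dl X) \<I> \<bullet> (aid (dl (dl X)) \<star> Ev (dl Y) (dl X)) \<bullet> As (dl (dl X)) (dl (dl Y)) ?N \<bullet> (?P \<star> aid ?N)"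
    using X Y by (subst \<theta>_Ev) (auto simp: acmp_assoc)
  also have "As (dl (dl X)) (dl (dl Y)) ?N \<bullet> (?P \<star> aid ?N) = (PV X \<star> (PV Y \<star> aid ?N)) \<bullet> As X Y ?N"
    using As_natural[of "PV X" "PV Y" "aid ?N"] X Y by simp
  also have "PV X \<star> (PV Y \<star> aid ?N) = (PV X \<star> aid (dl (dl Y) \<odot> ?N)) \<bullet> (aid X \<star> (PV Y \<star> aid ?N))"
    using X Y by (intro ten_split) auto
  also have "Ev (dl X) \<I> \<bullet> (aid (dl (dl X)) \<star> Ev (dl Y) (dl X)) \<bullet> (\<dots> \<bullet> As X Y ?N)
      = Ev (dl X) \<I> \<bullet> (PV X \<star> aid (dl X)) \<bullet> (aid X \<star> Ev (dl Y) (dl X)) \<bullet> (aid X \<star> (PV Y \<star> aid ?N)) \<bullet> As X Y ?N"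
    using X Y slide_cmp[of "PV X" "Ev (dl Y) (dl X)" X "dl (dl X)" "dl (dl Y) \<odot> ?N" "dl X"] by (simp add: acmp_assoc)
  also have "\<dots> = Evb X \<I> \<bullet> (aid X \<star> Evb Y (dl X)) \<bullet> As X Y ?N"
    using X Y by (simp add: Evb_def lwhisker acmp_assoc)
  finally show ?thesis .
qed

text \<open>The right pivotal trace as an endomorphism of the unit object.\<close>

definition TrA :: "('a, 'b) arrow \<Rightarrow> ('a, 'b) arrow" where
  "TrA f = Evb (dm f) \<I> \<bullet> (f \<star> aid (dl (dm f))) \<bullet> DB (dm f)"

lemma TrA_simps [simp]:
  assumes "ar f" "cd f = dm f"
  shows "ar (TrA f)" "dm (TrA f) = \<I>" "cd (TrA f) = \<I>" "mor (TrA f) = ptr_right C (dm f) (mor f)"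
  using assms by (auto simp: TrA_def ptr_right_def ev_bar_def Evb_def Ev_unit)

lemma Evb_dmA:
  assumes f: "ar f" "dm f = X" "cd f = Y"
  shows "Evb Y \<I> \<bullet> (f \<star> aid (dl Y)) = Evb X \<I> \<bullet> (aid X \<star> dmA f)"
proof -
  have o: "X \<in> obj C" "Y \<in> obj C" using f ar_obj by auto
  have "Evb Y \<I> \<bullet> (f \<star> aid (dl Y)) = EV (dl Y) \<bullet> ((PV Y \<bullet> f) \<star> aid (dl Y))"
    using o f by (simp add: Evb_def Ev_unit rwhisker acmp_assoc)
  also have "\<dots> = (EV (dl Y) \<bullet> (dmA (dmA f) \<star> aid (dl Y))) \<bullet> (PV X \<star> aid (dl Y))"
    unfolding PV_natural[OF f] using o f by (simp add: rwhisker acmp_assoc)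
  also have "\<dots> = (EV (dl X) \<bullet> (aid (dl (dl X)) \<star> dmA f)) \<bullet> (PV X \<star> aid (dl Y))"
    using o f by (subst dmA_EV) auto
  also have "\<dots> = EV (dl X) \<bullet> (PV X \<star> aid (dl X)) \<bullet> (aid X \<star> dmA f)"
    using o f slide[of "PV X" "dmA f" X "dl (dl X)" "dl Y" "dl X"] by (simp add: acmp_assoc)
  finally show ?thesis using o by (simp add: Evb_def Ev_unit acmp_assoc)
qed

text \<open>\<open>f\<close> slides along the closed strand: around the evaluation it becomes its dual by naturality of the
  pivotal structure, and around the coevaluation it turns back into \<open>f\<close>.\<close>

lemma TrA_cyclic:
  assumes f: "ar f" "dm f = X" "cd f = Y" and g: "ar g" "dm g = Y" "cd g = X"
  shows "TrA (f \<bullet> g) = TrA (g \<bullet> f)"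
proof -
  have o: "X \<in> obj C" "Y \<in> obj C" using f ar_obj by auto
  have "TrA (f \<bullet> g) = (Evb Y \<I> \<bullet> (f \<star> aid (dl Y))) \<bullet> (g \<star> aid (dl Y)) \<bullet> DB Y"
    using o f g by (simp add: TrA_def rwhisker acmp_assoc)
  also have "\<dots> = Evb X \<I> \<bullet> (aid X \<star> dmA f) \<bullet> (g \<star> aid (dl Y)) \<bullet> DB Y"
    unfolding Evb_dmA[OF f] by (simp add: acmp_assoc)
  also have "\<dots> = Evb X \<I> \<bullet> (g \<star> aid (dl X)) \<bullet> (aid Y \<star> dmA f) \<bullet> DB Y"
    using o f g slide_cmp[of g "dmA f" Y X "dl Y" "dl X"] by simp
  also have "\<dots> = Evb X \<I> \<bullet> (g \<star> aid (dl X)) \<bullet> (f \<star> aid (dl X)) \<bullet> DB X"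
    by (simp add: dmA_DB[OF f])
  finally show ?thesis using o f g by (simp add: TrA_def rwhisker acmp_assoc)
qed

section \<open>Partial traces\<close>

text \<open>A morphism \<open>h : A \<otimes> y \<rightarrow> B \<otimes> z\<close> acts in front of \<open>D\<close> through \<open>ext\<close>. The partial traces close
  the strand \<open>y\<close> on the right of \<open>A\<close>, respectively the strand \<open>x\<close> on its left, again in front of \<open>D\<close>.\<close>

definition ext :: "'a \<Rightarrow> 'a \<Rightarrow> 'a \<Rightarrow> 'a \<Rightarrow> ('a, 'b) arrow \<Rightarrow> 'a \<Rightarrow> ('a, 'b) arrow" where
  "ext A y B z h D = As B z D \<bullet> (h \<star> aid D) \<bullet> As' A y D"

definition pR :: "'a \<Rightarrow> 'a \<Rightarrow> 'a \<Rightarrow> ('a, 'b) arrow \<Rightarrow> 'a \<Rightarrow> ('a, 'b) arrow" where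
  "pR A y B h D = (aid B \<star> Evb y D) \<bullet> ext A y B y h (dl y \<odot> D) \<bullet> (aid A \<star> Db y D)"

definition pL :: "'a \<Rightarrow> 'a \<Rightarrow> 'a \<Rightarrow> ('a, 'b) arrow \<Rightarrow> 'a \<Rightarrow> ('a, 'b) arrow" where
  "pL x y z h D = Ev x (z \<odot> D) \<bullet> (aid (dl x) \<star> ext x y x z h D) \<bullet> Dbb x (y \<odot> D)"

context
  fixes A y B z h
  assumes o [simp]: "A \<in> obj C" "y \<in> obj C" "B \<in> obj C" "z \<in> obj C"
    and h [simp]: "ar h" "dm h = A \<odot> y" "cd h = B \<odot> z"
begin

lemma ext_simps [simp]:
  assumes "D \<in> obj C"
  shows "ar (ext A y B z h D)" "dm (ext A y B z h D) = A \<odot> (y \<odot> D)" "cd (ext A y B z h D) = B \<odot> (z \<odot> D)"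
  using assms by (auto simp: ext_def)

lemma ext_unit [simp]: "ext A y B z h \<I> = h"
  by (simp add: ext_def)

lemma ext_rwhisker:
  assumes "c \<in> obj C" "D \<in> obj C"
  shows "ext A y B z h c \<star> aid D = As' B (z \<odot> c) D \<bullet> (aid B \<star> As' z c D) \<bullet> ext A y B z h (c \<odot> D)
    \<bullet> (aid A \<star> As y c D) \<bullet> As A (y \<odot> c) D"
proof -
  have "ext A y B z h c \<star> aid D = ((As B z c \<star> aid D) \<bullet> As' (B \<odot> z) c D) \<bullet> (h \<star> aid (c \<odot> D)) \<bullet> (As (A \<odot> y) c D \<bullet> (As' A y c \<star> aid D))"
    unfolding ext_def using assms by (simp add: rwhisker triple_ten[of h] acmp_assoc)
  then show ?thesis using assms by (simp add: pentagon_mid pentagon_mid' ext_def acmp_assoc)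
qed

lemma ext_natural:
  assumes t: "ar t" "dm t = D" "cd t = D'"
  shows "ext A y B z h D' \<bullet> (aid A \<star> (aid y \<star> t)) = (aid B \<star> (aid z \<star> t)) \<bullet> ext A y B z h D"
proof -
  have o': "D \<in> obj C" "D' \<in> obj C" using t ar_obj by auto
  have "ext A y B z h D' \<bullet> (aid A \<star> (aid y \<star> t)) = As B z D' \<bullet> (h \<star> aid D') \<bullet> (aid (A \<odot> y) \<star> t) \<bullet> As' A y D"
    unfolding ext_def using o' t As'_natural[of "aid A" "aid y" t] by (simp add: acmp_assoc)
  also have "\<dots> = As B z D' \<bullet> (aid (B \<odot> z) \<star> t) \<bullet> (h \<star> aid D) \<bullet> As' A y D"
    using o' t slide_cmp[of h t "A \<odot> y" "B \<odot> z" D D'] by simp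
  also have "\<dots> = (aid B \<star> (aid z \<star> t)) \<bullet> ext A y B z h D"
    unfolding ext_def using o' t pre2[OF As_natural[of "aid B" "aid z" t]] by (simp add: acmp_assoc)
  finally show ?thesis .
qed

end

lemma ext_cmp:
  assumes "A \<in> obj C" "y \<in> obj C" "B \<in> obj C" "z \<in> obj C" "E \<in> obj C" "w \<in> obj C" "D \<in> obj C"
    and "ar h" "dm h = A \<odot> y" "cd h = B \<odot> z" "ar g" "dm g = B \<odot> z" "cd g = E \<odot> w"
  shows "ext A y E w (g \<bullet> h) D = ext B z E w g D \<bullet> ext A y B z h D"
  using assms by (simp add: ext_def rwhisker acmp_assoc)

lemma ext_ten:
  assumes "A \<in> obj C" "y \<in> obj C" "D \<in> obj C" "ar a" "dm a = A" "cd a = B"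
  shows "ext A y B y (a \<star> aid y) D = a \<star> aid (y \<odot> D)" "ext y A y B (aid y \<star> a) D = aid y \<star> (a \<star> aid D)"
  using assms by (auto simp: ext_def triple_ten acmp_assoc)

lemma pR_simps [simp]:
  assumes "A \<in> obj C" "y \<in> obj C" "B \<in> obj C" "D \<in> obj C" "ar h" "dm h = A \<odot> y" "cd h = B \<odot> y"
  shows "ar (pR A y B h D)" "dm (pR A y B h D) = A \<odot> D" "cd (pR A y B h D) = B \<odot> D"
  using assms by (auto simp: pR_def)

lemma pL_simps [simp]:
  assumes "x \<in> obj C" "y \<in> obj C" "z \<in> obj C" "D \<in> obj C" "ar h" "dm h = x \<odot> y" "cd h = x \<odot> z"
  shows "ar (pL x y z h D)" "dm (pL x y z h D) = y \<odot> D" "cd (pL x y z h D) = z \<odot> D"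
  using assms by (auto simp: pL_def)

lemma pR_rwhisker:
  assumes "A \<in> obj C" "y \<in> obj C" "B \<in> obj C" "D \<in> obj C" "ar h" "dm h = A \<odot> y" "cd h = B \<odot> y"
  shows "pR A y B h \<I> \<star> aid D = pR A y B h D"
  using assms
  by (simp add: pR_def rwhisker triple_ten[of "aid B" "Evb y \<I>"] triple_ten[of "aid A" "Db y \<I>"]
    Evb_rwhisker Db_rwhisker ext_rwhisker[of A y B y h] lwhisker acmp_assoc)

lemma pL_rwhisker:
  assumes "x \<in> obj C" "y \<in> obj C" "z \<in> obj C" "D \<in> obj C" "ar h" "dm h = x \<odot> y" "cd h = x \<odot> z"
  shows "pL x y z h \<I> \<star> aid D = pL x y z h D"
  using assms
  by (simp add: pL_def rwhisker triple_ten[of "aid (dl x)" h] ext_def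
    Ev_rwhisker Dbb_rwhisker lwhisker acmp_assoc)

text \<open>The comparison \<open>\<theta>\<close> replaces the cup and the cap of \<open>x \<otimes> y\<close> by nested ones, so that
  the trace over a tensor product becomes an iterated partial trace.\<close>

lemma TrA_pR:
  assumes x: "x \<in> obj C" and y: "y \<in> obj C" and h: "ar h" "dm h = x \<odot> y" "cd h = x \<odot> y"
  shows "TrA h = TrA (pR x y x h \<I>)"
proof -
  let ?z = "x \<odot> y" and ?N = "dl y \<odot> dl x"
  have "DB ?z = As' x y (dl ?z) \<bullet> (aid x \<star> (aid y \<star> \<theta> x y)) \<bullet> (aid x \<star> Db y (dl x)) \<bullet> DB x"
    using x y by (simp add: \<theta>_DB)
  also have "\<dots> = (As' x y (dl ?z) \<bullet> (aid x \<star> (aid y \<star> \<theta> x y))) \<bullet> (aid x \<star> Db y (dl x)) \<bullet> DB x"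
    by (simp only: acmp_assoc)
  also have "As' x y (dl ?z) \<bullet> (aid x \<star> (aid y \<star> \<theta> x y)) = (aid ?z \<star> \<theta> x y) \<bullet> As' x y ?N"
    using As'_natural[of "aid x" "aid y" "\<theta> x y"] x y by simp
  finally have "TrA h = Evb ?z \<I> \<bullet> (h \<star> aid (dl ?z)) \<bullet> (aid ?z \<star> \<theta> x y) \<bullet> As' x y ?N \<bullet> (aid x \<star> Db y (dl x)) \<bullet> DB x"
    using h by (simp add: TrA_def acmp_assoc)
  also have "\<dots> = Evb ?z \<I> \<bullet> (aid ?z \<star> \<theta> x y) \<bullet> (h \<star> aid ?N) \<bullet> As' x y ?N \<bullet> (aid x \<star> Db y (dl x)) \<bullet> DB x"
    using x y h slide_cmp[of h "\<theta> x y" ?z ?z ?N "dl ?z"] by simp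
  also have "\<dots> = Evb x \<I> \<bullet> (aid x \<star> Evb y (dl x)) \<bullet> As x y ?N \<bullet> (h \<star> aid ?N) \<bullet> As' x y ?N \<bullet> (aid x \<star> Db y (dl x)) \<bullet> DB x"
    using x y by (subst pre2[OF \<theta>_Evb]) (auto simp: acmp_assoc)
  also have "\<dots> = Evb x \<I> \<bullet> pR x y x h (dl x) \<bullet> DB x"
    by (simp add: pR_def ext_def acmp_assoc)
  also have "\<dots> = TrA (pR x y x h \<I>)"
    using x y h by (simp add: TrA_def pR_rwhisker)
  finally show ?thesis .
qed

lemma unit_loop: "Evb \<I> \<I> \<bullet> DB \<I> = aid \<I>"
proof -
  have PV: "PV \<I> = dmA (EV \<I>) \<bullet> DB \<I>"
    by (intro arrow_eqI) (simp_all add: piv_unit ddual_unit_def)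
  have zz: "EV \<I> \<bullet> DB \<I> = aid \<I>" using zigzag_arrow(1)[of \<I>] by simp
  have "Evb \<I> \<I> \<bullet> DB \<I> = (EV (dl \<I>) \<bullet> (dmA (EV \<I>) \<star> aid (dl \<I>))) \<bullet> (DB \<I> \<star> aid (dl \<I>)) \<bullet> DB \<I>"
    by (simp add: Evb_def Ev_unit PV rwhisker acmp_assoc)
  also have "\<dots> = EV \<I> \<bullet> (aid (dl \<I>) \<star> EV \<I>) \<bullet> (DB \<I> \<star> aid (dl \<I>)) \<bullet> DB \<I>"
    by (subst dmA_EV[of "EV \<I>" "dl \<I>" \<I>]) (auto simp: acmp_assoc)
  also have "\<dots> = EV \<I> \<bullet> DB \<I> \<bullet> EV \<I> \<bullet> DB \<I>"
    using slide_cmp[of "DB \<I>" "EV \<I>" \<I> "dl \<I>" "dl \<I>" \<I> "DB \<I>"] by simp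
  finally show ?thesis by (simp add: zz)
qed

text \<open>The evaluation of \<open>U\<close> closes a strand \<open>U\<^sup>\<or>\<close> on its right, once \<open>U\<close> is identified
  with \<open>U\<^sup>\<or>\<^sup>\<or>\<close>: naturality of the pivotal structure at the morphism \<open>ev\<close>.\<close>

lemma EV_eq_Evb:
  assumes U: "U \<in> obj C"
  shows "EV U = Evb (dl U) \<I> \<bullet> (aid (dl U) \<star> PV U)"
proof -
  let ?z = "dl U \<odot> U" and ?W = "dl (dl U)" and ?f = "EV U"
  have "dmA ?f \<bullet> DB \<I> = (EV U \<star> aid (dl ?z)) \<bullet> DB ?z"
    using dmA_DB[of ?f ?z \<I>] U by simp
  also have "DB ?z = As' (dl U) U (dl ?z) \<bullet> (aid (dl U) \<star> (aid U \<star> \<theta> (dl U) U)) \<bullet> (aid (dl U) \<star> Db U ?W) \<bullet> DB (dl U)"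
    using U by (simp add: \<theta>_DB)
  also have "(EV U \<star> aid (dl ?z)) \<bullet> \<dots> = (Ev U (dl ?z) \<bullet> (aid (dl U) \<star> (aid U \<star> \<theta> (dl U) U))) \<bullet> (aid (dl U) \<star> Db U ?W) \<bullet> DB (dl U)"
    by (simp add: Ev_def acmp_assoc)
  also have "\<dots> = \<theta> (dl U) U \<bullet> DB (dl U)"
    using U by (subst Ev_natural[symmetric, where Z = "dl U \<odot> ?W"]) (auto simp: acmp_assoc)
  finally have f: "dmA ?f \<bullet> DB \<I> = \<theta> (dl U) U \<bullet> DB (dl U)" .
  have "EV U = Evb \<I> \<I> \<bullet> DB \<I> \<bullet> EV U" using U by (simp add: pre2[OF unit_loop])
  also have "\<dots> = (Evb \<I> \<I> \<bullet> (EV U \<star> aid (dl \<I>))) \<bullet> (aid ?z \<star> DB \<I>)"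
    using U slide[of "EV U" "DB \<I>" ?z \<I> \<I> "dl \<I>"] by (simp add: acmp_assoc)
  also have "\<dots> = Evb ?z \<I> \<bullet> (aid ?z \<star> (dmA ?f \<bullet> DB \<I>))"
    using U by (subst Evb_dmA[of ?f ?z \<I>]) (auto simp: lwhisker acmp_assoc)
  also have "\<dots> = (Evb ?z \<I> \<bullet> (aid ?z \<star> \<theta> (dl U) U)) \<bullet> (aid ?z \<star> DB (dl U))"
    unfolding f using U by (simp add: lwhisker acmp_assoc)
  also have "\<dots> = Evb (dl U) \<I> \<bullet> (aid (dl U) \<star> Evb U ?W) \<bullet> As (dl U) U (dl U \<odot> ?W) \<bullet> (aid ?z \<star> DB (dl U))"
    using U by (subst \<theta>_Evb) (auto simp: acmp_assoc)
  also have "As (dl U) U (dl U \<odot> ?W) \<bullet> (aid ?z \<star> DB (dl U)) = aid (dl U) \<star> (aid U \<star> DB (dl U))"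
    using As_natural[of "aid (dl U)" "aid U" "DB (dl U)"] U by simp
  also have "Evb (dl U) \<I> \<bullet> (aid (dl U) \<star> Evb U ?W) \<bullet> \<dots> = Evb (dl U) \<I> \<bullet> (aid (dl U) \<star> (Evb U ?W \<bullet> (aid U \<star> DB (dl U))))"
    using U by (simp add: lwhisker)
  also have "Evb U ?W \<bullet> (aid U \<star> DB (dl U)) = Ev (dl U) ?W \<bullet> (aid ?W \<star> Db (dl U) \<I>) \<bullet> PV U"
    using U slide[of "PV U" "DB (dl U)" U ?W \<I> "dl U \<odot> ?W"] by (simp add: Evb_def acmp_assoc Db_unit)
  also have "\<dots> = PV U" using U zz_cmp(2)[of "dl U" \<I>] by simp
  finally show ?thesis .
qed

text \<open>A general property of monoidal natural isomorphisms: on a dual object the inverse is the dual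
  morphism. Here it follows from the description of \<open>ev\<close> above.\<close>

lemma dmA_PV:
  assumes W: "W \<in> obj C"
  shows "dmA (PV W) = PV' (dl W)"
proof -
  have "dmA (PV W) \<bullet> PV (dl W) = aid (dl W)"
  proof (rule EV_faithful[OF W])
    have "EV W \<bullet> ((dmA (PV W) \<bullet> PV (dl W)) \<star> aid W) = (EV W \<bullet> (dmA (PV W) \<star> aid W)) \<bullet> (PV (dl W) \<star> aid W)"
      using W by (simp add: rwhisker acmp_assoc)
    also have "\<dots> = EV (dl (dl W)) \<bullet> (aid (dl (dl (dl W))) \<star> PV W) \<bullet> (PV (dl W) \<star> aid W)"
      using W by (subst dmA_EV[of "PV W" W "dl (dl W)"]) (auto simp: acmp_assoc)
    also have "\<dots> = Evb (dl W) \<I> \<bullet> (aid (dl W) \<star> PV W)"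
      using W slide[of "PV (dl W)" "PV W" "dl W" "dl (dl (dl W))" W "dl (dl W)"] by (simp add: Evb_def Ev_unit acmp_assoc)
    finally show "EV W \<bullet> ((dmA (PV W) \<bullet> PV (dl W)) \<star> aid W) = EV W \<bullet> (aid (dl W) \<star> aid W)"
      using W EV_eq_Evb[OF W] by simp
  qed (use W in auto)
  then have "(dmA (PV W) \<bullet> PV (dl W)) \<bullet> PV' (dl W) = PV' (dl W)" using W by simp
  then show ?thesis using W by (simp add: acmp_assoc)
qed

lemma Dbb_dual:
  assumes W: "W \<in> obj C" and Z: "Z \<in> obj C"
  shows "Dbb (dl W) Z = (PV W \<star> aid (dl W \<odot> Z)) \<bullet> Db W Z"
proof -
  let ?X = "dl (dl W)" and ?p = "PV' (dl W)"
  have "Dbb (dl W) Z = (aid ?X \<star> (?p \<star> aid Z)) \<bullet> As ?X (dl ?X) Z \<bullet> (DB ?X \<star> aid Z)"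
    by (simp add: Dbb_def Db_def)
  also have "\<dots> = ((aid ?X \<star> (?p \<star> aid Z)) \<bullet> As ?X (dl ?X) Z) \<bullet> (DB ?X \<star> aid Z)"
    by (simp only: acmp_assoc)
  also have "(aid ?X \<star> (?p \<star> aid Z)) \<bullet> As ?X (dl ?X) Z = As ?X (dl W) Z \<bullet> ((aid ?X \<star> ?p) \<star> aid Z)"
    using As_natural[of "aid ?X" ?p "aid Z"] W Z by simp
  also have "\<dots> \<bullet> (DB ?X \<star> aid Z) = As ?X (dl W) Z \<bullet> (((aid ?X \<star> ?p) \<bullet> DB ?X) \<star> aid Z)"
    using W Z by (simp add: rwhisker acmp_assoc)
  also have "(aid ?X \<star> ?p) \<bullet> DB ?X = (PV W \<star> aid (dl W)) \<bullet> DB W"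
    using dmA_DB[of "PV W" W ?X] dmA_PV[OF W] W by simp
  also have "As ?X (dl W) Z \<bullet> (\<dots> \<star> aid Z) = (As ?X (dl W) Z \<bullet> ((PV W \<star> aid (dl W)) \<star> aid Z)) \<bullet> (DB W \<star> aid Z)"
    using W Z by (simp add: rwhisker acmp_assoc)
  also have "As ?X (dl W) Z \<bullet> ((PV W \<star> aid (dl W)) \<star> aid Z) = (PV W \<star> aid (dl W \<odot> Z)) \<bullet> As W (dl W) Z"
    using As_natural[of "PV W" "aid (dl W)" "aid Z"] W Z by simp
  finally show ?thesis by (simp add: Db_def acmp_assoc)
qed

text \<open>A strand \<open>W\<^sup>\<or>\<close> may be closed on the left with \<open>W\<close> in place of \<open>W\<^sup>\<or>\<^sup>\<or>\<close>.\<close>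

lemma pL_dual:
  assumes W: "W \<in> obj C" and V: "V \<in> obj C" and \<phi>: "ar \<phi>" "dm \<phi> = dl W \<odot> V" "cd \<phi> = dl W \<odot> V"
  shows "pL (dl W) V V \<phi> \<I> = Evb W V \<bullet> (aid W \<star> \<phi>) \<bullet> Db W V"
proof -
  have "pL (dl W) V V \<phi> \<I> = Ev (dl W) V \<bullet> (aid (dl (dl W)) \<star> \<phi>) \<bullet> (PV W \<star> aid (dl W \<odot> V)) \<bullet> Db W V"
    using W V \<phi> by (simp add: pL_def Dbb_dual)
  also have "\<dots> = Ev (dl W) V \<bullet> (PV W \<star> aid (dl W \<odot> V)) \<bullet> (aid W \<star> \<phi>) \<bullet> Db W V"
    using W V \<phi> slide_cmp[of "PV W" \<phi> W "dl (dl W)" "dl W \<odot> V" "dl W \<odot> V"] by simp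
  finally show ?thesis by (simp add: Evb_def acmp_assoc)
qed

end

context spherical_category
begin

lemma TrA_left:
  assumes f: "ar f" "dm f = X" "cd f = X"
  shows "TrA f = EV X \<bullet> (aid (dl X) \<star> f) \<bullet> Dbb X \<I>"
  using f ar_mor[of f] spherical[of X "mor f"]
  by (auto intro!: arrow_eqI simp: ptr_left_def db_bar_def Dbb_def Db_unit)

text \<open>Closing the right strand commutes with closing the left strand, so sphericity of the strand \<open>x\<close>
  alone lets the trace over \<open>x \<otimes> y\<close> be closed on the left of \<open>x\<close>.\<close>

lemma TrA_pL:
  assumes x: "x \<in> obj C" and y: "y \<in> obj C" and h: "ar h" "dm h = x \<odot> y" "cd h = x \<odot> y"
  shows "TrA h = TrA (pL x y y h \<I>)"
proof -
  let ?e = "ext x y x y h (dl y)"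
  have "TrA (pL x y y h \<I>) = (Evb y \<I> \<bullet> Ev x (y \<odot> dl y)) \<bullet> (aid (dl x) \<star> ?e) \<bullet> (Dbb x (y \<odot> dl y) \<bullet> DB y)"
    using x y h by (simp add: TrA_def pL_rwhisker) (simp add: pL_def acmp_assoc)
  also have "Evb y \<I> \<bullet> Ev x (y \<odot> dl y) = EV x \<bullet> (aid (dl x) \<star> (aid x \<star> Evb y \<I>))"
    using x y Ev_natural[of x "Evb y \<I>" "y \<odot> dl y" \<I>] by (simp add: Ev_unit)
  also have "Dbb x (y \<odot> dl y) \<bullet> DB y = (aid (dl x) \<star> (aid x \<star> DB y)) \<bullet> Dbb x \<I>"
    using x y Dbb_natural[of x "DB y" \<I> "y \<odot> dl y"] by simp
  also have "(EV x \<bullet> (aid (dl x) \<star> (aid x \<star> Evb y \<I>))) \<bullet> (aid (dl x) \<star> ?e) \<bullet> \<dots> = EV x \<bullet> (aid (dl x) \<star> pR x y x h \<I>) \<bullet> Dbb x \<I>"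
    using x y h by (simp add: pR_def lwhisker acmp_assoc Db_unit)
  also have "\<dots> = TrA (pR x y x h \<I>)" using x y h by (subst TrA_left[of _ x]) auto
  finally show ?thesis using TrA_pR[OF x y h] by simp
qed

end

section \<open>Scalar traces in spherical fusion categories\<close>

locale closed_spherical_fusion_category = spherical_fusion_category C
  for C :: "('o, 'm::ab_group_add, 'k::{alg_closed_field, field_char_0}) pivotal_category" (structure)
begin

sublocale schur_semisimple_category C
proof (intro schur_semisimple_category.intro schur_category.intro schur_category_axioms.intro)
  show "\<exists>K k. is_kernel C X Y f K k" if "X \<in> obj C" "Y \<in> obj C" "f \<in> hom C X Y" for X Y f
    using kernels[OF that] .
  show "\<exists>B. finite B \<and> hom C X Y \<subseteq> module.span (scl C) B" if "X \<in> obj C" "Y \<in> obj C" for X Y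
    using hom_findim[OF that] by (metis subset_refl)
qed (rule linear_category_axioms semisimple_category_axioms)+

text \<open>Arrows with different sources or targets cannot be added, so linear combinations are formed inside
  one hom-space, with the source and target given explicitly.\<close>

definition LC :: "'o \<Rightarrow> 'o \<Rightarrow> 'i set \<Rightarrow> ('i \<Rightarrow> 'k) \<Rightarrow> ('i \<Rightarrow> ('o, 'm) arrow) \<Rightarrow> ('o, 'm) arrow" where
  "LC X Y I c f = Arr X (\<Sum>i\<in>I. scl C (c i) (mor (f i))) Y"

definition par :: "'o \<Rightarrow> 'o \<Rightarrow> ('o, 'm) arrow \<Rightarrow> bool" where
  "par X Y f \<longleftrightarrow> ar f \<and> dm f = X \<and> cd f = Y"

lemma parI [intro]: "ar f \<Longrightarrow> dm f = X \<Longrightarrow> cd f = Y \<Longrightarrow> par X Y f"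
  by (simp add: par_def)

lemma parD: "par X Y f \<Longrightarrow> ar f" "par X Y f \<Longrightarrow> dm f = X" "par X Y f \<Longrightarrow> cd f = Y"
    "par X Y f \<Longrightarrow> X \<in> obj C" "par X Y f \<Longrightarrow> Y \<in> obj C" "par X Y f \<Longrightarrow> mor f \<in> hom C X Y"
  using ar_mor[of f] by (auto simp: par_def)

lemma par_cmp: "par X Y f \<Longrightarrow> par Y Z g \<Longrightarrow> par X Z (g \<bullet> f)"
  and par_ten: "par X Y f \<Longrightarrow> par X' Y' g \<Longrightarrow> par (X \<odot> X') (Y \<odot> Y') (f \<star> g)"
  and par_aid [simp]: "X \<in> obj C \<Longrightarrow> par X X (aid X)"
  by (auto simp: par_def)

lemma par_Arr: "par X Y (Arr X f Y) \<longleftrightarrow> X \<in> obj C \<and> Y \<in> obj C \<and> f \<in> hom C X Y"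
  by (auto simp: par_def)

lemma par_eqI: "par X Y f \<Longrightarrow> par X Y g \<Longrightarrow> mor f = mor g \<Longrightarrow> f = g"
  by (auto simp: par_def intro: arrow_eqI)

lemma LC_par:
  assumes "X \<in> obj C" "Y \<in> obj C" "\<And>i. i \<in> I \<Longrightarrow> par X Y (f i)"
  shows "par X Y (LC X Y I c f)"
  unfolding LC_def par_Arr using assms parD(6) by (auto intro!: hom_sum hom_scl)

lemma LC_cong: "I = J \<Longrightarrow> (\<And>i. i \<in> J \<Longrightarrow> c i = d i) \<Longrightarrow> (\<And>i. i \<in> J \<Longrightarrow> f i = g i) \<Longrightarrow> LC X Y I c f = LC X Y J d g"
  unfolding LC_def by (auto intro!: sum.cong)

lemma cmp_LC:
  assumes "X \<in> obj C" "par Y Z g" "\<And>i. i \<in> I \<Longrightarrow> par X Y (f i)"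
  shows "g \<bullet> LC X Y I c f = LC X Z I c (\<lambda>i. g \<bullet> f i)"
proof -
  note g = parD[OF assms(2)]
  have f: "\<And>i. i \<in> I \<Longrightarrow> mor (f i) \<in> hom C X Y" using assms(3) parD(6) by blast
  have L: "par X Y (LC X Y I c f)" using assms g by (intro LC_par) auto
  show ?thesis
  proof (rule par_eqI[of X Z])
    show "par X Z (g \<bullet> LC X Y I c f)" using L assms by (blast intro: par_cmp)
    show "par X Z (LC X Z I c (\<lambda>i. g \<bullet> f i))" using assms g by (intro LC_par) (auto intro: par_cmp)
    have "mor (g \<bullet> LC X Y I c f) = mor g \<cdot> (\<Sum>i\<in>I. scl C (c i) (mor (f i)))"
      using parD[OF L] g by (simp add: LC_def)
    also have "\<dots> = (\<Sum>i\<in>I. mor g \<cdot> scl C (c i) (mor (f i)))"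
      using assms f g by (intro cmp_sum_right[of X Y Z]) (auto intro: hom_scl)
    also have "\<dots> = (\<Sum>i\<in>I. scl C (c i) (mor (g \<bullet> f i)))"
      using assms f g parD[OF assms(3)] by (intro sum.cong) (auto simp: cmp_scl_right[of X Y Z])
    finally show "mor (g \<bullet> LC X Y I c f) = mor (LC X Z I c (\<lambda>i. g \<bullet> f i))" by (simp add: LC_def)
  qed
qed

lemma LC_cmp:
  assumes "Z \<in> obj C" "par X Y g" "\<And>i. i \<in> I \<Longrightarrow> par Y Z (f i)"
  shows "LC Y Z I c f \<bullet> g = LC X Z I c (\<lambda>i. f i \<bullet> g)"
proof -
  note g = parD[OF assms(2)]
  have f: "\<And>i. i \<in> I \<Longrightarrow> mor (f i) \<in> hom C Y Z" using assms(3) parD(6) by blast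
  have L: "par Y Z (LC Y Z I c f)" using assms g by (intro LC_par) auto
  show ?thesis
  proof (rule par_eqI[of X Z])
    show "par X Z (LC Y Z I c f \<bullet> g)" using L assms by (blast intro: par_cmp)
    show "par X Z (LC X Z I c (\<lambda>i. f i \<bullet> g))" using assms g by (intro LC_par) (auto intro: par_cmp)
    have "mor (LC Y Z I c f \<bullet> g) = (\<Sum>i\<in>I. scl C (c i) (mor (f i))) \<cdot> mor g"
      using parD[OF L] g by (simp add: LC_def)
    also have "\<dots> = (\<Sum>i\<in>I. scl C (c i) (mor (f i)) \<cdot> mor g)"
      using assms f g by (intro cmp_sum_left[of X Y Z]) (auto intro: hom_scl)
    also have "\<dots> = (\<Sum>i\<in>I. scl C (c i) (mor (f i \<bullet> g)))"
      using assms f g parD[OF assms(3)] by (intro sum.cong) (auto simp: cmp_scl_left[of X Y Z])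
    finally show "mor (LC Y Z I c f \<bullet> g) = mor (LC X Z I c (\<lambda>i. f i \<bullet> g))" by (simp add: LC_def)
  qed
qed

lemma tensm_sum_left:
  assumes "X \<in> obj C" "Y \<in> obj C" "X' \<in> obj C" "Y' \<in> obj C" "h \<in> hom C X' Y'" "\<And>i. i \<in> I \<Longrightarrow> f i \<in> hom C X Y"
  shows "(\<Sum>i\<in>I. f i) \<otimes> h = (\<Sum>i\<in>I. f i \<otimes> h)"
  using assms(6)
proof (induction I rule: infinite_finite_induct)
  case (insert i I)
  then show ?case using assms by (simp add: tensm_add_left[of X Y X' Y'] hom_sum)
qed (use assms tensm_scl_left[of X Y X' Y' 0 h 0] in \<open>auto simp: hom_zero\<close>)

lemma tensm_sum_right:
  assumes "X \<in> obj C" "Y \<in> obj C" "X' \<in> obj C" "Y' \<in> obj C" "h \<in> hom C X Y" "\<And>i. i \<in> I \<Longrightarrow> f i \<in> hom C X' Y'"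
  shows "h \<otimes> (\<Sum>i\<in>I. f i) = (\<Sum>i\<in>I. h \<otimes> f i)"
  using assms(6)
proof (induction I rule: infinite_finite_induct)
  case (insert i I)
  then show ?case using assms by (simp add: tensm_add_right[of X Y X' Y'] hom_sum)
qed (use assms tensm_scl_right[of X Y X' Y' h 0 0] in \<open>auto simp: hom_zero\<close>)

lemma aid_ten_LC:
  assumes "W \<in> obj C" "X \<in> obj C" "Y \<in> obj C" "\<And>i. i \<in> I \<Longrightarrow> par X Y (f i)"
  shows "aid W \<star> LC X Y I c f = LC (W \<odot> X) (W \<odot> Y) I c (\<lambda>i. aid W \<star> f i)"
proof (rule par_eqI[of "W \<odot> X" "W \<odot> Y"])
  have f: "\<And>i. i \<in> I \<Longrightarrow> mor (f i) \<in> hom C X Y" using assms parD(6) by blast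
  have L: "par X Y (LC X Y I c f)" using assms by (intro LC_par) auto
  show "par (W \<odot> X) (W \<odot> Y) (aid W \<star> LC X Y I c f)" using L assms by (blast intro: par_ten par_aid)
  show "par (W \<odot> X) (W \<odot> Y) (LC (W \<odot> X) (W \<odot> Y) I c (\<lambda>i. aid W \<star> f i))"
    using assms by (intro LC_par) (auto intro: par_ten par_aid)
  have "mor (aid W \<star> LC X Y I c f) = \<one> W \<otimes> (\<Sum>i\<in>I. scl C (c i) (mor (f i)))"
    using parD[OF L] assms by (simp add: LC_def)
  also have "\<dots> = (\<Sum>i\<in>I. \<one> W \<otimes> scl C (c i) (mor (f i)))"
    using assms f by (intro tensm_sum_right[of W W X Y]) (auto intro: hom_scl idn_hom)
  also have "\<dots> = (\<Sum>i\<in>I. scl C (c i) (mor (aid W \<star> f i)))"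
    using assms f parD(1)[OF assms(4)] by (intro sum.cong) (auto simp: tensm_scl_right[of W W X Y] idn_hom)
  finally show "mor (aid W \<star> LC X Y I c f) = mor (LC (W \<odot> X) (W \<odot> Y) I c (\<lambda>i. aid W \<star> f i))" by (simp add: LC_def)
qed

lemma LC_ten_aid:
  assumes "W \<in> obj C" "X \<in> obj C" "Y \<in> obj C" "\<And>i. i \<in> I \<Longrightarrow> par X Y (f i)"
  shows "LC X Y I c f \<star> aid W = LC (X \<odot> W) (Y \<odot> W) I c (\<lambda>i. f i \<star> aid W)"
proof (rule par_eqI[of "X \<odot> W" "Y \<odot> W"])
  have f: "\<And>i. i \<in> I \<Longrightarrow> mor (f i) \<in> hom C X Y" using assms parD(6) by blast
  have L: "par X Y (LC X Y I c f)" using assms by (intro LC_par) auto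
  show "par (X \<odot> W) (Y \<odot> W) (LC X Y I c f \<star> aid W)" using L assms by (blast intro: par_ten par_aid)
  show "par (X \<odot> W) (Y \<odot> W) (LC (X \<odot> W) (Y \<odot> W) I c (\<lambda>i. f i \<star> aid W))"
    using assms by (intro LC_par) (auto intro: par_ten par_aid)
  have "mor (LC X Y I c f \<star> aid W) = (\<Sum>i\<in>I. scl C (c i) (mor (f i))) \<otimes> \<one> W"
    using parD[OF L] assms by (simp add: LC_def)
  also have "\<dots> = (\<Sum>i\<in>I. scl C (c i) (mor (f i)) \<otimes> \<one> W)"
    using assms f by (intro tensm_sum_left[of X Y W W]) (auto intro: hom_scl idn_hom)
  also have "\<dots> = (\<Sum>i\<in>I. scl C (c i) (mor (f i \<star> aid W)))"
    using assms f parD(1)[OF assms(4)] by (intro sum.cong) (auto simp: tensm_scl_left[of X Y W W] idn_hom)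
  finally show "mor (LC X Y I c f \<star> aid W) = mor (LC (X \<odot> W) (Y \<odot> W) I c (\<lambda>i. f i \<star> aid W))" by (simp add: LC_def)
qed

definition sA :: "'k \<Rightarrow> ('o, 'm) arrow \<Rightarrow> ('o, 'm) arrow" where
  "sA c f = LC (dm f) (cd f) {()} (\<lambda>_. c) (\<lambda>_. f)"

lemma sA_par: "par X Y f \<Longrightarrow> par X Y (sA c f)"
  unfolding sA_def using LC_par[of X Y "{()}" "\<lambda>_. f" "\<lambda>_. c"] by (auto simp: par_def)

lemma sA_aid_par [simp]: "X \<in> obj C \<Longrightarrow> par X X (sA c (aid X))"
  by (rule sA_par) (simp add: par_aid)

lemma mor_sA: "mor (sA c f) = scl C c (mor f)"
  by (simp add: sA_def LC_def)

lemma cmp_sA: "par X Y f \<Longrightarrow> par Y Z g \<Longrightarrow> g \<bullet> sA c f = sA c (g \<bullet> f)"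
  unfolding sA_def using cmp_LC[of X Y Z g "{()}" "\<lambda>_. f" "\<lambda>_. c"] parD[of X Y f] parD[of Y Z g] by auto

lemma sA_cmp: "par X Y f \<Longrightarrow> par Y Z g \<Longrightarrow> sA c g \<bullet> f = sA c (g \<bullet> f)"
  unfolding sA_def using LC_cmp[of Z X Y f "{()}" "\<lambda>_. g" "\<lambda>_. c"] parD[of X Y f] parD[of Y Z g] by auto

lemma aid_ten_sA: "par X Y f \<Longrightarrow> W \<in> obj C \<Longrightarrow> aid W \<star> sA c f = sA c (aid W \<star> f)"
  unfolding sA_def using aid_ten_LC[of W X Y "{()}" "\<lambda>_. f" "\<lambda>_. c"] parD[of X Y f] by auto

lemma cmp_zero_arrow: "par Y Z g \<Longrightarrow> X \<in> obj C \<Longrightarrow> g \<bullet> Arr X 0 Y = Arr X 0 Z"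
  using parD[of Y Z g] cmp_zero_right[of X Y Z "mor g"]
  by (intro par_eqI[of X Z] par_cmp) (auto simp: par_Arr hom_zero)

lemma zero_arrow_cmp: "par X Y f \<Longrightarrow> Z \<in> obj C \<Longrightarrow> Arr Y 0 Z \<bullet> f = Arr X 0 Z"
  using parD[of X Y f] cmp_zero_left[of X Y Z "mor f"]
  by (intro par_eqI[of X Z] par_cmp) (auto simp: par_Arr hom_zero)

lemma zero_ten:
  assumes "X \<in> obj C" "Y \<in> obj C" "W \<in> obj C"
  shows "Arr X 0 Y \<star> aid W = Arr (X \<odot> W) 0 (Y \<odot> W)"
  using assms tensm_scl_left[of X Y W W 0 "\<one> W" 0]
  by (intro par_eqI[of "X \<odot> W" "Y \<odot> W"] par_ten) (auto simp: par_Arr hom_zero par_aid idn_hom)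

definition tr :: "('o, 'm) arrow \<Rightarrow> 'k" where
  "tr f = ptr C (dm f) (mor f)"

abbreviation d :: "'o \<Rightarrow> 'k" where "d X \<equiv> tr (aid X)"

lemma d_qdim: "d X = qdim C X"
  by (simp add: tr_def qdim_def)

lemma tr_unique:
  assumes "par X X f" "TrA f = sA c (aid \<I>)" shows "tr f = c"
proof -
  have "ptr_right C (dm f) (mor f) = scl C c (\<one> \<I>)"
    using assms(2) TrA_simps(4)[of f] parD[OF assms(1)] by (auto simp: mor_sA)
  then show ?thesis unfolding tr_def ptr_def
    using scl_idn_inject[OF unit_simple] by (intro the_equality) auto
qed

lemma TrA_tr: "par X X f \<Longrightarrow> TrA f = sA (tr f) (aid \<I>)"
proof -
  assume f: "par X X f"
  have p: "par \<I> \<I> (TrA f)" using parD[OF f] by auto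
  then obtain c where "mor (TrA f) = scl C c (\<one> \<I>)"
    using schur_scalar[OF unit_simple] parD(6) by blast
  then have "TrA f = sA c (aid \<I>)"
    using p by (intro par_eqI[of \<I> \<I>]) (auto simp: mor_sA intro: sA_par par_aid)
  then show ?thesis using tr_unique[OF f] by simp
qed

lemma tr_eqI: "par X X f \<Longrightarrow> par Y Y g \<Longrightarrow> TrA f = TrA g \<Longrightarrow> tr f = tr g"
  using tr_unique TrA_tr by metis

lemma tr_cyclic: "par X Y f \<Longrightarrow> par Y X g \<Longrightarrow> tr (f \<bullet> g) = tr (g \<bullet> f)"
  using TrA_cyclic[of f X Y g] by (intro tr_eqI[of Y _ X]) (auto simp: par_def)

lemma tr_LC:
  assumes X: "X \<in> obj C" and f: "\<And>i. i \<in> I \<Longrightarrow> par X X (f i)"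
  shows "tr (LC X X I c f) = (\<Sum>i\<in>I. c i * tr (f i))"
proof (rule tr_unique)
  show L: "par X X (LC X X I c f)" using X f by (intro LC_par) auto
  let ?N = "dl X"
  have N: "?N \<in> obj C" using X by simp
  have t: "par (X \<odot> ?N) (X \<odot> ?N) (f i \<star> aid ?N)" if "i \<in> I" for i
    using f[OF that] X by (auto intro: par_ten par_aid)
  have "TrA (LC X X I c f) = Evb X \<I> \<bullet> (LC X X I c f \<star> aid ?N) \<bullet> DB X"
    using parD[OF L] by (simp add: TrA_def)
  also have "\<dots> = Evb X \<I> \<bullet> LC (X \<odot> ?N) (X \<odot> ?N) I c (\<lambda>i. f i \<star> aid ?N) \<bullet> DB X"
    using X f N by (subst LC_ten_aid) auto
  also have "\<dots> = Evb X \<I> \<bullet> LC \<I> (X \<odot> ?N) I c (\<lambda>i. (f i \<star> aid ?N) \<bullet> DB X)"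
    using X N t by (subst LC_cmp[of _ \<I>]) auto
  also have "\<dots> = LC \<I> \<I> I c (\<lambda>i. Evb X \<I> \<bullet> (f i \<star> aid ?N) \<bullet> DB X)"
    using X N t by (subst cmp_LC[of _ _ \<I>]) (auto intro!: par_cmp[of _ "X \<odot> ?N"])
  also have "\<dots> = LC \<I> \<I> I c (\<lambda>i. sA (tr (f i)) (aid \<I>))"
    using TrA_tr[OF f] parD(2)[OF f] by (intro LC_cong) (auto simp: TrA_def)
  also have "\<dots> = sA (\<Sum>i\<in>I. c i * tr (f i)) (aid \<I>)"
    by (intro par_eqI[of \<I> \<I>] LC_par sA_par par_aid)
      (auto simp: mor_sA LC_def vs.scale_sum_left intro: sA_par par_aid)
  finally show "TrA (LC X X I c f) = sA (\<Sum>i\<in>I. c i * tr (f i)) (aid \<I>)" .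
qed

lemma tr_sA: "par X X f \<Longrightarrow> tr (sA c f) = c * tr f"
  unfolding sA_def using tr_LC[of X "{()}" "\<lambda>_. f" "\<lambda>_. c"] parD[of X X f] by auto

lemma tr_pR: "x \<in> obj C \<Longrightarrow> y \<in> obj C \<Longrightarrow> par (x \<odot> y) (x \<odot> y) h \<Longrightarrow> tr h = tr (pR x y x h \<I>)"
  using TrA_pR[of x y h] by (intro tr_eqI[of "x \<odot> y" _ x]) (auto simp: par_def)

lemma tr_pL: "x \<in> obj C \<Longrightarrow> y \<in> obj C \<Longrightarrow> par (x \<odot> y) (x \<odot> y) h \<Longrightarrow> tr h = tr (pL x y y h \<I>)"
  using TrA_pL[of x y h] by (intro tr_eqI[of "x \<odot> y" _ y]) (auto simp: par_def)

lemma tr_aid_ten: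
  assumes V: "V \<in> obj C" and w: "par X X w"
  shows "tr (aid V \<star> w) = d V * tr w"
proof -
  note w' = parD[OF w]
  have "pR V X V (aid V \<star> w) \<I> = aid V \<star> TrA w"
    using V w' by (simp add: pR_def ext_ten TrA_def lwhisker Db_unit)
  also have "\<dots> = sA (tr w) (aid V)"
    unfolding TrA_tr[OF w] using V aid_ten_sA[of \<I> \<I> "aid \<I>" V "tr w"] by (simp add: par_aid)
  finally have "tr (aid V \<star> w) = tr (sA (tr w) (aid V))"
    using V w w' by (subst tr_pR[of V X]) (auto intro: par_ten par_aid)
  then show ?thesis using V by (simp add: tr_sA[of V] par_aid)
qed

lemma d_unit: "d \<I> = 1"
proof (rule tr_unique[of \<I>])
  show "TrA (aid \<I>) = sA 1 (aid \<I>)"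
    using unit_loop by (intro par_eqI[of \<I> \<I>]) (auto simp: TrA_def mor_sA intro: sA_par par_aid)
qed (auto intro: par_aid)

lemma d_dual: "W \<in> obj C \<Longrightarrow> d (dl W) = d W"
proof (rule tr_eqI[of "dl W" _ W])
  assume W: "W \<in> obj C"
  show "TrA (aid (dl W)) = TrA (aid W)"
    using W by (subst TrA_left[of _ "dl W"]) (auto simp: Dbb_dual TrA_def Evb_def Db_unit Ev_unit acmp_assoc)
qed (auto intro: par_aid)

lemma d_ten: "V \<in> obj C \<Longrightarrow> W \<in> obj C \<Longrightarrow> d (V \<odot> W) = d V * d W"
  using tr_aid_ten[of V W "aid W"] by (simp add: par_aid)

lemma d_iso:
  assumes "X \<in> obj C" "Y \<in> obj C" "isomorphic C X Y" shows "d X = d Y"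
proof -
  obtain f g where fg: "f \<in> hom C X Y" "g \<in> hom C Y X" "g \<cdot> f = \<one> X" "f \<cdot> g = \<one> Y"
    using assms by (auto simp: isomorphic_def is_iso_def inverse_of_def)
  then have "Arr Y g X \<bullet> Arr X f Y = aid X" "Arr X f Y \<bullet> Arr Y g X = aid Y"
    using assms by (auto simp: acmp_def aid_def)
  moreover have "par X Y (Arr X f Y)" "par Y X (Arr Y g X)" using assms fg by (auto simp: par_Arr)
  ultimately show ?thesis using tr_cyclic[of X Y "Arr X f Y" "Arr Y g X"] by simp
qed

text \<open>Simple objects have nonzero dimension: a retraction of the nonzero coevaluation
  \<open>I \<rightarrow> S \<otimes> S\<^sup>\<or>\<close> is the evaluation twisted by an endomorphism of \<open>S\<close>, that is, by a scalar.\<close>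

lemma d_simple_nonzero:
  assumes S: "simple C S" shows "d S \<noteq> 0"
proof -
  have o [simp]: "S \<in> obj C" using S simple_obj by blast
  let ?D = "dl S"
  have "db C S \<noteq> 0"
  proof
    assume "db C S = 0"
    then have "DB S = Arr \<I> 0 (S \<odot> ?D)" by (simp add: DB_def)
    then have "DB S \<star> aid S = Arr S 0 ((S \<odot> ?D) \<odot> S)" using zero_ten[of \<I> "S \<odot> ?D" S] by simp
    then have "(aid S \<star> EV S) \<bullet> As S ?D S \<bullet> (DB S \<star> aid S) = Arr S 0 S"
      using cmp_zero_arrow[of "(S \<odot> ?D) \<odot> S" "S \<odot> (?D \<odot> S)" "As S ?D S" S]
        cmp_zero_arrow[of "S \<odot> (?D \<odot> S)" S "aid S \<star> EV S" S] by (auto simp: par_def)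
    then have "\<one> S = 0" using zigzag_arrow(1)[of S] by (simp add: aid_def)
    then show False using S simple_nonzero by simp
  qed
  then obtain p where p: "p \<in> hom C (S \<odot> ?D) \<I>" "p \<cdot> db C S = \<one> \<I>"
    using simple_source_split[OF unit_simple, of "S \<odot> ?D" "db C S"] by (auto simp: db_hom)
  define r where "r = Arr (S \<odot> ?D) p \<I>"
  have r [simp]: "ar r" "dm r = S \<odot> ?D" "cd r = \<I>" using p by (auto simp: r_def)
  have rDB: "r \<bullet> DB S = aid \<I>" using p by (intro arrow_eqI) (auto simp: r_def)
  define q where "q = (aid ?D \<star> r) \<bullet> Dbb S ?D"
  have q [simp]: "ar q" "dm q = ?D" "cd q = ?D" by (auto simp: q_def)
  have "Evb S \<I> \<bullet> (aid S \<star> q) = (Evb S \<I> \<bullet> (aid S \<star> (aid ?D \<star> r))) \<bullet> (aid S \<star> Dbb S ?D)"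
    by (simp add: q_def lwhisker acmp_assoc)
  also have "\<dots> = r" by (subst Evb_natural[symmetric, where Z = "S \<odot> ?D"]) (auto simp: acmp_assoc zz3)
  finally have qr: "Evb S \<I> \<bullet> (aid S \<star> q) = r" .
  define e where "e = EV S \<bullet> (q \<star> aid S)"
  define t where "t = (aid S \<star> e) \<bullet> Db S S"
  have e [simp]: "ar e" "dm e = ?D \<odot> S" "cd e = \<I>" by (auto simp: e_def)
  have t [simp]: "ar t" "dm t = S" "cd t = S" by (auto simp: t_def)
  have "EV S \<bullet> (aid ?D \<star> t) = (Ev S \<I> \<bullet> (aid ?D \<star> (aid S \<star> e))) \<bullet> (aid ?D \<star> Db S S)"
    by (simp add: t_def lwhisker acmp_assoc Ev_unit)
  also have "\<dots> = e" by (subst Ev_natural[symmetric, where Z = "?D \<odot> S"]) (auto simp: acmp_assoc)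
  finally have "EV S \<bullet> (aid ?D \<star> t) = e" .
  then have eq: "EV S \<bullet> (dmA t \<star> aid S) = EV S \<bullet> (q \<star> aid S)" using dmA_EV[of t S S] by (simp add: e_def)
  have "dmA t = q" by (rule EV_faithful[OF _ _ _ _ _ _ _ eq, where N = ?D]) simp_all
  then have "TrA t = Evb S \<I> \<bullet> (aid S \<star> q) \<bullet> DB S"
    using dmA_DB[of t S S] by (simp add: TrA_def)
  then have "TrA t = aid \<I>" using pre2[OF qr] rDB by simp
  moreover have "par S S t" by (auto)
  ultimately have "tr t = 1"
    by (intro tr_unique[of S]) (auto intro!: par_eqI[of \<I> \<I> "aid \<I>"] sA_par par_aid simp: mor_sA)
  moreover obtain c where "mor t = scl C c (\<one> S)" using schur_scalar[OF S, of "mor t"] ar_mor[of t] by auto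
  then have "t = sA c (aid S)" by (intro par_eqI[of S S]) (auto simp: mor_sA intro: sA_par par_aid)
  ultimately show ?thesis using tr_sA[of S "aid S" c] by (auto simp: par_aid)
qed

text \<open>A nonzero difference \<open>f - g\<close> is nonzero on some simple summand \<open>S\<close> of the source and splits there;
  the splitting, composed with the inclusion and projection, detects it with trace \<open>d S\<close>.\<close>

lemma trace_nondegenerate:
  assumes f: "par A B f" and g: "par A B g" and eq: "\<And>h. par B A h \<Longrightarrow> tr (h \<bullet> f) = tr (h \<bullet> g)"
  shows "f = g"
proof (rule ccontr)
  assume "f \<noteq> g"
  note f' = parD[OF f] and g' = parD[OF g]
  have o: "A \<in> obj C" "B \<in> obj C" using f' by auto
  define x where "x = mor f - mor g"
  have x: "x \<in> hom C A B" unfolding x_def using f' g' hom_diff by blast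
  have "x \<noteq> 0" using \<open>f \<noteq> g\<close> par_eqI[OF f g] by (auto simp: x_def)
  obtain n S \<iota> \<pi> where dec: "direct_sum C n S \<iota> \<pi> A" and S: "\<forall>i<n. simple C (S i)"
    using semisimple[OF o(1)] by blast
  note ds = direct_sum_parts[OF dec]
  have "\<exists>i<n. x \<cdot> \<iota> i \<noteq> 0"
  proof (rule ccontr)
    assume "\<not> ?thesis"
    then have z: "\<And>i. i < n \<Longrightarrow> x \<cdot> \<iota> i = 0" by blast
    have "x = x \<cdot> (\<Sum>i<n. \<iota> i \<cdot> \<pi> i)" using ds x o by (simp add: cmp_idn[of A B])
    also have "\<dots> = (\<Sum>i<n. x \<cdot> \<iota> i \<cdot> \<pi> i)"
      using ds x o by (intro cmp_sum_right[of A A B]) (auto intro: cmp_hom[of A "S _" A])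
    also have "\<dots> = (\<Sum>i<n. (x \<cdot> \<iota> i) \<cdot> \<pi> i)"
      using ds x o by (intro sum.cong refl cmp_assoc[symmetric, of A "S _" A B]) auto
    also have "\<dots> = 0" using z by (intro sum.neutral) (simp add: cmp_zero_left[OF ds(1,2) o(2) ds(4)])
    finally show False using \<open>x \<noteq> 0\<close> by simp
  qed
  then obtain i where i: "i < n" "x \<cdot> \<iota> i \<noteq> 0" by blast
  have "x \<cdot> \<iota> i \<in> hom C (S i) B" using cmp_hom[of "S i" A B] ds i x o by simp
  then obtain p where p: "p \<in> hom C B (S i)" "p \<cdot> x \<cdot> \<iota> i = \<one> (S i)"
    using simple_source_split[of "S i" B "x \<cdot> \<iota> i"] S i o by auto
  define I where "I = Arr (S i) (\<iota> i) A"
  define P where "P = Arr B p (S i)"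
  have I: "par (S i) A I" and P: "par B (S i) P" using p ds i o by (auto simp: I_def P_def par_Arr)
  have t: "tr (P \<bullet> f \<bullet> I) = tr (P \<bullet> g \<bullet> I)"
  proof -
    have "tr ((I \<bullet> P) \<bullet> h) = tr (P \<bullet> h \<bullet> I)" if "par A B h" for h
      using tr_cyclic[OF I par_cmp[OF that P]] by (simp add: acmp_assoc)
    then show ?thesis using eq[OF par_cmp[OF P I]] f g by simp
  qed
  have Pf: "par (S i) (S i) (P \<bullet> f \<bullet> I)" "par (S i) (S i) (P \<bullet> g \<bullet> I)"
    using f g P I by (auto intro: par_cmp)
  define c where "c = (\<lambda>b. if b then 1 else - 1 :: 'k)"
  define h where "h = (\<lambda>b. if b then P \<bullet> f \<bullet> I else P \<bullet> g \<bullet> I)"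
  have "LC (S i) (S i) UNIV c h = aid (S i)"
  proof (rule par_eqI[of "S i" "S i"])
    show "par (S i) (S i) (LC (S i) (S i) UNIV c h)" using Pf ds i by (intro LC_par) (auto simp: h_def)
    show "par (S i) (S i) (aid (S i))" using ds i by (intro par_aid) auto
    have fi: "mor f \<cdot> \<iota> i \<in> hom C (S i) B" "mor g \<cdot> \<iota> i \<in> hom C (S i) B"
      using cmp_hom[of "S i" A B] ds(2,3)[OF i(1)] f' g' by auto
    have "mor (LC (S i) (S i) UNIV c h) = mor (P \<bullet> f \<bullet> I) - mor (P \<bullet> g \<bullet> I)"
      by (simp add: LC_def c_def h_def UNIV_bool)
    also have "\<dots> = p \<cdot> mor f \<cdot> \<iota> i - p \<cdot> mor g \<cdot> \<iota> i"
      using parD[OF P] parD[OF I] f' g' by (simp add: P_def I_def)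
    also have "\<dots> = p \<cdot> (mor f \<cdot> \<iota> i - mor g \<cdot> \<iota> i)"
      using p ds(2,3)[OF i(1)] fi o by (simp add: cmp_diff_right[of "S i" B "S i"])
    also have "\<dots> = p \<cdot> x \<cdot> \<iota> i"
      unfolding x_def using ds(2,3)[OF i(1)] f' g' o by (simp add: cmp_diff_left[of "S i" A B])
    finally show "mor (LC (S i) (S i) UNIV c h) = mor (aid (S i))" using p by simp
  qed
  then have "d (S i) = (\<Sum>b\<in>UNIV. c b * tr (h b))"
    using tr_LC[of "S i" UNIV h c] Pf ds i by (auto simp: h_def)
  also have "\<dots> = 0" using t by (simp add: c_def h_def UNIV_bool)
  finally show False using d_simple_nonzero S i by blast
qed

end

context closed_spherical_fusion_category
begin

section \<open>Fusion rules and the global dimension\<close>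

text \<open>The representative depends on the isomorphism class only, because the defining predicate does.
  Hence distinct members of \<open>Irr\<close> are not isomorphic.\<close>

definition rep :: "'o \<Rightarrow> 'o" where "rep X = (SOME Z. simple C Z \<and> isomorphic C Z X)"

definition Irr :: "'o set" where "Irr = rep ` {X. simple C X}"

lemma rep_simple: "simple C X \<Longrightarrow> simple C (rep X) \<and> isomorphic C (rep X) X"
  unfolding rep_def by (rule someI[of "\<lambda>Z. simple C Z \<and> isomorphic C Z X" X]) (simp add: isomorphic_refl simple_obj)

lemma rep_cong:
  assumes "simple C X" "Y \<in> obj C" "isomorphic C X Y" shows "rep X = (SOME Z. simple C Z \<and> isomorphic C Z Y)"
proof -
  have "(\<lambda>Z. simple C Z \<and> isomorphic C Z X) = (\<lambda>Z. simple C Z \<and> isomorphic C Z Y)"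
    using assms isomorphic_sym isomorphic_trans simple_obj by (intro ext) metis
  then show ?thesis unfolding rep_def by simp
qed

lemma Irr_finite: "finite Irr"
proof -
  obtain S where S: "finite S" "S \<subseteq> obj C" "\<And>X. simple C X \<Longrightarrow> \<exists>Y\<in>S. isomorphic C X Y"
    using finitely_many_simples by blast
  have "Irr \<subseteq> (\<lambda>Y. SOME Z. simple C Z \<and> isomorphic C Z Y) ` S"
    unfolding Irr_def using S rep_cong by (force simp: image_iff)
  then show ?thesis using S finite_surj by blast
qed

lemma Irr_simple: "V \<in> Irr \<Longrightarrow> simple C V" and Irr_obj [simp]: "V \<in> Irr \<Longrightarrow> V \<in> obj C"
  unfolding Irr_def using rep_simple simple_obj by auto

lemma Irr_isomorphic: "V \<in> Irr \<Longrightarrow> V' \<in> Irr \<Longrightarrow> isomorphic C V V' \<Longrightarrow> V = V'"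
proof -
  assume "V \<in> Irr" "V' \<in> Irr" and iso: "isomorphic C V V'"
  then obtain X X' where X: "simple C X" "V = rep X" "simple C X'" "V' = rep X'"
    unfolding Irr_def by auto
  then have "isomorphic C X X'"
    using iso rep_simple[OF X(1)] rep_simple[OF X(3)] isomorphic_sym isomorphic_trans simple_obj by metis
  then show "V = V'" using X rep_cong[of X X'] simple_obj[OF X(3)] rep_def[of X'] by simp
qed

lemma Irr_schur_zero:
  assumes "V \<in> Irr" "V' \<in> Irr" "V \<noteq> V'" "par V V' f" shows "f = Arr V 0 V'"
proof -
  have "mor f = 0"
    using schur_iso[of V V' "mor f"] assms Irr_simple Irr_isomorphic parD(6) unfolding isomorphic_def by blast
  then show ?thesis using assms by (intro par_eqI[of V V']) (auto simp: par_Arr hom_zero)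
qed

lemma Irr_schur_scalar:
  assumes "V \<in> Irr" "par V V f" obtains c where "f = sA c (aid V)"
proof -
  obtain c where "mor f = scl C c (\<one> V)"
    using schur_scalar[of V "mor f"] Irr_simple assms parD(6) by blast
  then have "f = sA c (aid V)" using assms by (intro par_eqI[of V V]) (auto simp: mor_sA)
  then show ?thesis using that by blast
qed

lemma d_Irr: "V \<in> Irr \<Longrightarrow> d V \<noteq> 0"
  using d_simple_nonzero Irr_simple by blast

definition decomposes where
  "decomposes A = (\<lambda>(n, S, \<iota>, \<pi>).
    (\<forall>r<n. S r \<in> Irr \<and> par (S r) A (\<iota> r) \<and> par A (S r) (\<pi> r)) \<and>
    (\<forall>r<n. \<forall>s<n. \<pi> r \<bullet> \<iota> s = (if r = s then aid (S r) else Arr (S s) 0 (S r))) \<and>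
    LC A A {..<(n::nat)} (\<lambda>_. 1) (\<lambda>r. \<iota> r \<bullet> \<pi> r) = aid A)"

lemma decomposition_exists:
  assumes A: "A \<in> obj C" shows "\<exists>x. decomposes A x"
proof -
  obtain n S \<iota> \<pi> where dec: "direct_sum C n S \<iota> \<pi> A" and S: "\<forall>i<n. simple C (S i)"
    using semisimple[OF A] by blast
  note ds = direct_sum_parts[OF dec]
  have "\<forall>i\<in>{..<n}. \<exists>f. is_iso C (S i) (rep (S i)) f"
    using rep_simple S isomorphic_sym unfolding isomorphic_def by blast
  then obtain F where F: "\<And>i. i < n \<Longrightarrow> is_iso C (S i) (rep (S i)) (F i)"
    using bchoice[of "{..<n}"] by (metis lessThan_iff)
  then have "\<forall>i\<in>{..<n}. \<exists>g. inverse_of C (S i) (rep (S i)) (F i) g" unfolding is_iso_def by auto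
  then obtain G where G: "\<And>i. i < n \<Longrightarrow> inverse_of C (S i) (rep (S i)) (F i) (G i)"
    using bchoice[of "{..<n}"] by (metis lessThan_iff)
  define T where "T = (\<lambda>i. rep (S i))"
  have T: "T i \<in> Irr" if "i < n" for i using that S unfolding T_def Irr_def by auto
  define f where "f = (\<lambda>i. Arr (S i) (F i) (T i))"
  define g where "g = (\<lambda>i. Arr (T i) (G i) (S i))"
  define I where "I = (\<lambda>i. Arr (S i) (\<iota> i) A)"
  define P where "P = (\<lambda>i. Arr A (\<pi> i) (S i))"
  have fg: "par (S i) (T i) (f i)" "par (T i) (S i) (g i)" "par (S i) A (I i)" "par A (S i) (P i)" if "i < n" for i
    using that ds F[OF that] G[OF that] T[OF that]
    by (auto simp: par_Arr f_def g_def I_def P_def T_def is_iso_def inverse_of_def)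
  have gf: "g i \<bullet> f i = aid (S i)" "f i \<bullet> g i = aid (T i)" if "i < n" for i
    using G[OF that] parD[OF fg(1)[OF that]] parD[OF fg(2)[OF that]] unfolding f_def g_def T_def
    by (auto simp: acmp_def aid_def inverse_of_def)
  have PI: "P i \<bullet> I j = (if i = j then aid (S i) else Arr (S j) 0 (S i))" if "i < n" "j < n" for i j
    using parD[OF fg(3)[OF that(2)]] parD[OF fg(4)[OF that(1)]] ds(5)[OF that(1)] ds(6)[OF that]
    unfolding I_def P_def by (auto simp: acmp_def aid_def)
  have "decomposes A (n, T, \<lambda>i. I i \<bullet> g i, \<lambda>i. f i \<bullet> P i)"
    unfolding decomposes_def split
  proof (intro conjI allI impI)
    fix i assume i: "i < n"
    show "T i \<in> Irr" "par (T i) A (I i \<bullet> g i)" "par A (T i) (f i \<bullet> P i)"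
      using T[OF i] fg[OF i] by (auto intro: par_cmp)
    fix j assume j: "j < n"
    have "(f i \<bullet> P i) \<bullet> I j \<bullet> g j = f i \<bullet> (P i \<bullet> I j) \<bullet> g j" by (simp only: acmp_assoc)
    also have "\<dots> = (if i = j then aid (T i) else Arr (T j) 0 (T i))"
    proof (cases "i = j")
      case True
      then show ?thesis using gf[OF i] PI[OF i j] fg[OF i] by (simp add: par_def)
    next
      case False
      have o: "S i \<in> obj C" "T i \<in> obj C" "T j \<in> obj C" using ds(2)[OF i] T[OF i] T[OF j] by auto
      have "Arr (S j) 0 (S i) \<bullet> g j = Arr (T j) 0 (S i)" using fg(2)[OF j] o by (intro zero_arrow_cmp)
      moreover have "f i \<bullet> Arr (T j) 0 (S i) = Arr (T j) 0 (T i)" using fg(1)[OF i] o by (intro cmp_zero_arrow)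
      ultimately show ?thesis using False PI[OF i j] by simp
    qed
    finally show "(f i \<bullet> P i) \<bullet> I j \<bullet> g j = (if i = j then aid (T i) else Arr (T j) 0 (T i))" .
  next
    have "(I i \<bullet> g i) \<bullet> f i \<bullet> P i = I i \<bullet> P i" if "i < n" for i
      using gf[OF that] fg[OF that] by (simp add: acmp_assoc pre2[of "g i" "f i"] par_def)
    then have "LC A A {..<n} (\<lambda>_. 1) (\<lambda>i. (I i \<bullet> g i) \<bullet> f i \<bullet> P i) = LC A A {..<n} (\<lambda>_. 1) (\<lambda>i. I i \<bullet> P i)"
      by (intro LC_cong) auto
    also have "\<dots> = aid A"
    proof (rule par_eqI[of A A])
      show "par A A (LC A A {..<n} (\<lambda>_. 1) (\<lambda>i. I i \<bullet> P i))"
        using par_cmp[OF fg(4) fg(3)] A by (intro LC_par) auto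
      have "mor (I i \<bullet> P i) = \<iota> i \<cdot> \<pi> i" if "i < n" for i
        using parD[OF fg(3)[OF that]] parD[OF fg(4)[OF that]] unfolding I_def P_def by simp
      then show "mor (LC A A {..<n} (\<lambda>_. 1) (\<lambda>i. I i \<bullet> P i)) = mor (aid A)"
        using ds(7) by (simp add: LC_def)
    qed (use A in simp)
    finally show "LC A A {..<n} (\<lambda>_. 1) (\<lambda>i. (I i \<bullet> g i) \<bullet> f i \<bullet> P i) = aid A" .
  qed
  then show ?thesis by blast
qed

definition summands where "summands A = (SOME x. decomposes A x)"
definition dn :: "'o \<Rightarrow> nat" where "dn A = fst (summands A)"
definition dS :: "'o \<Rightarrow> nat \<Rightarrow> 'o" where "dS A = fst (snd (summands A))"
definition d\<iota> :: "'o \<Rightarrow> nat \<Rightarrow> ('o, 'm) arrow" where "d\<iota> A = fst (snd (snd (summands A)))"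
definition d\<pi> :: "'o \<Rightarrow> nat \<Rightarrow> ('o, 'm) arrow" where "d\<pi> A = snd (snd (snd (summands A)))"

lemma decomposition:
  assumes "A \<in> obj C"
  shows "r < dn A \<Longrightarrow> dS A r \<in> Irr" "r < dn A \<Longrightarrow> par (dS A r) A (d\<iota> A r)" "r < dn A \<Longrightarrow> par A (dS A r) (d\<pi> A r)"
    "r < dn A \<Longrightarrow> s < dn A \<Longrightarrow> d\<pi> A r \<bullet> d\<iota> A s = (if r = s then aid (dS A r) else Arr (dS A s) 0 (dS A r))"
    "LC A A {..<dn A} (\<lambda>_. 1) (\<lambda>r. d\<iota> A r \<bullet> d\<pi> A r) = aid A"
proof -
  have "decomposes A (dn A, dS A, d\<iota> A, d\<pi> A)"
    using someI_ex[OF decomposition_exists[OF assms]] unfolding summands_def[symmetric] dn_def dS_def d\<iota>_def d\<pi>_def by simp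
  then show "r < dn A \<Longrightarrow> dS A r \<in> Irr" "r < dn A \<Longrightarrow> par (dS A r) A (d\<iota> A r)" "r < dn A \<Longrightarrow> par A (dS A r) (d\<pi> A r)"
    "r < dn A \<Longrightarrow> s < dn A \<Longrightarrow> d\<pi> A r \<bullet> d\<iota> A s = (if r = s then aid (dS A r) else Arr (dS A s) 0 (dS A r))"
    "LC A A {..<dn A} (\<lambda>_. 1) (\<lambda>r. d\<iota> A r \<bullet> d\<pi> A r) = aid A"
    unfolding decomposes_def by auto
qed

lemma decompose_target:
  assumes f: "par A B f"
  shows "f = LC A B {..<dn B} (\<lambda>_. 1) (\<lambda>r. d\<iota> B r \<bullet> d\<pi> B r \<bullet> f)"
proof -
  note f' = parD[OF f]
  note D = decomposition[OF f'(5)]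
  have "f = LC B B {..<dn B} (\<lambda>_. 1) (\<lambda>r. d\<iota> B r \<bullet> d\<pi> B r) \<bullet> f" using D(5) f' by simp
  also have "\<dots> = LC A B {..<dn B} (\<lambda>_. 1) (\<lambda>r. (d\<iota> B r \<bullet> d\<pi> B r) \<bullet> f)"
    using f f' D by (intro LC_cmp) (auto intro: par_cmp)
  finally show ?thesis by (simp only: acmp_assoc)
qed

text \<open>Morphisms into \<open>B\<close> are separated by the projections of \<open>B\<close> to its simple summands.\<close>

lemma simple_tests:
  assumes f: "par A B f" and g: "par A B g" and eq: "\<And>S p. S \<in> Irr \<Longrightarrow> par B S p \<Longrightarrow> p \<bullet> f = p \<bullet> g"
  shows "f = g"
proof -
  have "d\<pi> B r \<bullet> f = d\<pi> B r \<bullet> g" if "r < dn B" for r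
    using eq decomposition(1,3)[OF parD(5)[OF f] that] by blast
  then have "LC A B {..<dn B} (\<lambda>_. 1) (\<lambda>r. d\<iota> B r \<bullet> d\<pi> B r \<bullet> f) = LC A B {..<dn B} (\<lambda>_. 1) (\<lambda>r. d\<iota> B r \<bullet> d\<pi> B r \<bullet> g)"
    by (intro LC_cong) auto
  then show ?thesis using decompose_target[OF f] decompose_target[OF g] by simp
qed

text \<open>The inclusions and projections of the summands of \<open>W\<^sup>\<or> \<otimes> V\<close>, with the strand \<open>W\<^sup>\<or>\<close> bent
  to the other side.\<close>

definition rot_in :: "'o \<Rightarrow> 'o \<Rightarrow> nat \<Rightarrow> ('o, 'm) arrow" where
  "rot_in W V r = Evb W V \<bullet> (aid W \<star> d\<iota> (dl W \<odot> V) r)"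

definition rot_out :: "'o \<Rightarrow> 'o \<Rightarrow> nat \<Rightarrow> ('o, 'm) arrow" where
  "rot_out W V r = (aid W \<star> d\<pi> (dl W \<odot> V) r) \<bullet> Db W V"

definition comps :: "'o \<Rightarrow> 'o \<Rightarrow> 'o \<Rightarrow> nat set" where
  "comps W V V' = {r. r < dn (dl W \<odot> V') \<and> dS (dl W \<odot> V') r = V}"

lemma comps_finite [simp]: "finite (comps W V V')"
  by (simp add: comps_def)

lemma rot_par:
  assumes "W \<in> obj C" "V' \<in> obj C" "r < dn (dl W \<odot> V')" "dS (dl W \<odot> V') r = V"
  shows "par (W \<odot> V) V' (rot_in W V' r)" "par V' (W \<odot> V) (rot_out W V' r)"
proof -
  have o: "dl W \<odot> V' \<in> obj C" using assms by simp
  note D = decomposition[OF o]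
  show "par (W \<odot> V) V' (rot_in W V' r)" "par V' (W \<odot> V) (rot_out W V' r)"
    using D(2,3)[OF assms(3)] assms unfolding rot_in_def rot_out_def par_def by auto
qed

text \<open>Closing the rotated strand turns the composite into a trace over \<open>W\<^sup>\<or> \<otimes> V'\<close>, and cyclicity swaps the factors.\<close>

lemma rot_pairing:
  assumes W: "W \<in> obj C" and V': "V' \<in> Irr" and r: "r \<in> comps W V V'" and s: "s \<in> comps W V V'"
  shows "tr (rot_in W V' s \<bullet> rot_out W V' r) = (if r = s then d V else 0)"
proof -
  let ?A = "dl W \<odot> V'"
  have A: "?A \<in> obj C" using W V' by simp
  note D = decomposition[OF A]
  have rs: "r < dn ?A" "s < dn ?A" "dS ?A r = V" "dS ?A s = V" using r s by (auto simp: comps_def)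
  have V: "V \<in> obj C" using D(1)[OF rs(1)] rs by simp
  have p: "par V ?A (d\<iota> ?A s)" "par ?A V (d\<pi> ?A r)" using D(2)[OF rs(2)] D(3)[OF rs(1)] rs by auto
  define \<phi> where "\<phi> = d\<iota> ?A s \<bullet> d\<pi> ?A r"
  have \<phi>: "par ?A ?A \<phi>" unfolding \<phi>_def using p by (auto intro: par_cmp)
  have "rot_in W V' s \<bullet> rot_out W V' r = Evb W V' \<bullet> (aid W \<star> \<phi>) \<bullet> Db W V'"
    unfolding rot_in_def rot_out_def \<phi>_def using p W by (simp add: par_def lwhisker acmp_assoc)
  also have "\<dots> = pL (dl W) V' V' \<phi> \<I>" using W V' \<phi> by (subst pL_dual) (auto simp: par_def)
  finally have "tr (rot_in W V' s \<bullet> rot_out W V' r) = tr \<phi>" using W V' \<phi> by (simp add: tr_pL[of "dl W" V'])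
  also have "\<dots> = tr (d\<pi> ?A r \<bullet> d\<iota> ?A s)" unfolding \<phi>_def by (rule tr_cyclic[OF p(1) p(2)])
  also have "\<dots> = (if r = s then d V else 0)"
  proof -
    have "tr (Arr V 0 V) = 0" using tr_LC[of V "{}" "\<lambda>_. aid V" "\<lambda>_. 0"] V by (simp add: LC_def)
    then show ?thesis using D(4)[OF rs(1,2)] rs by simp
  qed
  finally show ?thesis .
qed

text \<open>With \<open>W\<close> bent to the other side, \<open>p\<close> becomes a morphism \<open>V \<rightarrow> W\<^sup>\<or> \<otimes> V'\<close>, whose components are
  scalars by Schur's lemma.\<close>

lemma rot_in_span:
  assumes W: "W \<in> obj C" and V: "V \<in> Irr" and V': "V' \<in> Irr" and p: "par (W \<odot> V) V' p"
  obtains \<gamma> where "p = LC (W \<odot> V) V' (comps W V V') \<gamma> (rot_in W V')"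
proof -
  let ?A = "dl W \<odot> V'"
  have o: "?A \<in> obj C" "V \<in> obj C" "V' \<in> obj C" using W V V' by auto
  note p' = parD[OF p]
  note D = decomposition[OF o(1)]
  define t where "t = (aid (dl W) \<star> p) \<bullet> Dbb W V"
  have t: "par V ?A t" unfolding t_def using W p' o by (auto simp: par_def)
  have "Evb W V' \<bullet> (aid W \<star> t) = (Evb W V' \<bullet> (aid W \<star> (aid (dl W) \<star> p))) \<bullet> (aid W \<star> Dbb W V)"
    unfolding t_def using W p' o by (simp add: lwhisker acmp_assoc)
  also have "\<dots> = p" using W p' o by (subst Evb_natural[symmetric, where Z = "W \<odot> V"]) (auto simp: acmp_assoc zz3)
  finally have pt: "p = Evb W V' \<bullet> (aid W \<star> t)" ..
  have "\<exists>c. d\<pi> ?A r \<bullet> t = sA c (aid V)" if r: "r \<in> comps W V V'" for r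
  proof -
    have "par V V (d\<pi> ?A r \<bullet> t)" using r D(3)[of r] t by (auto simp: comps_def intro: par_cmp)
    then show ?thesis using Irr_schur_scalar[OF V] by metis
  qed
  then obtain \<gamma> where \<gamma>: "\<And>r. r \<in> comps W V V' \<Longrightarrow> d\<pi> ?A r \<bullet> t = sA (\<gamma> r) (aid V)" by metis
  have trm: "mor (d\<iota> ?A r \<bullet> d\<pi> ?A r \<bullet> t) = (if r \<in> comps W V V' then scl C (\<gamma> r) (mor (d\<iota> ?A r)) else 0)"
    if r: "r < dn ?A" for r
  proof (cases "r \<in> comps W V V'")
    case True
    have \<iota>: "par V ?A (d\<iota> ?A r)" using D(2)[OF r] True by (auto simp: comps_def)
    then have "d\<iota> ?A r \<bullet> d\<pi> ?A r \<bullet> t = sA (\<gamma> r) (d\<iota> ?A r)"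
      using \<gamma>[OF True] cmp_sA[of V V "aid V" ?A "d\<iota> ?A r"] o by (simp add: par_def)
    then show ?thesis using True by (simp add: mor_sA)
  next
    case False
    then have "dS ?A r \<noteq> V" using r by (auto simp: comps_def)
    then have "d\<pi> ?A r \<bullet> t = Arr V 0 (dS ?A r)"
      using Irr_schur_zero[OF V D(1)[OF r] _ par_cmp[OF t D(3)[OF r]]] by auto
    then show ?thesis using cmp_zero_arrow[OF D(2)[OF r] o(2)] False by simp
  qed
  have "t = LC V ?A (comps W V V') \<gamma> (d\<iota> ?A)"
  proof (rule par_eqI[OF t])
    show "par V ?A (LC V ?A (comps W V V') \<gamma> (d\<iota> ?A))"
      using D(2) o by (intro LC_par) (auto simp: comps_def)
    have "mor t = (\<Sum>r<dn ?A. mor (d\<iota> ?A r \<bullet> d\<pi> ?A r \<bullet> t))"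
      by (subst decompose_target[OF t]) (simp add: LC_def)
    also have "\<dots> = (\<Sum>r\<in>comps W V V'. scl C (\<gamma> r) (mor (d\<iota> ?A r)))"
      using trm by (intro sum.mono_neutral_cong_right) (auto simp: comps_def)
    finally show "mor t = mor (LC V ?A (comps W V V') \<gamma> (d\<iota> ?A))" by (simp add: LC_def)
  qed
  then have "p = Evb W V' \<bullet> (aid W \<star> LC V ?A (comps W V V') \<gamma> (d\<iota> ?A))" using pt by simp
  also have "\<dots> = Evb W V' \<bullet> LC (W \<odot> V) (W \<odot> ?A) (comps W V V') \<gamma> (\<lambda>r. aid W \<star> d\<iota> ?A r)"
    using W o D(2) by (subst aid_ten_LC) (auto simp: comps_def)
  also have "\<dots> = LC (W \<odot> V) V' (comps W V V') \<gamma> (rot_in W V')"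
    unfolding rot_in_def using W o D(2) by (subst cmp_LC[where Y = "W \<odot> ?A"]) (auto simp: comps_def par_def)
  finally show ?thesis using that by blast
qed

definition rot_index :: "'o \<Rightarrow> 'o \<Rightarrow> ('o \<times> nat) set" where
  "rot_index W V = (SIGMA V':Irr. comps W V V')"

lemma rot_index_finite [simp]: "finite (rot_index W V)"
  unfolding rot_index_def using Irr_finite by auto

lemma rot_index_par:
  assumes "W \<in> obj C" "i \<in> rot_index W V"
  shows "par (W \<odot> V) (fst i) (rot_in W (fst i) (snd i))" "par (fst i) (W \<odot> V) (rot_out W (fst i) (snd i))" "fst i \<in> Irr"
  using rot_par[OF assms(1), of "fst i" "snd i" V] assms(2) by (auto simp: rot_index_def comps_def)

text \<open>The rotated bases are dual up to dimensions, so they resolve the identity of \<open>W \<otimes> V\<close>.\<close>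

lemma rotated_resolution:
  assumes W: "W \<in> obj C" and V: "V \<in> Irr"
  shows "LC (W \<odot> V) (W \<odot> V) (rot_index W V) (\<lambda>i. d (fst i))
      (\<lambda>i. rot_out W (fst i) (snd i) \<bullet> rot_in W (fst i) (snd i)) = sA (d V) (aid (W \<odot> V))"
    (is "?L = _")
proof (rule simple_tests[of "W \<odot> V" "W \<odot> V"])
  let ?I = "rot_index W V" and ?b = "\<lambda>i. rot_in W (fst i) (snd i)" and ?c = "\<lambda>i. rot_out W (fst i) (snd i)"
  have o: "V \<in> obj C" "W \<odot> V \<in> obj C" using W V by auto
  note P = rot_index_par[OF W]
  have cb: "par (W \<odot> V) (W \<odot> V) (?c i \<bullet> ?b i)" if "i \<in> ?I" for i using P[OF that] by (auto intro: par_cmp)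
  show L: "par (W \<odot> V) (W \<odot> V) ?L" using o cb by (intro LC_par) auto
  show "par (W \<odot> V) (W \<odot> V) (sA (d V) (aid (W \<odot> V)))" using o by simp
  fix V' p assume V': "V' \<in> Irr" and p: "par (W \<odot> V) V' p"
  have o': "V' \<in> obj C" using V' by simp
  have b: "rot_in W V' s \<bullet> ?L = sA (d V) (rot_in W V' s)" if s: "s \<in> comps W V V'" for s
  proof (rule par_eqI[of "W \<odot> V" V'])
    have bs: "par (W \<odot> V) V' (rot_in W V' s)" using rot_par(1)[OF W o'] s by (auto simp: comps_def)
    show "par (W \<odot> V) V' (rot_in W V' s \<bullet> ?L)" using par_cmp[OF L bs] .
    show "par (W \<odot> V) V' (sA (d V) (rot_in W V' s))" using sA_par[OF bs] .
    have trm: "scl C (d (fst i)) (mor (rot_in W V' s \<bullet> ?c i \<bullet> ?b i)) = (if i = (V', s) then scl C (d V) (mor (rot_in W V' s)) else 0)"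
      if i: "i \<in> ?I" for i
    proof (cases "fst i = V'")
      case False
      have bc: "par (fst i) V' (rot_in W V' s \<bullet> ?c i)" using par_cmp[OF P(2)[OF i] bs] .
      have "rot_in W V' s \<bullet> ?c i = Arr (fst i) 0 V'"
        using Irr_schur_zero[OF P(3)[OF i] V' False bc] .
      then have "rot_in W V' s \<bullet> ?c i \<bullet> ?b i = Arr (W \<odot> V) 0 V'"
        using zero_arrow_cmp[OF P(1)[OF i] o'] by (simp add: acmp_assoc[symmetric])
      then show ?thesis using False by auto
    next
      case True
      obtain r where i': "i = (V', r)" using True by (cases i) auto
      have r: "r \<in> comps W V V'" using i i' by (auto simp: rot_index_def)
      have br: "par (W \<odot> V) V' (rot_in W V' r)" "par V' (W \<odot> V) (rot_out W V' r)" using P[OF i] i' by auto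
      obtain \<mu> where \<mu>: "rot_in W V' s \<bullet> rot_out W V' r = sA \<mu> (aid V')"
        using Irr_schur_scalar[OF V' par_cmp[OF br(2) bs]] .
      have "\<mu> * d V' = (if r = s then d V else 0)"
        using rot_pairing[OF W V' r s] tr_sA[of V' "aid V'" \<mu>] o' unfolding \<mu> by simp
      moreover have "rot_in W V' s \<bullet> rot_out W V' r \<bullet> rot_in W V' r = sA \<mu> (rot_in W V' r)"
        using \<mu> sA_cmp[OF br(1), of V' "aid V'" \<mu>] parD[OF br(1)] o' by (simp add: acmp_assoc[symmetric])
      ultimately show ?thesis using i' by (auto simp: mor_sA mult.commute)
    qed
    have "rot_in W V' s \<bullet> ?L = LC (W \<odot> V) V' ?I (\<lambda>i. d (fst i)) (\<lambda>i. rot_in W V' s \<bullet> ?c i \<bullet> ?b i)"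
      using o bs cb by (intro cmp_LC) auto
    then have "mor (rot_in W V' s \<bullet> ?L) = (\<Sum>i\<in>?I. if i = (V', s) then scl C (d V) (mor (rot_in W V' s)) else 0)"
      using trm by (simp add: LC_def)
    also have "\<dots> = scl C (d V) (mor (rot_in W V' s))"
    proof -
      have "(V', s) \<in> ?I" using s V' by (simp add: rot_index_def)
      then show ?thesis by simp
    qed
    finally show "mor (rot_in W V' s \<bullet> ?L) = mor (sA (d V) (rot_in W V' s))" by (simp add: mor_sA)
  qed
  obtain \<gamma> where \<gamma>: "p = LC (W \<odot> V) V' (comps W V V') \<gamma> (rot_in W V')"
    using rot_in_span[OF W V V' p] .
  have rp: "\<And>s. s \<in> comps W V V' \<Longrightarrow> par (W \<odot> V) V' (rot_in W V' s)"
    using rot_par(1)[OF W o'] by (auto simp: comps_def)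
  have "p \<bullet> ?L = LC (W \<odot> V) V' (comps W V V') \<gamma> (\<lambda>s. rot_in W V' s \<bullet> ?L)"
    unfolding \<gamma> using o' L rp by (intro LC_cmp) auto
  also have "\<dots> = LC (W \<odot> V) V' (comps W V V') \<gamma> (\<lambda>s. sA (d V) (rot_in W V' s))"
    using b by (intro LC_cong) auto
  also have "\<dots> = sA (d V) p"
    unfolding \<gamma> using rp o o'
    by (intro par_eqI[of "W \<odot> V" V'] LC_par sA_par)
      (auto simp: LC_def mor_sA vs.scale_sum_right mult.commute)
  also have "\<dots> = p \<bullet> sA (d V) (aid (W \<odot> V))"
    using cmp_sA[of "W \<odot> V" "W \<odot> V" "aid (W \<odot> V)" V' p "d V"] p parD[OF p] by simp
  finally show "p \<bullet> ?L = p \<bullet> sA (d V) (aid (W \<odot> V))" .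
qed

definition gdim :: 'k where "gdim = (\<Sum>V\<in>Irr. d V ^ 2)"

text \<open>The first rule takes the trace of the decomposition of \<open>W\<^sup>\<or> \<otimes> V'\<close>, the second one below the trace
  of the rotated decomposition of \<open>W \<otimes> V\<close>.\<close>

lemma fusion_rule_in:
  assumes W: "W \<in> obj C" and V': "V' \<in> obj C"
  shows "(\<Sum>V\<in>Irr. of_nat (card (comps W V V')) * d V) = d W * d V'"
proof -
  let ?A = "dl W \<odot> V'"
  have A: "?A \<in> obj C" using W V' by simp
  note D = decomposition[OF A]
  have "d W * d V' = d ?A" using W V' by (simp add: d_ten d_dual del: aid_ten)
  also have "\<dots> = (\<Sum>r<dn ?A. tr (d\<iota> ?A r \<bullet> d\<pi> ?A r))"
    using tr_LC[OF A, of "{..<dn ?A}" "\<lambda>r. d\<iota> ?A r \<bullet> d\<pi> ?A r" "\<lambda>_. 1"] D(2,3,5) by (auto intro: par_cmp)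
  also have "\<dots> = (\<Sum>r<dn ?A. d (dS ?A r))"
  proof (rule sum.cong[OF refl])
    fix r assume "r \<in> {..<dn ?A}"
    then have r: "r < dn ?A" by simp
    show "tr (d\<iota> ?A r \<bullet> d\<pi> ?A r) = d (dS ?A r)" using tr_cyclic[OF D(2,3)[OF r]] D(4)[OF r r] by simp
  qed
  also have "\<dots> = (\<Sum>V\<in>Irr. \<Sum>r | r \<in> {..<dn ?A} \<and> dS ?A r = V. d (dS ?A r))"
    using D(1) Irr_finite by (intro sum.group[symmetric]) auto
  also have "\<dots> = (\<Sum>V\<in>Irr. of_nat (card (comps W V V')) * d V)"
    by (intro sum.cong refl) (simp add: comps_def)
  finally show ?thesis ..
qed

lemma fusion_rule_out:
  assumes W: "W \<in> obj C" and V: "V \<in> Irr"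
  shows "(\<Sum>V'\<in>Irr. of_nat (card (comps W V V')) * d V') = d W * d V"
proof -
  let ?I = "rot_index W V" and ?b = "\<lambda>i. rot_in W (fst i) (snd i)" and ?c = "\<lambda>i. rot_out W (fst i) (snd i)"
  have o: "V \<in> obj C" "W \<odot> V \<in> obj C" using W V by auto
  note P = rot_index_par[OF W]
  have "d V * (d W * d V) = tr (sA (d V) (aid (W \<odot> V)))"
    using o W by (simp add: tr_sA[of "W \<odot> V"] d_ten del: aid_ten)
  also have "\<dots> = (\<Sum>i\<in>?I. d (fst i) * tr (?c i \<bullet> ?b i))"
    unfolding rotated_resolution[OF W V, symmetric]
    by (intro tr_LC[OF o(2)] par_cmp[OF P(1) P(2)])
  also have "\<dots> = (\<Sum>i\<in>?I. d (fst i) * d V)"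
  proof (rule sum.cong[OF refl])
    fix i assume i: "i \<in> ?I"
    have "tr (?c i \<bullet> ?b i) = tr (?b i \<bullet> ?c i)" using tr_cyclic[OF P(2,1)[OF i]] .
    also have "\<dots> = d V" using i rot_pairing[OF W, of "fst i" "snd i" V "snd i"] by (auto simp: rot_index_def)
    finally show "d (fst i) * tr (?c i \<bullet> ?b i) = d (fst i) * d V" by simp
  qed
  also have "\<dots> = (\<Sum>V'\<in>Irr. \<Sum>r\<in>comps W V V'. d V' * d V)"
    unfolding rot_index_def using Irr_finite by (subst sum.Sigma) (auto simp: case_prod_unfold)
  also have "\<dots> = d V * (\<Sum>V'\<in>Irr. of_nat (card (comps W V V')) * d V')"
    by (simp add: sum_distrib_left mult_ac)
  finally show ?thesis using d_Irr[OF V] by simp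
qed

text \<open>With the fusion coefficients \<open>N W V V'\<close>, the second fusion rule gives
  \<open>gdim \<cdot> d V = \<Sum> N W V V' \<cdot> d W \<cdot> d V'\<close>. If this is zero, apply a rational functional \<open>\<phi>\<close>, multiply by
  \<open>\<phi> (d V)\<close> and sum over \<open>V\<close>: by the first fusion rule the result is the sum of the squares of the
  rational numbers \<open>\<phi> (d W \<cdot> d V')\<close>, one of which is \<open>1\<close>. Positivity of the integral matrices
  \<open>N\<^sup>T N\<close> is what this argument expresses; characteristic zero enters through \<open>\<phi>\<close>.\<close>

lemma gdim_nonzero: "gdim \<noteq> 0"
proof
  assume zero: "gdim = 0"
  obtain \<phi> :: "'k \<Rightarrow> rat" where \<phi>: "\<And>x y. \<phi> (x + y) = \<phi> x + \<phi> y"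
    "\<And>n x. \<phi> (of_nat n * x) = of_nat n * \<phi> x" "\<phi> 1 = 1"
    by (rule rational_functional) blast
  have \<phi>0: "\<phi> 0 = 0" using \<phi>(2)[of 0 0] by simp
  have \<phi>_sum: "\<phi> (sum f A) = (\<Sum>x\<in>A. \<phi> (f x))" for f :: "'b \<Rightarrow> 'k" and A
    by (induction A rule: infinite_finite_induct) (auto simp: \<phi> \<phi>0)
  let ?a = "\<lambda>W V V'. of_nat (card (comps W V V'))"
  have "(\<Sum>W\<in>Irr. \<Sum>V'\<in>Irr. ?a W V V' * \<phi> (d W * d V')) = 0" if V: "V \<in> Irr" for V
  proof -
    have "(\<Sum>W\<in>Irr. \<Sum>V'\<in>Irr. ?a W V V' * (d W * d V')) = (\<Sum>W\<in>Irr. d W * (d W * d V))"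
    proof (rule sum.cong[OF refl])
      fix W assume "W \<in> Irr"
      have "(\<Sum>V'\<in>Irr. ?a W V V' * (d W * d V')) = d W * (\<Sum>V'\<in>Irr. ?a W V V' * d V')"
        by (simp add: sum_distrib_left mult_ac)
      then show "(\<Sum>V'\<in>Irr. ?a W V V' * (d W * d V')) = d W * (d W * d V)"
        using fusion_rule_out[OF _ V, of W] \<open>W \<in> Irr\<close> by simp
    qed
    also have "\<dots> = gdim * d V" unfolding gdim_def sum_distrib_right power2_eq_square by (simp add: mult.assoc)
    finally have "\<phi> (\<Sum>W\<in>Irr. \<Sum>V'\<in>Irr. ?a W V V' * (d W * d V')) = 0" using zero \<phi>0 by simp
    then show ?thesis by (simp add: \<phi>_sum \<phi>(2))
  qed
  then have "0 = (\<Sum>V\<in>Irr. \<phi> (d V) * (\<Sum>W\<in>Irr. \<Sum>V'\<in>Irr. ?a W V V' * \<phi> (d W * d V')))" by simp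
  also have "\<dots> = (\<Sum>W\<in>Irr. \<Sum>V'\<in>Irr. \<phi> (d W * d V') * (\<Sum>V\<in>Irr. ?a W V V' * \<phi> (d V)))"
    unfolding sum_distrib_left
    by (subst sum.swap, rule sum.cong[OF refl], subst sum.swap) (simp add: mult_ac)
  also have "\<dots> = (\<Sum>W\<in>Irr. \<Sum>V'\<in>Irr. \<phi> (d W * d V') * \<phi> (d W * d V'))"
  proof (intro sum.cong refl)
    fix W V' assume "W \<in> Irr" "V' \<in> Irr"
    then have "\<phi> (\<Sum>V\<in>Irr. ?a W V V' * d V) = \<phi> (d W * d V')" by (subst fusion_rule_in) auto
    then show "\<phi> (d W * d V') * (\<Sum>V\<in>Irr. ?a W V V' * \<phi> (d V)) = \<phi> (d W * d V') * \<phi> (d W * d V')"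
      by (simp add: \<phi>_sum \<phi>(2))
  qed
  finally have sq: "(\<Sum>W\<in>Irr. \<Sum>V'\<in>Irr. \<phi> (d W * d V') * \<phi> (d W * d V')) = 0" by simp
  define U where "U = rep \<I>"
  have U: "U \<in> Irr" unfolding U_def Irr_def using unit_simple by blast
  have dU: "d U = 1" using d_iso[of U \<I>] rep_simple[OF unit_simple] U d_unit unfolding U_def by auto
  have inner: "\<And>W. (\<Sum>V'\<in>Irr. \<phi> (d W * d V') * \<phi> (d W * d V')) \<ge> 0" by (intro sum_nonneg) simp
  have "(\<Sum>V'\<in>Irr. \<phi> (d U * d V') * \<phi> (d U * d V')) = 0"
    using sq sum_nonneg_eq_0_iff[OF Irr_finite, of "\<lambda>W. \<Sum>V'\<in>Irr. \<phi> (d W * d V') * \<phi> (d W * d V')"] inner U by auto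
  then have "\<phi> (d U * d U) * \<phi> (d U * d U) = 0"
    using sum_nonneg_eq_0_iff[OF Irr_finite, of "\<lambda>V'. \<phi> (d U * d V') * \<phi> (d U * d V')"] U by auto
  then show False using dU \<phi>(3) by simp
qed

end

section \<open>Averaging over the simple objects\<close>

context closed_spherical_fusion_category
begin

text \<open>Morphisms that avoid the closed strand can be moved in and out of a partial trace.\<close>

lemma pR_post:
  assumes "A \<in> obj C" "y \<in> obj C" "par (A \<odot> y) (B \<odot> y) h" "par B E k" "B \<in> obj C"
  shows "k \<bullet> pR A y B h \<I> = pR A y E ((k \<star> aid y) \<bullet> h) \<I>"
proof -
  note h = parD[OF assms(3)] and k = parD[OF assms(4)]
  have "pR A y E ((k \<star> aid y) \<bullet> h) \<I> = (aid E \<star> Evb y \<I>) \<bullet> (k \<star> aid (y \<odot> dl y)) \<bullet> ext A y B y h (dl y) \<bullet> (aid A \<star> Db y \<I>)"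
    unfolding pR_def using assms h k by (subst ext_cmp[of A y B y E y]) (auto simp: ext_ten acmp_assoc)
  also have "\<dots> = (k \<star> aid \<I>) \<bullet> (aid B \<star> Evb y \<I>) \<bullet> ext A y B y h (dl y) \<bullet> (aid A \<star> Db y \<I>)"
    using assms k slide_cmp[of k "Evb y \<I>" B E "y \<odot> dl y" \<I>] by simp
  finally show ?thesis using k by (simp add: pR_def assms(2))
qed

lemma pR_pre:
  assumes "A \<in> obj C" "y \<in> obj C" "B \<in> obj C" "par (A \<odot> y) (B \<odot> y) h" "par E A a"
  shows "pR A y B h \<I> \<bullet> a = pR E y B (h \<bullet> (a \<star> aid y)) \<I>"
proof -
  note h = parD[OF assms(4)] and a = parD[OF assms(5)]
  have "pR E y B (h \<bullet> (a \<star> aid y)) \<I> = (aid B \<star> Evb y \<I>) \<bullet> ext A y B y h (dl y) \<bullet> (a \<star> aid (y \<odot> dl y)) \<bullet> (aid E \<star> Db y \<I>)"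
    unfolding pR_def using assms h a by (subst ext_cmp[of E y A y B y]) (auto simp: ext_ten acmp_assoc)
  also have "(a \<star> aid (y \<odot> dl y)) \<bullet> (aid E \<star> Db y \<I>) = (aid A \<star> Db y \<I>) \<bullet> (a \<star> aid \<I>)"
    using assms a slide[of a "Db y \<I>" E A \<I> "y \<odot> dl y"] by simp
  finally show ?thesis using a by (simp add: pR_def assms(2) acmp_assoc)
qed

lemma pL_pre:
  assumes "W \<in> obj C" "X \<in> obj C" "V \<in> obj C" "par (W \<odot> X) (W \<odot> X) g" "par (X \<odot> V) (X \<odot> V) u"
  shows "pL W X X g V \<bullet> u = pL W (X \<odot> V) (X \<odot> V) (ext W X W X g V \<bullet> (aid W \<star> u)) \<I>"
proof -
  note g = parD[OF assms(4)] and u = parD[OF assms(5)]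
  have "pL W X X g V \<bullet> u = Ev W (X \<odot> V) \<bullet> (aid (dl W) \<star> ext W X W X g V) \<bullet> (aid (dl W) \<star> (aid W \<star> u)) \<bullet> Dbb W (X \<odot> V)"
    unfolding pL_def using assms u Dbb_natural[of W u "X \<odot> V" "X \<odot> V"] by (simp add: acmp_assoc)
  then show ?thesis unfolding pL_def using assms g u by (simp add: lwhisker acmp_assoc)
qed

context
  fixes X \<sigma>
  assumes X [simp]: "X \<in> obj C" and hb: "half_braiding C X \<sigma>"
begin

definition Sg :: "'o \<Rightarrow> ('o, 'm) arrow" where "Sg V = Arr (X \<odot> V) (\<sigma> V) (V \<odot> X)"
definition Sg' :: "'o \<Rightarrow> ('o, 'm) arrow" where
  "Sg' V = Arr (V \<odot> X) (minv C (X \<odot> V) (V \<odot> X) (\<sigma> V)) (X \<odot> V)"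

lemma Sg_dm_cd [simp]: "dm (Sg V) = X \<odot> V" "cd (Sg V) = V \<odot> X" "mor (Sg V) = \<sigma> V"
  "dm (Sg' V) = V \<odot> X" "cd (Sg' V) = X \<odot> V"
  by (auto simp: Sg_def Sg'_def)

lemma Sg_simps [simp]:
  assumes "V \<in> obj C"
  shows "ar (Sg V)" "ar (Sg' V)" "Sg V \<bullet> Sg' V = aid (V \<odot> X)" "Sg' V \<bullet> Sg V = aid (X \<odot> V)"
    "Sg V \<bullet> Sg' V \<bullet> t = aid (V \<odot> X) \<bullet> t" "Sg' V \<bullet> Sg V \<bullet> t = aid (X \<odot> V) \<bullet> t"
proof -
  have iso: "is_iso C (X \<odot> V) (V \<odot> X) (\<sigma> V)" using hb assms by (auto simp: half_braiding_def)
  then have "inverse_of C (X \<odot> V) (V \<odot> X) (\<sigma> V) (minv C (X \<odot> V) (V \<odot> X) (\<sigma> V))"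
    using assms by (intro minv_inverse) auto
  then show 1: "ar (Sg V)" "ar (Sg' V)" and 2: "Sg V \<bullet> Sg' V = aid (V \<odot> X)" "Sg' V \<bullet> Sg V = aid (X \<odot> V)"
    using iso assms by (auto simp: Sg_def Sg'_def inverse_of_def is_iso_def acmp_def aid_def)
  show "Sg V \<bullet> Sg' V \<bullet> t = aid (V \<odot> X) \<bullet> t" "Sg' V \<bullet> Sg V \<bullet> t = aid (X \<odot> V) \<bullet> t"
    using 2 by (simp_all add: acmp_assoc[symmetric])
qed

lemma Sg_natural:
  assumes "par V W f" shows "Sg W \<bullet> (aid X \<star> f) = (f \<star> aid X) \<bullet> Sg V"
proof -
  note f = parD[OF assms]
  have "\<sigma> W \<cdot> (\<one> X \<otimes> mor f) = (mor f \<otimes> \<one> X) \<cdot> \<sigma> V"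
    using hb f by (auto simp: half_braiding_def)
  then show ?thesis using f by (intro arrow_eqI) auto
qed

lemma Sg_unit: "Sg \<I> = aid X"
  using hb by (simp add: Sg_def aid_def half_braiding_def)

lemma Sg_tens:
  assumes "V \<in> obj C" "W \<in> obj C"
  shows "Sg (V \<odot> W) = As' V W X \<bullet> (aid V \<star> Sg W) \<bullet> As V X W \<bullet> (Sg V \<star> aid W) \<bullet> As' X V W"
  using assms hb by (intro arrow_eqI) (auto simp: half_braiding_def)

abbreviation Sx :: "'o \<Rightarrow> 'o \<Rightarrow> ('o, 'm) arrow" where "Sx W V \<equiv> ext X W W X (Sg W) V"

lemma Sx_simps [simp]:
  assumes "W \<in> obj C" "V \<in> obj C"
  shows "ar (Sx W V)" "dm (Sx W V) = X \<odot> (W \<odot> V)" "cd (Sx W V) = W \<odot> (X \<odot> V)"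
  using assms by (auto simp: ext_def)

text \<open>The hexagon for \<open>W \<otimes> V\<close> together with naturality at \<open>c : V' \<rightarrow> W \<otimes> V\<close>.\<close>

lemma Sg_split:
  assumes W: "W \<in> obj C" and V: "V \<in> obj C" and c: "par V' (W \<odot> V) c"
  shows "Sx W V \<bullet> (aid X \<star> c) = (aid W \<star> Sg' V) \<bullet> As W V X \<bullet> (c \<star> aid X) \<bullet> Sg V'"
proof -
  note c' = parD[OF c]
  have "(aid W \<star> Sg' V) \<bullet> As W V X \<bullet> Sg (W \<odot> V) \<bullet> (aid X \<star> c) = Sx W V \<bullet> (aid X \<star> c)"
    using W V c' by (simp add: Sg_tens ext_def acmp_assoc)
  then show ?thesis unfolding Sg_natural[OF c] by simp
qed

text \<open>A strand \<open>V\<close> crosses \<open>X\<close> from right to left below \<open>w\<close> and returns above it. The average closes these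
  strands to loops around \<open>w\<close> and weights them by dimension.\<close>

definition conjg :: "('o, 'm) arrow \<Rightarrow> 'o \<Rightarrow> ('o, 'm) arrow" where
  "conjg w V = Sg' V \<bullet> (aid V \<star> w) \<bullet> Sg V"

lemma conjg_par: "par X X w \<Longrightarrow> V \<in> obj C \<Longrightarrow> par (X \<odot> V) (X \<odot> V) (conjg w V)"
  unfolding conjg_def by (auto simp: par_def)

lemma conjg_split:
  assumes W: "W \<in> obj C" and V: "V \<in> obj C" and c: "par V' (W \<odot> V) c" and w: "par X X w"
  shows "Sx W V \<bullet> (aid X \<star> c) \<bullet> conjg w V' = (aid W \<star> conjg w V) \<bullet> Sx W V \<bullet> (aid X \<star> c)"
proof -
  note c' = parD[OF c] and w' = parD[OF w]
  have "Sx W V \<bullet> (aid X \<star> c) \<bullet> conjg w V' = ((aid W \<star> Sg' V) \<bullet> As W V X \<bullet> (c \<star> aid X) \<bullet> Sg V') \<bullet> conjg w V'"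
    by (simp only: Sg_split[OF W V c, symmetric] acmp_assoc)
  also have "\<dots> = (aid W \<star> Sg' V) \<bullet> As W V X \<bullet> (c \<star> aid X) \<bullet> (aid V' \<star> w) \<bullet> Sg V'"
    using W V c' w' by (simp add: conjg_def acmp_assoc)
  also have "\<dots> = (aid W \<star> Sg' V) \<bullet> (As W V X \<bullet> (aid (W \<odot> V) \<star> w)) \<bullet> (c \<star> aid X) \<bullet> Sg V'"
    using W V c' w' slide_cmp[of c w V' "W \<odot> V" X X] by (simp add: acmp_assoc)
  also have "As W V X \<bullet> (aid (W \<odot> V) \<star> w) = (aid W \<star> (aid V \<star> w)) \<bullet> As W V X"
    using W V w' As_natural[of "aid W" "aid V" w] by simp
  also have "(aid W \<star> Sg' V) \<bullet> ((aid W \<star> (aid V \<star> w)) \<bullet> As W V X) \<bullet> (c \<star> aid X) \<bullet> Sg V'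
      = (aid W \<star> conjg w V) \<bullet> (aid W \<star> Sg' V) \<bullet> As W V X \<bullet> (c \<star> aid X) \<bullet> Sg V'"
    using W V c' w' by (simp add: conjg_def lwhisker acmp_assoc)
  finally show ?thesis using Sg_split[OF W V c] by simp
qed

definition avg :: "('o, 'm) arrow \<Rightarrow> ('o, 'm) arrow" where
  "avg w = LC X X Irr d (\<lambda>V. pR X V X (conjg w V) \<I>)"

lemma avg_par:
  assumes w: "par X X w" shows "par X X (avg w)"
  unfolding avg_def using conjg_par[OF w] by (intro LC_par) (auto simp: par_def)

lemma avg_pairing:
  assumes w: "par X X w" and k: "par X X k"
  shows "tr (k \<bullet> avg w) = (\<Sum>V\<in>Irr. d V * tr ((k \<star> aid V) \<bullet> conjg w V))"
proof -
  have p: "par X X (pR X V X (conjg w V) \<I>)" if "V \<in> Irr" for V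
    using conjg_par[OF w, of V] that by (auto simp: par_def)
  have kc: "par (X \<odot> V) (X \<odot> V) ((k \<star> aid V) \<bullet> conjg w V)" if "V \<in> Irr" for V
    using that by (intro par_cmp[OF conjg_par[OF w] par_ten[OF k par_aid]]) auto
  have "tr (k \<bullet> avg w) = (\<Sum>V\<in>Irr. d V * tr (k \<bullet> pR X V X (conjg w V) \<I>))"
    unfolding avg_def using p k by (subst cmp_LC[OF X k p], simp) (auto intro!: tr_LC par_cmp)
  also have "\<dots> = (\<Sum>V\<in>Irr. d V * tr ((k \<star> aid V) \<bullet> conjg w V))"
    using conjg_par[OF w] k kc by (intro sum.cong refl) (simp add: pR_post tr_pR[OF X _ kc])
  finally show ?thesis .
qed

text \<open>Cyclicity removes the half braidings, and each loop contributes its dimension.\<close>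

lemma tr_avg:
  assumes w: "par X X w" shows "tr (avg w) = gdim * tr w"
proof -
  have "tr (avg w) = tr (aid X \<bullet> avg w)" using avg_par[OF w] by (simp add: par_def)
  also have "\<dots> = (\<Sum>V\<in>Irr. d V * tr ((aid X \<star> aid V) \<bullet> conjg w V))" using w by (subst avg_pairing) auto
  also have "\<dots> = (\<Sum>V\<in>Irr. d V * (d V * tr w))"
  proof (intro sum.cong refl arg_cong2[where f = "(*)"])
    fix V assume V: "V \<in> Irr"
    have "(aid X \<star> aid V) \<bullet> conjg w V = Sg' V \<bullet> ((aid V \<star> w) \<bullet> Sg V)"
      using conjg_par[OF w, of V] V by (simp add: par_def) (simp add: conjg_def)
    also have "tr \<dots> = tr (((aid V \<star> w) \<bullet> Sg V) \<bullet> Sg' V)"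
      using V w by (intro tr_cyclic) (auto simp: par_def)
    also have "\<dots> = tr (aid V \<star> w)" using V w by (simp add: acmp_assoc par_def)
    finally show "tr ((aid X \<star> aid V) \<bullet> conjg w V) = d V * tr w" using V w by (simp add: tr_aid_ten)
  qed
  finally show ?thesis by (simp add: gdim_def sum_distrib_right power2_eq_square mult.assoc)
qed

text \<open>Let \<open>h'\<close> be a test morphism. Closing \<open>h' (W \<otimes> avg w) \<sigma>\<close> on the left of \<open>W\<close> leads directly to
  a sum of traces \<open>layer V\<close>. Closing \<open>h' \<sigma> (avg w \<otimes> W)\<close> on the right puts a loop \<open>V'\<close> beside a loop \<open>W\<^sup>\<or>\<close>;
  decomposing \<open>W\<^sup>\<or> \<otimes> V'\<close> and rotating produces the same sum, by the resolution of the identity of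
  \<open>W \<otimes> V\<close> above.\<close>

context
  fixes W w h'
  assumes W [simp]: "W \<in> obj C" and w: "par X X w" and h': "par (W \<odot> X) (X \<odot> W) h'"
begin

definition layer :: "'o \<Rightarrow> ('o, 'm) arrow" where
  "layer V = ext W X X W h' V \<bullet> (aid W \<star> conjg w V) \<bullet> Sx W V"

lemma h_facts: "ar h'" "dm h' = W \<odot> X" "cd h' = X \<odot> W" "ar w" "dm w = X" "cd w = X"
  using h' w by (auto simp: par_def)

lemma hx_par: "V \<in> obj C \<Longrightarrow> par (W \<odot> (X \<odot> V)) (X \<odot> (W \<odot> V)) (ext W X X W h' V)"
  using h_facts by (auto simp: par_def)

lemma layer_par: "V \<in> obj C \<Longrightarrow> par (X \<odot> (W \<odot> V)) (X \<odot> (W \<odot> V)) (layer V)"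
  unfolding layer_def using h_facts conjg_par[OF w, of V] hx_par[of V] by (auto simp: par_def)

lemma tr_left_layer: "tr (h' \<bullet> (aid W \<star> avg w) \<bullet> Sg W) = (\<Sum>V\<in>Irr. d V * tr (layer V))"
proof -
  note h_facts [simp]
  let ?g = "Sg W \<bullet> h'" and ?a = "avg w"
  note a = avg_par[OF w]
  have g: "par (W \<odot> X) (W \<odot> X) ?g" by (auto simp: par_def)
  have a': "ar ?a" "dm ?a = X" "cd ?a = X" using a by (auto simp: par_def)
  have "tr (h' \<bullet> (aid W \<star> ?a) \<bullet> Sg W) = tr ((h' \<bullet> (aid W \<star> ?a)) \<bullet> Sg W)" by (simp only: acmp_assoc)
  also have "\<dots> = tr (Sg W \<bullet> h' \<bullet> (aid W \<star> ?a))" using a' by (intro tr_cyclic) (auto simp: par_def)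
  also have "\<dots> = tr (pL W X X (?g \<bullet> (aid W \<star> ?a)) \<I>)"
    using a' by (subst tr_pL[of W X]) (auto simp: par_def acmp_assoc)
  also have "\<dots> = tr (pL W X X ?g \<I> \<bullet> ?a)"
    using pL_pre[of W X \<I> ?g ?a] g a by (simp)
  also have "\<dots> = (\<Sum>V\<in>Irr. d V * tr ((pL W X X ?g \<I> \<star> aid V) \<bullet> conjg w V))"
    by (intro avg_pairing w) (auto simp: par_def)
  also have "\<dots> = (\<Sum>V\<in>Irr. d V * tr (layer V))"
  proof (intro sum.cong refl arg_cong2[where f = "(*)"])
    fix V assume "V \<in> Irr"
    then have V [simp]: "V \<in> obj C" by simp
    note cj = conjg_par[OF w V]
    have cj' [simp]: "ar (conjg w V)" "dm (conjg w V) = X \<odot> V" "cd (conjg w V) = X \<odot> V" using cj by (auto simp: par_def)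
    have "(pL W X X ?g \<I> \<star> aid V) \<bullet> conjg w V = pL W X X ?g V \<bullet> conjg w V"
      by (simp add: pL_rwhisker)
    also have "\<dots> = pL W (X \<odot> V) (X \<odot> V) (ext W X W X ?g V \<bullet> (aid W \<star> conjg w V)) \<I>"
      using g cj by (intro pL_pre) auto
    finally have "tr ((pL W X X ?g \<I> \<star> aid V) \<bullet> conjg w V) = tr (ext W X W X ?g V \<bullet> (aid W \<star> conjg w V))"
      by (subst tr_pL[of W "X \<odot> V"]) (auto simp: par_def)
    also have "ext W X W X ?g V = Sx W V \<bullet> ext W X X W h' V" by (rule ext_cmp) auto
    also have "(Sx W V \<bullet> ext W X X W h' V) \<bullet> (aid W \<star> conjg w V) = Sx W V \<bullet> (ext W X X W h' V \<bullet> (aid W \<star> conjg w V))"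
      by (simp only: acmp_assoc)
    also have "tr \<dots> = tr ((ext W X X W h' V \<bullet> (aid W \<star> conjg w V)) \<bullet> Sx W V)"
      using hx_par[OF V] by (intro tr_cyclic) (auto simp: par_def)
    finally show "tr ((pL W X X ?g \<I> \<star> aid V) \<bullet> conjg w V) = tr (layer V)" by (simp add: layer_def acmp_assoc)
  qed
  finally show ?thesis .
qed

lemma tr_right_layer: "tr (h' \<bullet> Sg W \<bullet> (avg w \<star> aid W)) = (\<Sum>V\<in>Irr. d V * tr (layer V))"
proof -
  note h_facts [simp]
  let ?h = "h' \<bullet> Sg W" and ?a = "avg w"
  note a = avg_par[OF w]
  have h: "par (X \<odot> W) (X \<odot> W) ?h" by (auto simp: par_def)
  have a' [simp]: "ar ?a" "dm ?a = X" "cd ?a = X" using a by (auto simp: par_def)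
  \<comment> \<open>The loops \<open>V'\<close> and \<open>W\<^sup>\<or>\<close> are fused: the decomposition of the identity of \<open>W\<^sup>\<or> \<otimes> V'\<close> is inserted.\<close>
  have one: "tr ((pR X W X ?h \<I> \<star> aid V') \<bullet> conjg w V')
      = (\<Sum>r<dn (dl W \<odot> V'). tr (layer (dS (dl W \<odot> V') r) \<bullet> (aid X \<star> (rot_out W V' r \<bullet> rot_in W V' r))))"
    if V': "V' \<in> Irr" for V'
  proof -
    have o [simp]: "V' \<in> obj C" using V' by simp
    let ?A = "dl W \<odot> V'"
    have A: "?A \<in> obj C" by simp
    note D = decomposition[OF A]
    note cj = conjg_par[OF w o]
    have cj' [simp]: "ar (conjg w V')" "dm (conjg w V') = X \<odot> V'" "cd (conjg w V') = X \<odot> V'" using cj by (auto simp: par_def)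
    define P where "P = (aid X \<star> Db W V') \<bullet> conjg w V' \<bullet> (aid X \<star> Evb W V')"
    have P: "par (X \<odot> (W \<odot> ?A)) (X \<odot> (W \<odot> ?A)) P" unfolding P_def by (auto simp: par_def)
    define H where "H = (\<lambda>Z. ext X W X W ?h Z)"
    have H: "par (X \<odot> (W \<odot> Z)) (X \<odot> (W \<odot> Z)) (H Z)" if "Z \<in> obj C" for Z
      unfolding H_def using that h by (auto simp: par_def)
    have s1: "(pR X W X ?h \<I> \<star> aid V') \<bullet> conjg w V' = (aid X \<star> Evb W V') \<bullet> (H ?A \<bullet> (aid X \<star> Db W V') \<bullet> conjg w V')"
      unfolding H_def by (simp add: pR_rwhisker) (simp add: pR_def acmp_assoc)
    have "tr ((pR X W X ?h \<I> \<star> aid V') \<bullet> conjg w V')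
        = tr ((H ?A \<bullet> (aid X \<star> Db W V') \<bullet> conjg w V') \<bullet> (aid X \<star> Evb W V'))"
      unfolding s1 using H[OF A] by (intro tr_cyclic) (auto simp: par_def)
    also have "\<dots> = tr ((H ?A \<bullet> P) \<bullet> (aid X \<star> (aid W \<star> aid ?A)))"
    proof -
      have "(H ?A \<bullet> P) \<bullet> aid (X \<odot> (W \<odot> ?A)) = H ?A \<bullet> P"
        using parD(1,2)[OF par_cmp[OF P H[OF A]]] by (rule cmp_aid)
      moreover have "aid X \<star> (aid W \<star> aid ?A) = aid (X \<odot> (W \<odot> ?A))" by simp
      ultimately show ?thesis by (simp only: P_def acmp_assoc)
    qed
    also have "(aid X \<star> (aid W \<star> aid ?A)) = LC (X \<odot> (W \<odot> ?A)) (X \<odot> (W \<odot> ?A)) {..<dn ?A} (\<lambda>_. 1)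
        (\<lambda>r. aid X \<star> (aid W \<star> (d\<iota> ?A r \<bullet> d\<pi> ?A r)))"
      using D(2,3) by (subst D(5)[symmetric], subst aid_ten_LC, simp_all add: par_cmp[OF D(3) D(2)])
        (subst aid_ten_LC, auto intro!: par_ten par_cmp[OF D(3) D(2)])
    also have "(H ?A \<bullet> P) \<bullet> \<dots> = LC (X \<odot> (W \<odot> ?A)) (X \<odot> (W \<odot> ?A)) {..<dn ?A} (\<lambda>_. 1)
        (\<lambda>r. (H ?A \<bullet> P) \<bullet> (aid X \<star> (aid W \<star> (d\<iota> ?A r \<bullet> d\<pi> ?A r))))"
      by (rule cmp_LC[OF _ par_cmp[OF P H[OF A]]]) (auto intro!: par_ten par_cmp[OF D(3) D(2)])
    also have "tr \<dots> = (\<Sum>r<dn ?A. 1 * tr ((H ?A \<bullet> P) \<bullet> (aid X \<star> (aid W \<star> (d\<iota> ?A r \<bullet> d\<pi> ?A r)))))"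
      by (rule tr_LC) (auto intro!: par_ten par_cmp[OF _ par_cmp[OF P H[OF A]]] par_cmp[OF D(3) D(2)])
    also have "\<dots> = (\<Sum>r<dn ?A. tr (layer (dS ?A r) \<bullet> (aid X \<star> (rot_out W V' r \<bullet> rot_in W V' r))))"
    proof (rule sum.cong[OF refl])
      fix r assume "r \<in> {..<dn ?A}"
      then have r: "r < dn ?A" by simp
      let ?S = "dS ?A r"
      have S [simp]: "?S \<in> obj C" using D(1)[OF r] by simp
      have \<iota> [simp]: "ar (d\<iota> ?A r)" "dm (d\<iota> ?A r) = ?S" "cd (d\<iota> ?A r) = ?A" using D(2)[OF r] by (auto simp: par_def)
      have \<pi> [simp]: "ar (d\<pi> ?A r)" "dm (d\<pi> ?A r) = ?A" "cd (d\<pi> ?A r) = ?S" using D(3)[OF r] by (auto simp: par_def)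
      let ?i = "aid X \<star> (aid W \<star> d\<iota> ?A r)" and ?p = "aid X \<star> (aid W \<star> d\<pi> ?A r)"
      have PH [simp]: "ar P" "dm P = X \<odot> (W \<odot> ?A)" "cd P = X \<odot> (W \<odot> ?A)"
        "\<And>Z. Z \<in> obj C \<Longrightarrow> ar (H Z)" "\<And>Z. Z \<in> obj C \<Longrightarrow> dm (H Z) = X \<odot> (W \<odot> Z)" "\<And>Z. Z \<in> obj C \<Longrightarrow> cd (H Z) = X \<odot> (W \<odot> Z)"
        using P H by (auto simp: par_def)
      have "tr ((H ?A \<bullet> P) \<bullet> (aid X \<star> (aid W \<star> (d\<iota> ?A r \<bullet> d\<pi> ?A r)))) = tr ((H ?A \<bullet> P \<bullet> ?i) \<bullet> ?p)"
        by (simp add: lwhisker acmp_assoc)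
      also have "\<dots> = tr (?p \<bullet> H ?A \<bullet> P \<bullet> ?i)" by (intro tr_cyclic) (auto simp: par_def)
      also have "?p \<bullet> H ?A \<bullet> P \<bullet> ?i = H ?S \<bullet> ?p \<bullet> P \<bullet> ?i"
      proof -
        have "H ?S \<bullet> ?p = ?p \<bullet> H ?A" unfolding H_def using h by (intro ext_natural) (auto simp: par_def)
        then show ?thesis by (metis acmp_assoc)
      qed
      also have "?p \<bullet> P \<bullet> ?i = (aid X \<star> rot_out W V' r) \<bullet> conjg w V' \<bullet> (aid X \<star> rot_in W V' r)"
        unfolding P_def rot_out_def rot_in_def by (simp add: lwhisker acmp_assoc)
      also have "H ?S = ext W X X W h' ?S \<bullet> Sx W ?S" unfolding H_def by (rule ext_cmp) auto
      also have "(ext W X X W h' ?S \<bullet> Sx W ?S) \<bullet> (aid X \<star> rot_out W V' r) \<bullet> conjg w V' \<bullet> (aid X \<star> rot_in W V' r)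
          = ext W X X W h' ?S \<bullet> (Sx W ?S \<bullet> (aid X \<star> rot_out W V' r) \<bullet> conjg w V') \<bullet> (aid X \<star> rot_in W V' r)"
        by (simp only: acmp_assoc)
      also have "Sx W ?S \<bullet> (aid X \<star> rot_out W V' r) \<bullet> conjg w V' = (aid W \<star> conjg w ?S) \<bullet> Sx W ?S \<bullet> (aid X \<star> rot_out W V' r)"
        by (rule conjg_split[OF W S rot_par(2)[OF W o r refl] w])
      also have "ext W X X W h' ?S \<bullet> \<dots> \<bullet> (aid X \<star> rot_in W V' r) = layer ?S \<bullet> (aid X \<star> (rot_out W V' r \<bullet> rot_in W V' r))"
        using rot_par[OF W o r refl] by (simp add: layer_def lwhisker acmp_assoc par_def)
      finally show "1 * tr ((H ?A \<bullet> P) \<bullet> (aid X \<star> (aid W \<star> (d\<iota> ?A r \<bullet> d\<pi> ?A r))))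
          = tr (layer ?S \<bullet> (aid X \<star> (rot_out W V' r \<bullet> rot_in W V' r)))" by simp
    qed
    finally show ?thesis .
  qed
  have "tr (h' \<bullet> Sg W \<bullet> (?a \<star> aid W)) = tr (pR X W X (?h \<bullet> (?a \<star> aid W)) \<I>)"
    by (subst tr_pR[of X W]) (auto simp: par_def acmp_assoc)
  also have "\<dots> = tr (pR X W X ?h \<I> \<bullet> ?a)" using pR_pre[of X W X ?h X ?a] h a by simp
  also have "\<dots> = (\<Sum>V'\<in>Irr. d V' * tr ((pR X W X ?h \<I> \<star> aid V') \<bullet> conjg w V'))"
    by (intro avg_pairing w) (auto simp: par_def)
  also have "\<dots> = (\<Sum>V'\<in>Irr. \<Sum>r<dn (dl W \<odot> V'). d V' * tr (layer (dS (dl W \<odot> V') r) \<bullet> (aid X \<star> (rot_out W V' r \<bullet> rot_in W V' r))))"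
    by (intro sum.cong refl) (simp add: one sum_distrib_left)
  also have "\<dots> = (\<Sum>V'\<in>Irr. \<Sum>V\<in>Irr. \<Sum>r\<in>comps W V V'. d V' * tr (layer V \<bullet> (aid X \<star> (rot_out W V' r \<bullet> rot_in W V' r))))"
  proof (rule sum.cong[OF refl])
    fix V' assume "V' \<in> Irr"
    then have A: "dl W \<odot> V' \<in> obj C" by simp
    show "(\<Sum>r<dn (dl W \<odot> V'). d V' * tr (layer (dS (dl W \<odot> V') r) \<bullet> (aid X \<star> (rot_out W V' r \<bullet> rot_in W V' r))))
      = (\<Sum>V\<in>Irr. \<Sum>r\<in>comps W V V'. d V' * tr (layer V \<bullet> (aid X \<star> (rot_out W V' r \<bullet> rot_in W V' r))))"
      using decomposition(1)[OF A] Irr_finite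
      by (subst sum.group[where g = "dS (dl W \<odot> V')" and T = Irr, symmetric]) (auto simp: comps_def intro!: sum.cong)
  qed
  also have "\<dots> = (\<Sum>V\<in>Irr. \<Sum>i\<in>rot_index W V. d (fst i) * tr (layer V \<bullet> (aid X \<star> (rot_out W (fst i) (snd i) \<bullet> rot_in W (fst i) (snd i)))))"
    unfolding rot_index_def using Irr_finite
    by (subst sum.swap) (intro sum.cong refl, subst sum.Sigma, auto simp: case_prod_unfold)
  also have "\<dots> = (\<Sum>V\<in>Irr. d V * tr (layer V))"
  proof (rule sum.cong[OF refl])
    fix V assume V: "V \<in> Irr"
    then have o [simp]: "V \<in> obj C" by simp
    let ?I = "rot_index W V" and ?f = "\<lambda>i. rot_out W (fst i) (snd i) \<bullet> rot_in W (fst i) (snd i)"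
    have f: "par (W \<odot> V) (W \<odot> V) (?f i)" if "i \<in> ?I" for i
      using rot_index_par[OF W that] by (auto intro: par_cmp)
    have Xf: "par (X \<odot> (W \<odot> V)) (X \<odot> (W \<odot> V)) (aid X \<star> ?f i)" if "i \<in> ?I" for i
      using f[OF that] by (auto simp: par_def)
    note L = layer_par[OF o]
    have "(\<Sum>i\<in>?I. d (fst i) * tr (layer V \<bullet> (aid X \<star> ?f i)))
        = tr (LC (X \<odot> (W \<odot> V)) (X \<odot> (W \<odot> V)) ?I (\<lambda>i. d (fst i)) (\<lambda>i. layer V \<bullet> (aid X \<star> ?f i)))"
      by (rule tr_LC[symmetric]) (simp, rule par_cmp[OF Xf L])
    also have "LC (X \<odot> (W \<odot> V)) (X \<odot> (W \<odot> V)) ?I (\<lambda>i. d (fst i)) (\<lambda>i. layer V \<bullet> (aid X \<star> ?f i))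
        = layer V \<bullet> LC (X \<odot> (W \<odot> V)) (X \<odot> (W \<odot> V)) ?I (\<lambda>i. d (fst i)) (\<lambda>i. aid X \<star> ?f i)"
      by (rule cmp_LC[symmetric, OF _ L Xf]) simp
    also have "LC (X \<odot> (W \<odot> V)) (X \<odot> (W \<odot> V)) ?I (\<lambda>i. d (fst i)) (\<lambda>i. aid X \<star> ?f i)
        = aid X \<star> LC (W \<odot> V) (W \<odot> V) ?I (\<lambda>i. d (fst i)) ?f"
      by (rule aid_ten_LC[symmetric]) (auto intro: f)
    also have "\<dots> = sA (d V) (aid (X \<odot> (W \<odot> V)))"
      unfolding rotated_resolution[OF W V] using aid_ten_sA[of "W \<odot> V" "W \<odot> V" "aid (W \<odot> V)" X "d V"] by simp
    also have "layer V \<bullet> \<dots> = sA (d V) (layer V)"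
      using cmp_sA[OF par_aid L, of "d V"] parD[OF L] by simp
    finally show "(\<Sum>i\<in>?I. d (fst i) * tr (layer V \<bullet> (aid X \<star> ?f i))) = d V * tr (layer V)"
      using tr_sA[OF L] by simp
  qed
  finally show ?thesis .
qed

end

text \<open>The handle slide: the trace form is nondegenerate, and tested against any \<open>h'\<close> both sides become
  the same sum of traces over \<open>X \<otimes> W \<otimes> V\<close>.\<close>

lemma avg_central:
  assumes w: "par X X w" and W: "W \<in> obj C"
  shows "(aid W \<star> avg w) \<bullet> Sg W = Sg W \<bullet> (avg w \<star> aid W)"
proof (rule trace_nondegenerate[of "X \<odot> W" "W \<odot> X"])
  have S: "par (X \<odot> W) (W \<odot> X) (Sg W)" using W by (auto simp: par_def)
  show "par (X \<odot> W) (W \<odot> X) ((aid W \<star> avg w) \<bullet> Sg W)"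
    by (rule par_cmp[OF S par_ten[OF par_aid[OF W] avg_par[OF w]]])
  show "par (X \<odot> W) (W \<odot> X) (Sg W \<bullet> (avg w \<star> aid W))"
    by (rule par_cmp[OF par_ten[OF avg_par[OF w] par_aid[OF W]] S])
  fix h' assume h': "par (W \<odot> X) (X \<odot> W) h'"
  show "tr (h' \<bullet> (aid W \<star> avg w) \<bullet> Sg W) = tr (h' \<bullet> Sg W \<bullet> (avg w \<star> aid W))"
    unfolding tr_left_layer[OF W w h'] tr_right_layer[OF W w h'] ..
qed

end
end

section \<open>The center\<close>

lemma center_simps [simp]:
  "obj (center C) = {X. fst X \<in> obj C \<and> half_braiding C (fst X) (snd X)}"
  "cmp (center C) = cmp C" "idn (center C) X = idn C (fst X)" "scl (center C) = scl C"
  "hom (center C) X Y = {f \<in> hom C (fst X) (fst Y). \<forall>V\<in>obj C.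
    cmp C (tensm C (idn C V) f) (snd X V) = cmp C (snd Y V) (tensm C f (idn C V))}"
  by (auto simp: center_def case_prod_unfold)

lemma ptr_center: "ptr (center C) X f = ptr C (fst X) f"
  by (cases X) (simp add: ptr_def ptr_right_def ev_bar_def center_def)

context closed_spherical_fusion_category
begin

text \<open>If \<open>P + Q = 1\<close>, then \<open>P\<close> fixes what \<open>Q\<close> annihilates, also after tensoring with \<open>V\<close>. It will be
  used for \<open>P = k r\<close> and \<open>Q = s f\<close>, where \<open>k\<close> is a kernel of \<open>f\<close>.\<close>

lemma complement_absorb:
  assumes P: "par X X P" and Q: "par X X Q" and PQ: "mor P + mor Q = \<one> X"
  shows "par Z X t \<Longrightarrow> Q \<bullet> t = Arr Z 0 X \<Longrightarrow> P \<bullet> t = t"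
    and "V \<in> obj C \<Longrightarrow> par Z (V \<odot> X) t \<Longrightarrow> (aid V \<star> Q) \<bullet> t = Arr Z 0 (V \<odot> X) \<Longrightarrow> (aid V \<star> P) \<bullet> t = t"
    and "V \<in> obj C \<Longrightarrow> par Z (X \<odot> V) t \<Longrightarrow> (Q \<star> aid V) \<bullet> t = Arr Z 0 (X \<odot> V) \<Longrightarrow> (P \<star> aid V) \<bullet> t = t"
proof -
  have X: "X \<in> obj C" using parD[OF P] by simp
  define F where "F = (\<lambda>b. if b then P else Q)"
  have F: "par X X (F b)" for b using P Q by (simp add: F_def)
  have id: "LC X X UNIV (\<lambda>_. 1) F = aid X"
    using X F PQ by (intro par_eqI[of X X] LC_par) (auto simp: LC_def F_def UNIV_bool add.commute)
  have absorb: "G True \<bullet> t = t" if G: "\<And>b. par Y Y (G b)" and i: "LC Y Y UNIV (\<lambda>_. 1) G = aid Y"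
    and t: "par Z Y t" and z: "G False \<bullet> t = Arr Z 0 Y" for Y G t
  proof -
    note t' = parD[OF t]
    have "t = LC Z Y UNIV (\<lambda>_. 1) (\<lambda>b. G b \<bullet> t)"
      using LC_cmp[OF t'(5) t, of UNIV G "\<lambda>_. 1"] G i t' by simp
    then have "mor t = mor (LC Z Y UNIV (\<lambda>_. 1) (\<lambda>b. G b \<bullet> t))" by simp
    also have "\<dots> = mor (G True \<bullet> t)" using z by (simp add: LC_def UNIV_bool)
    finally show ?thesis using par_eqI[OF par_cmp[OF t G] t] by simp
  qed
  show "par Z X t \<Longrightarrow> Q \<bullet> t = Arr Z 0 X \<Longrightarrow> P \<bullet> t = t" for t
    using absorb[of X F t, OF F id] by (simp add: F_def)
  show "par Z (V \<odot> X) t \<Longrightarrow> (aid V \<star> Q) \<bullet> t = Arr Z 0 (V \<odot> X) \<Longrightarrow> (aid V \<star> P) \<bullet> t = t" if V: "V \<in> obj C" for t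
  proof -
    have "LC (V \<odot> X) (V \<odot> X) UNIV (\<lambda>_. 1) (\<lambda>b. aid V \<star> F b) = aid (V \<odot> X)"
      using aid_ten_LC[OF V X X, of UNIV F "\<lambda>_. 1"] F id V X by simp
    from absorb[OF par_ten[OF par_aid[OF V] F] this]
    show "par Z (V \<odot> X) t \<Longrightarrow> (aid V \<star> Q) \<bullet> t = Arr Z 0 (V \<odot> X) \<Longrightarrow> (aid V \<star> P) \<bullet> t = t" by (simp add: F_def)
  qed
  show "par Z (X \<odot> V) t \<Longrightarrow> (Q \<star> aid V) \<bullet> t = Arr Z 0 (X \<odot> V) \<Longrightarrow> (P \<star> aid V) \<bullet> t = t" if V: "V \<in> obj C" for t
  proof -
    have "LC (X \<odot> V) (X \<odot> V) UNIV (\<lambda>_. 1) (\<lambda>b. F b \<star> aid V) = aid (X \<odot> V)"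
      using LC_ten_aid[OF V X X, of UNIV F "\<lambda>_. 1"] F id V X by simp
    from absorb[OF par_ten[OF F par_aid[OF V]] this]
    show "par Z (X \<odot> V) t \<Longrightarrow> (Q \<star> aid V) \<bullet> t = Arr Z 0 (X \<odot> V) \<Longrightarrow> (P \<star> aid V) \<bullet> t = t" by (simp add: F_def)
  qed
qed

lemma center_hom_arrow:
  assumes X: "X \<in> obj (center C)" and Y: "Y \<in> obj (center C)"
  shows "f \<in> hom (center C) X Y \<longleftrightarrow> par (fst X) (fst Y) (Arr (fst X) f (fst Y)) \<and>
    (\<forall>V\<in>obj C. (aid V \<star> Arr (fst X) f (fst Y)) \<bullet> Sg (fst X) (snd X) V = Sg (fst Y) (snd Y) V \<bullet> (Arr (fst X) f (fst Y) \<star> aid V))"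
proof -
  let ?x = "fst X" and ?y = "fst Y"
  have h: "?x \<in> obj C" "half_braiding C ?x (snd X)" "?y \<in> obj C" "half_braiding C ?y (snd Y)" using X Y by auto
  note dc = Sg_dm_cd[OF h(1,2)] Sg_dm_cd[OF h(3,4)]
  note Ss = Sg_simps[OF h(1,2)] Sg_simps[OF h(3,4)]
  have "((aid V \<star> Arr ?x f ?y) \<bullet> Sg ?x (snd X) V = Sg ?y (snd Y) V \<bullet> (Arr ?x f ?y \<star> aid V))
      \<longleftrightarrow> (\<one> V \<otimes> f) \<cdot> snd X V = snd Y V \<cdot> (f \<otimes> \<one> V)" if f: "f \<in> hom C ?x ?y" and V: "V \<in> obj C" for V
  proof -
    have a: "ar ((aid V \<star> Arr ?x f ?y) \<bullet> Sg ?x (snd X) V)" "ar (Sg ?y (snd Y) V \<bullet> (Arr ?x f ?y \<star> aid V))"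
      using f V h dc Ss(1,7)[OF V] by auto
    have m: "mor ((aid V \<star> Arr ?x f ?y) \<bullet> Sg ?x (snd X) V) = (\<one> V \<otimes> f) \<cdot> snd X V"
      "mor (Sg ?y (snd Y) V \<bullet> (Arr ?x f ?y \<star> aid V)) = snd Y V \<cdot> (f \<otimes> \<one> V)"
      using f V h dc Ss(1,7)[OF V] by auto
    show ?thesis
    proof
      assume "(aid V \<star> Arr ?x f ?y) \<bullet> Sg ?x (snd X) V = Sg ?y (snd Y) V \<bullet> (Arr ?x f ?y \<star> aid V)"
      then show "(\<one> V \<otimes> f) \<cdot> snd X V = snd Y V \<cdot> (f \<otimes> \<one> V)" using m by metis
    next
      assume "(\<one> V \<otimes> f) \<cdot> snd X V = snd Y V \<cdot> (f \<otimes> \<one> V)"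
      then show "(aid V \<star> Arr ?x f ?y) \<bullet> Sg ?x (snd X) V = Sg ?y (snd Y) V \<bullet> (Arr ?x f ?y \<star> aid V)"
        using a m f V h dc Ss(1,7)[OF V] by (intro arrow_eqI) auto
    qed
  qed
  then show ?thesis using h by (auto simp: par_Arr)
qed

text \<open>With a pseudo-inverse \<open>s\<close> of \<open>f\<close>, the kernel \<open>k\<close> of \<open>f\<close> in \<open>C\<close> splits: \<open>k r = 1 - s f\<close>. Since \<open>f\<close>
  is central, \<open>\<sigma> (k \<otimes> V)\<close> is annihilated by \<open>V \<otimes> f\<close>, hence fixed by \<open>V \<otimes> k r\<close>. So
  \<open>(V \<otimes> r) \<sigma> (k \<otimes> V)\<close> is a half braiding that makes \<open>k\<close> central; its axioms follow from those of
  \<open>\<sigma>\<close> by cancelling \<open>k\<close>.\<close>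

lemma center_kernel:
  assumes X: "X \<in> obj (center C)" and Y: "Y \<in> obj (center C)" and f: "f \<in> hom (center C) X Y"
  shows "\<exists>K k. is_kernel (center C) X Y f K k"
proof -
  define x where "x = fst X"
  define y where "y = fst Y"
  define F where "F = Arr x f y"
  define SX where "SX = Sg x (snd X)"
  define SX' where "SX' = Sg' x (snd X)"
  define SY where "SY = Sg y (snd Y)"
  define SY' where "SY' = Sg' y (snd Y)"
  have o [simp]: "x \<in> obj C" "y \<in> obj C" and hb: "half_braiding C x (snd X)" "half_braiding C y (snd Y)"
    using X Y by (auto simp: x_def y_def)
  have SX [simp]: "ar (SX V)" "dm (SX V) = x \<odot> V" "cd (SX V) = V \<odot> x" "ar (SX' V)" "dm (SX' V) = V \<odot> x" "cd (SX' V) = x \<odot> V"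
    "SX V \<bullet> SX' V = aid (V \<odot> x)" "SX' V \<bullet> SX V = aid (x \<odot> V)" "SX' V \<bullet> SX V \<bullet> t = aid (x \<odot> V) \<bullet> t" "SX V \<bullet> SX' V \<bullet> t = aid (V \<odot> x) \<bullet> t" if "V \<in> obj C" for V t
    using Sg_simps[OF o(1) hb(1) that] Sg_dm_cd[OF o(1) hb(1), of V] by (auto simp: SX_def SX'_def)
  have SY [simp]: "ar (SY V)" "dm (SY V) = y \<odot> V" "cd (SY V) = V \<odot> y" "ar (SY' V)" "dm (SY' V) = V \<odot> y" "cd (SY' V) = y \<odot> V"
    "SY V \<bullet> SY' V = aid (V \<odot> y)" "SY' V \<bullet> SY V = aid (y \<odot> V)" "SY' V \<bullet> SY V \<bullet> t = aid (y \<odot> V) \<bullet> t" if "V \<in> obj C" for V t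
    using Sg_simps[OF o(2) hb(2) that] Sg_dm_cd[OF o(2) hb(2), of V] by (auto simp: SY_def SY'_def)
  have fh: "f \<in> hom C x y" using f by (simp add: x_def y_def)
  have Fp: "par x y F" using fh by (simp add: F_def par_Arr)
  have F [simp]: "ar F" "dm F = x" "cd F = y" using parD[OF Fp] by auto
  have Fc: "(aid V \<star> F) \<bullet> SX V = SY V \<bullet> (F \<star> aid V)" if "V \<in> obj C" for V
    using f that unfolding center_hom_arrow[OF X Y] F_def SX_def SY_def x_def y_def by blast
  obtain K k where k: "is_kernel C x y f K k" using has_kernels[OF o fh] by blast
  have K [simp]: "K \<in> obj C" and kh: "k \<in> hom C K x" "f \<cdot> k = 0" using k by (auto simp: is_kernel_def)
  have kmono: "monic C K x k" using kernel_monic[OF o fh k] .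
  obtain s where s: "s \<in> hom C y x" "f \<cdot> s \<cdot> f = f" using von_neumann_regular[OF o fh] .
  have sf: "s \<cdot> f \<in> hom C x x" using cmp_hom[of x y x] s fh by simp
  have e: "\<one> x - s \<cdot> f \<in> hom C x x" using sf idn_hom hom_diff by simp
  have "f \<cdot> (\<one> x - s \<cdot> f) = 0"
    using cmp_diff_right[of x x y "\<one> x" "s \<cdot> f" f] sf s fh idn_hom cmp_idn[of x y f] by simp
  then have "\<exists>!r. r \<in> hom C x K \<and> k \<cdot> r = \<one> x - s \<cdot> f"
    using k e o(1) unfolding is_kernel_def by blast
  then obtain r where r: "r \<in> hom C x K" "k \<cdot> r = \<one> x - s \<cdot> f" by blast
  define k' where "k' = Arr K k x"
  define r' where "r' = Arr x r K"
  define s' where "s' = Arr y s x"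
  have kp [simp]: "ar k'" "dm k' = K" "cd k' = x" "ar r'" "dm r' = x" "cd r' = K" "ar s'" "dm s' = y" "cd s' = x"
    using kh r s by (auto simp: k'_def r'_def s'_def)
  have Fk: "F \<bullet> k' = Arr K 0 y" using kh fh by (simp add: F_def k'_def acmp_def)
  define P where "P = k' \<bullet> r'"
  define Q where "Q = s' \<bullet> F"
  have P: "par x x P" and Q: "par x x Q" unfolding P_def Q_def by (auto simp: par_def)
  have PQ: "mor P + mor Q = \<one> x" using r by (simp add: P_def Q_def) (simp add: k'_def r'_def s'_def F_def)
  note absorb = complement_absorb[OF P Q PQ]
  have kr_k: "P \<bullet> k' = k'"
  proof (rule absorb(1)[where Z = K])
    show "par K x k'" by (auto simp: par_def)
    have "Q \<bullet> k' = s' \<bullet> Arr K 0 y" by (simp add: Q_def acmp_assoc Fk)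
    also have "\<dots> = Arr K 0 x" by (rule cmp_zero_arrow) (auto simp: par_def)
    finally show "Q \<bullet> k' = Arr K 0 x" .
  qed
  have rk [simp]: "r' \<bullet> k' = aid K"
  proof -
    have "mor (r' \<bullet> k') = r \<cdot> k" by simp (simp add: k'_def r'_def)
    moreover have "r \<cdot> k = \<one> K"
    proof -
      have "k \<cdot> (r \<cdot> k) = k \<cdot> \<one> K"
        using arg_cong[OF kr_k, of mor] cmp_idn[of K x k] kh by (simp add: P_def acmp_assoc) (simp add: k'_def r'_def)
      moreover have "r \<cdot> k \<in> hom C K K" using cmp_hom[of K x K k r] kh r by simp
      ultimately show ?thesis using kmono idn_hom[OF K] K unfolding monic_def by blast
    qed
    ultimately show ?thesis by (intro par_eqI[of K K]) (auto simp: par_def)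
  qed
  have rk_cmp [simp]: "r' \<bullet> k' \<bullet> t = aid K \<bullet> t" for t by (rule pre2[OF rk])
  \<comment> \<open>The half braiding of the kernel and its inverse.\<close>
  define T where "T = (\<lambda>V. (aid V \<star> r') \<bullet> SX V \<bullet> (k' \<star> aid V))"
  define T' where "T' = (\<lambda>V. (r' \<star> aid V) \<bullet> SX' V \<bullet> (aid V \<star> k'))"
  have T [simp]: "ar (T V)" "dm (T V) = K \<odot> V" "cd (T V) = V \<odot> K" "ar (T' V)" "dm (T' V) = V \<odot> K" "cd (T' V) = K \<odot> V"
    if "V \<in> obj C" for V using that by (auto simp: T_def T'_def)
  have kT: "(aid V \<star> k') \<bullet> T V = SX V \<bullet> (k' \<star> aid V)" if V [simp]: "V \<in> obj C" for V
  proof -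
    have "(aid V \<star> P) \<bullet> (SX V \<bullet> (k' \<star> aid V)) = SX V \<bullet> (k' \<star> aid V)"
    proof (rule absorb(2)[where Z = "K \<odot> V"])
      show "par (K \<odot> V) (V \<odot> x) (SX V \<bullet> (k' \<star> aid V))" by (auto simp: par_def)
      have "(aid V \<star> Q) \<bullet> SX V \<bullet> (k' \<star> aid V) = (aid V \<star> s') \<bullet> ((aid V \<star> F) \<bullet> SX V) \<bullet> (k' \<star> aid V)"
        by (simp add: Q_def lwhisker acmp_assoc)
      also have "\<dots> = ((aid V \<star> s') \<bullet> SY V) \<bullet> ((F \<bullet> k') \<star> aid V)"
        unfolding Fc[OF V] by (simp add: rwhisker acmp_assoc)
      also have "\<dots> = ((aid V \<star> s') \<bullet> SY V) \<bullet> Arr (K \<odot> V) 0 (y \<odot> V)"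
        unfolding Fk by (simp add: zero_ten)
      also have "\<dots> = Arr (K \<odot> V) 0 (V \<odot> x)" by (rule cmp_zero_arrow) (auto simp: par_def)
      finally show "(aid V \<star> Q) \<bullet> (SX V \<bullet> (k' \<star> aid V)) = Arr (K \<odot> V) 0 (V \<odot> x)" .
    qed simp
    then show ?thesis by (simp add: P_def T_def lwhisker acmp_assoc)
  qed
  have kT': "(k' \<star> aid V) \<bullet> T' V = SX' V \<bullet> (aid V \<star> k')" if V [simp]: "V \<in> obj C" for V
  proof -
    have "(P \<star> aid V) \<bullet> (SX' V \<bullet> (aid V \<star> k')) = SX' V \<bullet> (aid V \<star> k')"
    proof (rule absorb(3)[where Z = "V \<odot> K"])
      show "par (V \<odot> K) (x \<odot> V) (SX' V \<bullet> (aid V \<star> k'))" by (auto simp: par_def)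
      have FS: "(F \<star> aid V) \<bullet> SX' V = SY' V \<bullet> (aid V \<star> F)"
      proof -
        have "(F \<star> aid V) \<bullet> SX' V = SY' V \<bullet> (SY V \<bullet> (F \<star> aid V)) \<bullet> SX' V" by (simp add: acmp_assoc)
        also have "\<dots> = SY' V \<bullet> (aid V \<star> F)" unfolding Fc[OF V, symmetric] by (simp add: acmp_assoc)
        finally show ?thesis .
      qed
      have "(Q \<star> aid V) \<bullet> SX' V \<bullet> (aid V \<star> k') = (s' \<star> aid V) \<bullet> ((F \<star> aid V) \<bullet> SX' V) \<bullet> (aid V \<star> k')"
        by (simp add: Q_def rwhisker acmp_assoc)
      also have "\<dots> = ((s' \<star> aid V) \<bullet> SY' V) \<bullet> (aid V \<star> (F \<bullet> k'))"
        unfolding FS by (simp add: lwhisker acmp_assoc)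
      also have "aid V \<star> (F \<bullet> k') = Arr (V \<odot> K) 0 (V \<odot> y)"
        unfolding Fk using aid_ten_LC[of V K y "{}" "\<lambda>_. k'" "\<lambda>_. 0"] by (simp add: LC_def)
      also have "((s' \<star> aid V) \<bullet> SY' V) \<bullet> \<dots> = Arr (V \<odot> K) 0 (x \<odot> V)" by (rule cmp_zero_arrow) (auto simp: par_def)
      finally show "(Q \<star> aid V) \<bullet> (SX' V \<bullet> (aid V \<star> k')) = Arr (V \<odot> K) 0 (x \<odot> V)" .
    qed simp
    then show ?thesis by (simp add: P_def T'_def rwhisker acmp_assoc)
  qed
  have cancelL: "u = v" if "(aid V \<star> k') \<bullet> u = (aid V \<star> k') \<bullet> v" "V \<in> obj C" "ar u" "ar v" "cd u = V \<odot> K" "cd v = V \<odot> K" for u v V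
  proof -
    have "(aid V \<star> r') \<bullet> (aid V \<star> k') \<bullet> u = (aid V \<star> r') \<bullet> (aid V \<star> k') \<bullet> v" using that(1) by simp
    then show ?thesis using that(2-6) by simp
  qed
  have cancelR: "u = v" if "(k' \<star> aid V) \<bullet> u = (k' \<star> aid V) \<bullet> v" "V \<in> obj C" "ar u" "ar v" "cd u = K \<odot> V" "cd v = K \<odot> V" for u v V
  proof -
    have "(r' \<star> aid V) \<bullet> (k' \<star> aid V) \<bullet> u = (r' \<star> aid V) \<bullet> (k' \<star> aid V) \<bullet> v" using that(1) by simp
    then show ?thesis using that(2-6) by simp
  qed
  have TT: "T V \<bullet> T' V = aid (V \<odot> K)" "T' V \<bullet> T V = aid (K \<odot> V)" if V [simp]: "V \<in> obj C" for V
  proof -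
    have "(aid V \<star> k') \<bullet> T V \<bullet> T' V = SX V \<bullet> (k' \<star> aid V) \<bullet> T' V" by (simp add: pre2[OF kT] acmp_assoc)
    also have "\<dots> = (aid V \<star> k') \<bullet> aid (V \<odot> K)" by (simp add: kT')
    finally show "T V \<bullet> T' V = aid (V \<odot> K)" by (rule cancelL) auto
    have "(k' \<star> aid V) \<bullet> T' V \<bullet> T V = SX' V \<bullet> (aid V \<star> k') \<bullet> T V" by (simp add: pre2[OF kT'] acmp_assoc)
    also have "\<dots> = (k' \<star> aid V) \<bullet> aid (K \<odot> V)" by (simp add: kT)
    finally show "T' V \<bullet> T V = aid (K \<odot> V)" by (rule cancelR) auto
  qed
  have Tnat: "T W \<bullet> (aid K \<star> g) = (g \<star> aid K) \<bullet> T V" if g: "par V W g" for V W g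
  proof -
    note g' [simp] = parD[OF g]
    have "(aid W \<star> k') \<bullet> T W \<bullet> (aid K \<star> g) = SX W \<bullet> (k' \<star> aid W) \<bullet> (aid K \<star> g)" by (simp add: pre2[OF kT] acmp_assoc)
    also have "\<dots> = (SX W \<bullet> (aid x \<star> g)) \<bullet> (k' \<star> aid V)" using slide[of k' g K x V W] by (simp add: acmp_assoc)
    also have "\<dots> = (g \<star> aid x) \<bullet> SX V \<bullet> (k' \<star> aid V)"
      using Sg_natural[OF o(1) hb(1) g] by (simp add: SX_def acmp_assoc)
    also have "\<dots> = (g \<star> aid x) \<bullet> (aid V \<star> k') \<bullet> T V" by (simp add: kT)
    also have "\<dots> = (aid W \<star> k') \<bullet> (g \<star> aid K) \<bullet> T V" using slide_cmp[of g k' V W K x] by simp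
    finally show ?thesis by (rule cancelL) auto
  qed
  have Tunit: "T \<I> = aid K" using Sg_unit[OF o(1) hb(1)] by (simp add: T_def SX_def)
  have Ttens: "T (V \<odot> W) = As' V W K \<bullet> (aid V \<star> T W) \<bullet> As V K W \<bullet> (T V \<star> aid W) \<bullet> As' K V W"
    if V [simp]: "V \<in> obj C" and W [simp]: "W \<in> obj C" for V W
  proof -
    let ?R = "(aid V \<star> T W) \<bullet> As V K W \<bullet> (T V \<star> aid W) \<bullet> As' K V W"
    have n1: "(aid (V \<odot> W) \<star> k') \<bullet> As' V W K = As' V W x \<bullet> (aid V \<star> (aid W \<star> k'))"
      using As'_natural[of "aid V" "aid W" k'] by simp
    have n2: "(aid V \<star> (k' \<star> aid W)) \<bullet> As V K W = As V x W \<bullet> ((aid V \<star> k') \<star> aid W)"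
      using As_natural[of "aid V" k' "aid W"] by simp
    have n3: "((k' \<star> aid V) \<star> aid W) \<bullet> As' K V W = As' x V W \<bullet> (k' \<star> aid (V \<odot> W))"
      using As'_natural[of k' "aid V" "aid W"] by simp
    have "(aid (V \<odot> W) \<star> k') \<bullet> As' V W K \<bullet> ?R = As' V W x \<bullet> (aid V \<star> ((aid W \<star> k') \<bullet> T W)) \<bullet> As V K W \<bullet> (T V \<star> aid W) \<bullet> As' K V W"
      by (simp add: pre2[OF n1] lwhisker acmp_assoc)
    also have "\<dots> = As' V W x \<bullet> (aid V \<star> SX W) \<bullet> ((aid V \<star> (k' \<star> aid W)) \<bullet> As V K W) \<bullet> (T V \<star> aid W) \<bullet> As' K V W"
      by (simp add: kT lwhisker acmp_assoc)
    also have "\<dots> = As' V W x \<bullet> (aid V \<star> SX W) \<bullet> As V x W \<bullet> (((aid V \<star> k') \<bullet> T V) \<star> aid W) \<bullet> As' K V W"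
      unfolding n2 by (simp add: rwhisker acmp_assoc)
    also have "\<dots> = As' V W x \<bullet> (aid V \<star> SX W) \<bullet> As V x W \<bullet> (SX V \<star> aid W) \<bullet> ((k' \<star> aid V) \<star> aid W) \<bullet> As' K V W"
      by (simp add: kT rwhisker acmp_assoc)
    also have "\<dots> = SX (V \<odot> W) \<bullet> (k' \<star> aid (V \<odot> W))"
      unfolding n3 using Sg_tens[OF o(1) hb(1) V W] by (simp add: SX_def acmp_assoc)
    finally have "(aid (V \<odot> W) \<star> k') \<bullet> T (V \<odot> W) = (aid (V \<odot> W) \<star> k') \<bullet> As' V W K \<bullet> ?R"
      by (simp add: kT)
    then show ?thesis by (rule cancelL) auto
  qed
  define \<sigma> where "\<sigma> = (\<lambda>V\<in>obj C. mor (T V))"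
  have \<sigma> [simp]: "V \<in> obj C \<Longrightarrow> \<sigma> V = mor (T V)" for V by (simp add: \<sigma>_def)
  have hbK: "half_braiding C K \<sigma>"
    unfolding half_braiding_def
  proof (intro conjI ballI)
    show "\<sigma> \<in> extensional (obj C)" by (simp add: \<sigma>_def)
    fix V assume V [simp]: "V \<in> obj C"
    show "is_iso C (K \<odot> V) (V \<odot> K) (\<sigma> V)"
      unfolding is_iso_def inverse_of_def
      using ar_mor[of "T V"] ar_mor[of "T' V"] arg_cong[OF TT(1)[OF V], of mor] arg_cong[OF TT(2)[OF V], of mor]
      by (auto intro!: exI[of _ "mor (T' V)"])
    fix W assume W [simp]: "W \<in> obj C"
    show "\<sigma> (V \<odot> W) = \<alpha>' V W K \<cdot> (\<one> V \<otimes> \<sigma> W) \<cdot> \<alpha> V K W \<cdot> (\<sigma> V \<otimes> \<one> W) \<cdot> \<alpha>' K V W"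
      using arg_cong[OF Ttens[OF V W], of mor] by simp
    fix g assume g: "g \<in> hom C V W"
    then show "\<sigma> W \<cdot> (\<one> K \<otimes> g) = (g \<otimes> \<one> K) \<cdot> \<sigma> V"
      using arg_cong[OF Tnat[of V W "Arr V g W"], of mor] by (simp add: par_Arr)
  next
    show "\<sigma> \<I> = \<one> K" using Tunit by simp
  qed
  let ?K = "(K, \<sigma>)"
  have Ko: "?K \<in> obj (center C)" using hbK by simp
  have SK: "Sg K \<sigma> V = T V" if "V \<in> obj C" for V
    using that T[OF that] by (simp add: Sg_def[OF K hbK] Arr_mor)
  have kc: "k \<in> hom (center C) ?K X"
    unfolding center_hom_arrow[OF Ko X] using kT SK kp
    by (auto simp: x_def[symmetric] SX_def[symmetric] k'_def[symmetric] par_def)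
  show ?thesis
  proof (intro exI[of _ ?K] exI[of _ k], unfold is_kernel_def, intro conjI ballI impI Ko kc)
    show "f \<cdot>\<^bsub>center C\<^esub> k = 0" using kh by simp
    fix Z g assume Z: "Z \<in> obj (center C)" and g: "g \<in> hom (center C) Z X" and fg: "f \<cdot>\<^bsub>center C\<^esub> g = 0"
    define z where "z = fst Z"
    define SZ where "SZ = Sg z (snd Z)"
    have z [simp]: "z \<in> obj C" and hz: "half_braiding C z (snd Z)" using Z by (auto simp: z_def)
    have gh: "g \<in> hom C z x" using g by (simp add: z_def x_def)
    define g' where "g' = Arr z g x"
    have g' [simp]: "ar g'" "dm g' = z" "cd g' = x" using gh by (auto simp: g'_def)
    have SZ [simp]: "ar (SZ V)" "dm (SZ V) = z \<odot> V" "cd (SZ V) = V \<odot> z" if "V \<in> obj C" for V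
      using Sg_simps[OF z hz that] Sg_dm_cd[OF z hz, of V] by (auto simp: SZ_def)
    have gc: "(aid V \<star> g') \<bullet> SZ V = SX V \<bullet> (g' \<star> aid V)" if "V \<in> obj C" for V
      using g that unfolding center_hom_arrow[OF Z X] g'_def SZ_def SX_def z_def x_def by blast
    define h' where "h' = r' \<bullet> g'"
    have h' [simp]: "ar h'" "dm h' = z" "cd h' = K" by (auto simp: h'_def)
    have "P \<bullet> g' = g'"
    proof (rule absorb(1)[where Z = z])
      show "par z x g'" by (auto simp: par_def)
      have "F \<bullet> g' = Arr z 0 y" using fg fh gh by (simp add: F_def g'_def acmp_def)
      then have "Q \<bullet> g' = s' \<bullet> Arr z 0 y" by (simp add: Q_def acmp_assoc)
      also have "\<dots> = Arr z 0 x" by (rule cmp_zero_arrow) (auto simp: par_def)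
      finally show "Q \<bullet> g' = Arr z 0 x" .
    qed
    then have kh': "k' \<bullet> h' = g'" by (simp add: P_def h'_def acmp_assoc)
    have "(aid V \<star> h') \<bullet> SZ V = T V \<bullet> (h' \<star> aid V)" if V [simp]: "V \<in> obj C" for V
    proof -
      have "(aid V \<star> k') \<bullet> (aid V \<star> h') \<bullet> SZ V = (aid V \<star> (k' \<bullet> h')) \<bullet> SZ V" by (simp add: lwhisker acmp_assoc)
      also have "\<dots> = SX V \<bullet> ((k' \<bullet> h') \<star> aid V)" unfolding kh' by (rule gc[OF V])
      also have "\<dots> = (aid V \<star> k') \<bullet> T V \<bullet> (h' \<star> aid V)" by (simp add: pre2[OF kT] rwhisker acmp_assoc)
      finally show ?thesis by (rule cancelL) auto
    qed
    moreover have "Arr z (mor h') K = h'" by (rule Arr_mor) auto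
    ultimately have hc: "mor h' \<in> hom (center C) Z ?K"
      unfolding center_hom_arrow[OF Z Ko] using SK by (auto simp: z_def[symmetric] SZ_def[symmetric] par_def)
    have kg: "k \<cdot> mor h' = g" using arg_cong[OF kh', of mor] by simp (simp add: k'_def g'_def)
    show "\<exists>!h. h \<in> hom (center C) Z ?K \<and> k \<cdot>\<^bsub>center C\<^esub> h = g"
    proof (rule ex1I[of _ "mor h'"])
      show "mor h' \<in> hom (center C) Z ?K \<and> k \<cdot>\<^bsub>center C\<^esub> mor h' = g" using hc kg by simp
      fix u assume "u \<in> hom (center C) Z ?K \<and> k \<cdot>\<^bsub>center C\<^esub> u = g"
      then have "u \<in> hom C z K" "k \<cdot> u = k \<cdot> mor h'" using kg by (simp_all add: z_def)
      then show "u = mor h'" using kmono z hc unfolding monic_def by (auto simp: z_def)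
    qed
  qed
qed

lemma center_schur_category:
  assumes "linear_category (center C)" shows "schur_category (center C)"
proof (intro schur_category.intro schur_category_axioms.intro assms)
  show "\<exists>K k. is_kernel (center C) X Y f K k" if "X \<in> obj (center C)" "Y \<in> obj (center C)" "f \<in> hom (center C) X Y" for X Y f
    using center_kernel[OF that] .
  show "\<exists>B. finite B \<and> hom (center C) X Y \<subseteq> module.span (scl (center C)) B"
    if XY: "X \<in> obj (center C)" "Y \<in> obj (center C)" for X Y
  proof -
    obtain B where B: "finite B" "hom C (fst X) (fst Y) \<subseteq> vs.span B"
      using hom_finite_dim[of "fst X" "fst Y"] XY by auto
    moreover have "hom (center C) X Y \<subseteq> hom C (fst X) (fst Y)" by auto
    ultimately have "finite B \<and> hom (center C) X Y \<subseteq> module.span (scl (center C)) B" by auto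
    then show ?thesis by blast
  qed
qed

text \<open>The average of any endomorphism \<open>w\<close> of the underlying object is central, hence a scalar \<open>c\<close>, and
  its trace gives \<open>c \<cdot> d X = gdim \<cdot> tr w\<close>. By nondegeneracy of the trace form some \<open>w\<close> has nonzero trace.\<close>

lemma center_qdim_nonzero:
  assumes lin: "linear_category (center C)" and X: "simple (center C) X"
  shows "qdim (center C) X \<noteq> 0"
proof -
  interpret D: schur_category "center C" using center_schur_category[OF lin] .
  let ?x = "fst X"
  have Xo: "X \<in> obj (center C)" using X D.simple_obj by blast
  then have o: "?x \<in> obj C" and hb: "half_braiding C ?x (snd X)" by auto
  have "\<one> ?x \<noteq> 0" using D.simple_nonzero[OF X] by simp
  then have "aid ?x \<noteq> Arr ?x 0 ?x" by (simp add: aid_def)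
  then obtain w where w: "par ?x ?x w" "tr (w \<bullet> aid ?x) \<noteq> tr (w \<bullet> Arr ?x 0 ?x)"
    using trace_nondegenerate[of ?x ?x "aid ?x" "Arr ?x 0 ?x"] o by (auto simp: par_Arr hom_zero)
  have "w \<bullet> Arr ?x 0 ?x = Arr ?x 0 ?x" using cmp_zero_arrow[OF w(1) o] .
  moreover have "tr (Arr ?x 0 ?x) = 0" using tr_LC[of ?x "{}" "\<lambda>_. aid ?x" "\<lambda>_. 0"] o by (simp add: LC_def)
  ultimately have trw: "tr w \<noteq> 0" using w parD[OF w(1)] by simp
  define a where "a = avg ?x (snd X) w"
  have a: "par ?x ?x a" unfolding a_def by (rule avg_par[OF o hb w(1)])
  have aA: "Arr ?x (mor a) ?x = a" using parD[OF a] by (intro Arr_mor) auto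
  have "mor a \<in> hom (center C) X X"
    unfolding center_hom_arrow[OF Xo Xo] aA using a avg_central[OF o hb w(1)] by (auto simp: a_def)
  then obtain c where "mor a = scl C c (\<one> ?x)" using D.schur_scalar[OF X] by (metis center_simps(3,4))
  then have "a = sA c (aid ?x)" using a o by (intro par_eqI[of ?x ?x]) (auto simp: mor_sA)
  then have "c * d ?x = gdim * tr w" using tr_avg[OF o hb w(1)] o by (simp add: a_def[symmetric] tr_sA[of ?x])
  then have "d ?x \<noteq> 0" using gdim_nonzero trw by auto
  then show ?thesis by (simp add: d_qdim qdim_def ptr_center)
qed

end

section \<open>Canonical isomorphisms and the operator E\<close>

context closed_spherical_fusion_category
begin

lemma is_iso_hom: "is_iso C X Y f \<Longrightarrow> f \<in> hom C X Y"
  by (simp add: is_iso_def)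

text \<open>The operator \<open>E\<close> contains inverses of regrouping and duality morphisms. That these morphisms are
  isomorphisms is what makes \<open>E\<close> well typed.\<close>

lemma is_iso_minv: "X \<in> obj C \<Longrightarrow> Y \<in> obj C \<Longrightarrow> is_iso C X Y f \<Longrightarrow> is_iso C Y X (minv C X Y f)"
  using minv_inverse[of X Y f] is_iso_sym[of X Y f] is_iso_hom by blast

lemma is_iso_arrow:
  assumes "ar f" "ar g" "dm f = X" "cd f = Y" "dm g = Y" "cd g = X" "g \<bullet> f = aid X" "f \<bullet> g = aid Y"
  shows "is_iso C X Y (mor f)"
proof -
  have "mor g \<cdot> mor f = mor (g \<bullet> f)" "mor f \<cdot> mor g = mor (f \<bullet> g)" using assms(1-6) by simp_all
  then have "mor g \<cdot> mor f = \<one> X" "mor f \<cdot> mor g = \<one> Y" using assms(7,8) by simp_all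
  then show ?thesis
    using ar_mor[of f] ar_mor[of g] assms(1-6) unfolding is_iso_def inverse_of_def by auto
qed

lemma arrow_inverse:
  assumes "X \<in> obj C" "Y \<in> obj C" "is_iso C X Y f"
  obtains g where "ar (Arr X f Y)" "ar (Arr Y g X)" "Arr Y g X \<bullet> Arr X f Y = aid X" "Arr X f Y \<bullet> Arr Y g X = aid Y"
  using assms that unfolding is_iso_def inverse_of_def by (force simp: acmp_def aid_def)

lemma is_iso_ten:
  assumes o: "X \<in> obj C" "Y \<in> obj C" "X' \<in> obj C" "Y' \<in> obj C" and f: "is_iso C X Y f" and g: "is_iso C X' Y' g"
  shows "is_iso C (X \<odot> X') (Y \<odot> Y') (f \<otimes> g)"
proof -
  obtain f' where f': "ar (Arr X f Y)" "ar (Arr Y f' X)" "Arr Y f' X \<bullet> Arr X f Y = aid X" "Arr X f Y \<bullet> Arr Y f' X = aid Y"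
    using arrow_inverse[OF o(1,2) f] .
  obtain g' where g': "ar (Arr X' g Y')" "ar (Arr Y' g' X')" "Arr Y' g' X' \<bullet> Arr X' g Y' = aid X'" "Arr X' g Y' \<bullet> Arr Y' g' X' = aid Y'"
    using arrow_inverse[OF o(3,4) g] .
  have "is_iso C (X \<odot> X') (Y \<odot> Y') (mor (Arr X f Y \<star> Arr X' g Y'))"
    using o f' g' by (intro is_iso_arrow[of _ "Arr Y f' X \<star> Arr Y' g' X'"]) (simp_all add: interchange[symmetric])
  then show ?thesis using f' g' by simp
qed

lemma npow_obj [simp]: "V \<in> obj C \<Longrightarrow> npow C V n \<in> obj C"
  by (induction n) auto

lemma vpow_obj [simp]: "V \<in> obj C \<Longrightarrow> vpow C V m \<in> obj C"
  by (simp add: vpow_def)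

lemma npow_merge_iso:
  "V \<in> obj C \<Longrightarrow> is_iso C (npow C V a \<odot> npow C V b) (npow C V (a + b)) (npow_merge C V a b)"
proof (induction a)
  case 0
  then show ?case by (simp add: is_iso_idn)
next
  case (Suc a)
  have "is_iso C (V \<odot> (npow C V a \<odot> npow C V b)) (V \<odot> npow C V (a + b)) (\<one> V \<otimes> npow_merge C V a b)"
    using Suc by (intro is_iso_ten is_iso_idn) auto
  then show ?case using Suc.prems
    by (auto intro!: is_iso_cmp[where Y = "V \<odot> (npow C V a \<odot> npow C V b)"] assoc_iso)
qed

lemma npow_regroup_iso:
  assumes V: "V \<in> obj C"
  shows "is_iso C (npow C V a \<odot> npow C V b) (npow C V b \<odot> npow C V a) (npow_regroup C V a b)"
proof -
  have "is_iso C (npow C V (b + a)) (npow C V b \<odot> npow C V a)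
      (minv C (npow C V b \<odot> npow C V a) (npow C V (b + a)) (npow_merge C V b a))"
    using V by (intro is_iso_minv npow_merge_iso) auto
  moreover have "is_iso C (npow C V a \<odot> npow C V b) (npow C V (b + a)) (npow_merge C V a b)"
    using npow_merge_iso[OF V, of a b] by (simp add: add.commute)
  ultimately show ?thesis unfolding npow_regroup_def using V by (intro is_iso_cmp) auto
qed

lemma vpow_nonneg: "m \<ge> 0 \<Longrightarrow> vpow C V m = npow C V (nat m)"
  and vpow_nonpos: "m \<le> 0 \<Longrightarrow> vpow C V m = npow C (dl V) (nat (- m))"
  by (auto simp: vpow_def)

lemma vpow_regroup_iso:
  assumes V: "V \<in> obj C" and ij: "0 \<le> i \<and> 0 \<le> j \<or> i \<le> 0 \<and> j \<le> 0"
  shows "is_iso C (vpow C V i \<odot> vpow C V j) (vpow C V j \<odot> vpow C V i) (vpow_regroup C V i j)"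
proof (cases "0 \<le> i \<and> 0 \<le> j")
  case True
  then show ?thesis using npow_regroup_iso[OF V, of "nat i" "nat j"] by (simp add: vpow_regroup_def vpow_nonneg)
next
  case False
  then have "i \<le> 0" "j \<le> 0" using ij by auto
  moreover have "vpow_regroup C V i j = npow_regroup C (dl V) (nat (- i)) (nat (- j))"
    using False by (auto simp: vpow_regroup_def)
  ultimately show ?thesis using npow_regroup_iso[of "dl V" "nat (- i)" "nat (- j)"] V by (simp add: vpow_nonpos)
qed

lemma db_unit_iso: "is_iso C \<I> (dl \<I>) (db C \<I>)"
proof -
  have "EV \<I> \<bullet> DB \<I> = aid \<I>" using zigzag_arrow(1)[of \<I>] by simp
  moreover have "DB \<I> \<bullet> EV \<I> = aid (dl \<I>)"
    using zigzag_arrow(2)[of \<I>] slide[of "EV \<I>" "DB \<I>" "dl \<I>" \<I> \<I> "dl \<I>"] by simp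
  ultimately show ?thesis using is_iso_arrow[of "DB \<I>" "EV \<I>" \<I> "dl \<I>"] by simp
qed

lemma dual_tens_iso: "X \<in> obj C \<Longrightarrow> Y \<in> obj C \<Longrightarrow> is_iso C (dl Y \<odot> dl X) (dl (X \<odot> Y)) (dual_tens C X Y)"
  using is_iso_arrow[of "\<theta> X Y" "\<theta>' X Y" "dl Y \<odot> dl X" "dl (X \<odot> Y)"] by simp

lemma npow_dual_iso: "V \<in> obj C \<Longrightarrow> is_iso C (npow C (dl V) n) (dl (npow C V n)) (npow_dual C V n)"
proof (induction n)
  case 0
  then show ?case by (simp add: db_unit_iso)
next
  case (Suc n)
  let ?D = "dl V" and ?W = "npow C V n" and ?N = "npow C (dl V) n"
  have 1: "is_iso C (?D \<odot> ?N) (?N \<odot> ?D) (npow_regroup C ?D 1 n)"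
    using npow_regroup_iso[of ?D 1 n] Suc.prems by simp
  have 2: "is_iso C (?N \<odot> ?D) (dl ?W \<odot> ?D) (npow_dual C V n \<otimes> \<one> ?D)"
    using Suc by (intro is_iso_ten is_iso_idn) auto
  have 3: "is_iso C (dl ?W \<odot> ?D) (dl (V \<odot> ?W)) (dual_tens C V ?W)"
    using Suc.prems by (intro dual_tens_iso) auto
  show ?case using is_iso_cmp[OF _ _ _ is_iso_cmp[OF _ _ _ 1 2] 3] Suc.prems by simp
qed

lemma npowm_iso: "V \<in> obj C \<Longrightarrow> W \<in> obj C \<Longrightarrow> is_iso C V W f \<Longrightarrow> is_iso C (npow C V n) (npow C W n) (npowm C f n)"
  by (induction n) (auto intro: is_iso_idn is_iso_ten)

lemma vpow_dual_iso:
  assumes V: "V \<in> obj C" shows "is_iso C (vpow C V (- m)) (dl (vpow C V m)) (vpow_dual C V m)"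
proof (cases "m \<ge> 0")
  case True
  then show ?thesis using npow_dual_iso[OF V, of "nat m"] vpow_nonneg[of m V] vpow_nonpos[of "- m" V] by (simp add: vpow_dual_def)
next
  case False
  let ?n = "nat (- m)"
  have "is_iso C (npow C V ?n) (npow C (dl (dl V)) ?n) (npowm C (piv C V) ?n)"
    using V piv_iso by (intro npowm_iso) auto
  moreover have "is_iso C (npow C (dl (dl V)) ?n) (dl (npow C (dl V) ?n)) (npow_dual C (dl V) ?n)"
    using V by (intro npow_dual_iso) auto
  ultimately have "is_iso C (npow C V ?n) (dl (npow C (dl V) ?n)) (npow_dual C (dl V) ?n \<cdot> npowm C (piv C V) ?n)"
    using V by (intro is_iso_cmp) auto
  then show ?thesis using False by (simp add: vpow_dual_def vpow_def)
qed

lemma ev_pow_hom: "V \<in> obj C \<Longrightarrow> ev_pow C V m \<in> hom C (vpow C V (- m) \<odot> vpow C V m) \<I>"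
  unfolding ev_pow_def
  by (intro cmp_hom[where Y = "dl (vpow C V m) \<odot> vpow C V m"] ev_hom tensm_hom idn_hom is_iso_hom vpow_dual_iso) auto

lemma db_pow_hom: "V \<in> obj C \<Longrightarrow> db_pow C V m \<in> hom C \<I> (vpow C V m \<odot> vpow C V (- m))"
  unfolding db_pow_def
  by (intro cmp_hom[where Y = "vpow C V m \<odot> dl (vpow C V m)"] db_hom tensm_hom idn_hom is_iso_hom is_iso_minv vpow_dual_iso) auto

lemma J_map_hom:
  assumes V: "V \<in> obj C"
  shows "J_map C V m l \<in> hom C ((vpow C V (- l) \<odot> vpow C V m) \<odot> vpow C V l) (vpow C V m)"
proof -
  let ?P = "vpow C V m" and ?Q = "vpow C V l" and ?Q' = "vpow C V (- l)"
  have o: "?P \<in> obj C" "?Q \<in> obj C" "?Q' \<in> obj C" using V by auto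
  have e: "par (?Q' \<odot> ?Q) \<I> (Arr (?Q' \<odot> ?Q) (ev_pow C V l) \<I>)" using V ev_pow_hom[of V l] by (simp add: par_Arr)
  note e' = parD[OF e]
  show ?thesis
  proof (cases "m * l \<ge> 0")
    case True
    then have "is_iso C (?P \<odot> ?Q) (?Q \<odot> ?P) (vpow_regroup C V m l)"
      using V by (intro vpow_regroup_iso) (auto simp: zero_le_mult_iff)
    then have "par (?P \<odot> ?Q) (?Q \<odot> ?P) (Arr (?P \<odot> ?Q) (vpow_regroup C V m l) (?Q \<odot> ?P))"
      using o is_iso_hom by (simp add: par_Arr)
    note r' = parD[OF this]
    have "par ((?Q' \<odot> ?P) \<odot> ?Q) ?P ((Arr (?Q' \<odot> ?Q) (ev_pow C V l) \<I> \<star> aid ?P) \<bullet> As' ?Q' ?Q ?P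
        \<bullet> (aid ?Q' \<star> Arr (?P \<odot> ?Q) (vpow_regroup C V m l) (?Q \<odot> ?P)) \<bullet> As ?Q' ?P ?Q)"
      using o e' r' by (auto simp: par_def simp del: ar_Arr)
    from parD(6)[OF this] show ?thesis using True o e' r' by (simp add: J_map_def Let_def del: ar_Arr)
  next
    case False
    then have "is_iso C (?Q' \<odot> ?P) (?P \<odot> ?Q') (vpow_regroup C V (- l) m)"
      using V by (intro vpow_regroup_iso) (auto simp: zero_le_mult_iff)
    then have "par (?Q' \<odot> ?P) (?P \<odot> ?Q') (Arr (?Q' \<odot> ?P) (vpow_regroup C V (- l) m) (?P \<odot> ?Q'))"
      using o is_iso_hom by (simp add: par_Arr)
    note r' = parD[OF this]
    have "par ((?Q' \<odot> ?P) \<odot> ?Q) ?P ((aid ?P \<star> Arr (?Q' \<odot> ?Q) (ev_pow C V l) \<I>) \<bullet> As ?P ?Q' ?Q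
        \<bullet> (Arr (?Q' \<odot> ?P) (vpow_regroup C V (- l) m) (?P \<odot> ?Q') \<star> aid ?Q))"
      using o e' r' by (auto simp: par_def simp del: ar_Arr)
    from parD(6)[OF this] show ?thesis using False o e' r' by (simp add: J_map_def Let_def del: ar_Arr)
  qed
qed

lemma E_map_arrow:
  fixes m l :: int
  assumes V: "V \<in> obj C" and X: "X \<in> obj (center C)" and f: "par (fst X) (vpow C V m) f"
  defines "Q \<equiv> vpow C V l" and "Q' \<equiv> vpow C V (- l)"
  defines "E \<equiv> Arr ((Q' \<odot> vpow C V m) \<odot> Q) (J_map C V m l) (vpow C V m)
    \<bullet> ((aid Q' \<star> f) \<star> aid Q) \<bullet> (Sg (fst X) (snd X) Q' \<star> aid Q) \<bullet> As' (fst X) Q' Q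
    \<bullet> (aid (fst X) \<star> Arr \<I> (db_pow C V (- l)) (Q' \<odot> Q))"
  shows "par (fst X) (vpow C V m) E" and "mor E = E_map C X V m l (mor f)"
proof -
  let ?x = "fst X" and ?P = "vpow C V m"
  have o: "?x \<in> obj C" and hb: "half_braiding C ?x (snd X)" using X by auto
  have q: "Q \<in> obj C" "Q' \<in> obj C" "?P \<in> obj C" using V by (auto simp: Q_def Q'_def)
  note S = Sg_simps(1)[OF o hb q(2)] Sg_dm_cd(1,2,3)[OF o hb]
  have J: "ar (Arr ((Q' \<odot> ?P) \<odot> Q) (J_map C V m l) ?P)" using J_map_hom[OF V, of m l] q by (simp add: Q_def Q'_def)
  have D: "ar (Arr \<I> (db_pow C V (- l)) (Q' \<odot> Q))" using db_pow_hom[OF V, of "- l"] q by (simp add: Q_def Q'_def)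
  note f' = parD[OF f]
  show "par ?x ?P E" unfolding E_def using o q S J D f' by (auto simp: par_def simp del: ar_Arr)
  show "mor E = E_map C X V m l (mor f)"
    unfolding E_def using o q S J D f' by (simp add: E_map_def Let_def Q_def[symmetric] Q'_def[symmetric] del: ar_Arr)
qed

text \<open>A central morphism \<open>u\<close> passes through the half braiding in \<open>E\<close>, and everything else in \<open>E\<close>
  acts on strands that do not meet \<open>u\<close>.\<close>

lemma E_map_natural:
  assumes V: "V \<in> obj C" and X: "X \<in> obj (center C)" and Y: "Y \<in> obj (center C)"
    and u: "u \<in> hom (center C) X Y" and f: "f \<in> hom C (fst Y) (vpow C V m)"
  shows "E_map C X V m l (f \<cdot> u) = E_map C Y V m l f \<cdot> u"
proof -
  let ?x = "fst X" and ?y = "fst Y" and ?P = "vpow C V m" and ?Q = "vpow C V l" and ?Q' = "vpow C V (- l)"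
  have o: "?x \<in> obj C" "?y \<in> obj C" and hb: "half_braiding C ?x (snd X)" "half_braiding C ?y (snd Y)" using X Y by auto
  have q: "?Q \<in> obj C" "?Q' \<in> obj C" "?P \<in> obj C" using V by auto
  define U where "U = Arr ?x u ?y"
  define F where "F = Arr ?y f ?P"
  define J where "J = Arr ((?Q' \<odot> ?P) \<odot> ?Q) (J_map C V m l) ?P"
  define D where "D = Arr \<I> (db_pow C V (- l)) (?Q' \<odot> ?Q)"
  define SX where "SX = Sg ?x (snd X) ?Q'"
  define SY where "SY = Sg ?y (snd Y) ?Q'"
  have U: "par ?x ?y U" and Uc: "(aid ?Q' \<star> U) \<bullet> SX = SY \<bullet> (U \<star> aid ?Q')"
    using u q(2) unfolding center_hom_arrow[OF X Y] U_def SX_def SY_def by auto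
  have F: "par ?y ?P F" using f o q by (simp add: F_def par_Arr)
  note U' [simp] = parD(1-3)[OF U] and F' [simp] = parD(1-3)[OF F] and o [simp] and q [simp]
  have J [simp]: "ar J" "dm J = (?Q' \<odot> ?P) \<odot> ?Q" "cd J = ?P" using J_map_hom[OF V, of m l] by (auto simp: J_def)
  have D [simp]: "ar D" "dm D = \<I>" "cd D = ?Q' \<odot> ?Q" using db_pow_hom[OF V, of "- l"] by (auto simp: D_def)
  have S [simp]: "ar SX" "dm SX = ?x \<odot> ?Q'" "cd SX = ?Q' \<odot> ?x" "ar SY" "dm SY = ?y \<odot> ?Q'" "cd SY = ?Q' \<odot> ?y"
    using Sg_simps(1)[OF o(1) hb(1) q(2)] Sg_simps(1)[OF o(2) hb(2) q(2)] Sg_dm_cd(1,2)[OF o(1) hb(1)] Sg_dm_cd(1,2)[OF o(2) hb(2)]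
    by (auto simp: SX_def SY_def)
  have EX: "mor (J \<bullet> ((aid ?Q' \<star> (F \<bullet> U)) \<star> aid ?Q) \<bullet> (SX \<star> aid ?Q) \<bullet> As' ?x ?Q' ?Q \<bullet> (aid ?x \<star> D)) = E_map C X V m l (f \<cdot> u)"
    using E_map_arrow(2)[OF V X par_cmp[OF U F], where l = l] unfolding J_def SX_def D_def
    by (simp del: ar_Arr) (simp add: F_def U_def)
  define EY where "EY = J \<bullet> ((aid ?Q' \<star> F) \<star> aid ?Q) \<bullet> (SY \<star> aid ?Q) \<bullet> As' ?y ?Q' ?Q \<bullet> (aid ?y \<star> D)"
  have EYp: "par ?y ?P EY" and EYm: "mor EY = E_map C Y V m l f"
    using E_map_arrow[OF V Y F, where l = l] unfolding EY_def J_def SY_def D_def by (auto simp: F_def simp del: ar_Arr)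
  have n1: "((U \<star> aid ?Q') \<star> aid ?Q) \<bullet> As' ?x ?Q' ?Q = As' ?y ?Q' ?Q \<bullet> (U \<star> aid (?Q' \<odot> ?Q))"
    using As'_natural[of U "aid ?Q'" "aid ?Q"] by simp
  have n2: "(U \<star> aid (?Q' \<odot> ?Q)) \<bullet> (aid ?x \<star> D) = (aid ?y \<star> D) \<bullet> U"
    using slide[of U D ?x ?y \<I> "?Q' \<odot> ?Q"] by simp
  have "J \<bullet> ((aid ?Q' \<star> (F \<bullet> U)) \<star> aid ?Q) \<bullet> (SX \<star> aid ?Q) \<bullet> As' ?x ?Q' ?Q \<bullet> (aid ?x \<star> D)
      = J \<bullet> ((aid ?Q' \<star> F) \<star> aid ?Q) \<bullet> (((aid ?Q' \<star> U) \<bullet> SX) \<star> aid ?Q) \<bullet> As' ?x ?Q' ?Q \<bullet> (aid ?x \<star> D)"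
    by (simp add: lwhisker rwhisker acmp_assoc)
  also have "\<dots> = J \<bullet> ((aid ?Q' \<star> F) \<star> aid ?Q) \<bullet> (SY \<star> aid ?Q) \<bullet> (((U \<star> aid ?Q') \<star> aid ?Q) \<bullet> As' ?x ?Q' ?Q) \<bullet> (aid ?x \<star> D)"
    unfolding Uc by (simp add: rwhisker acmp_assoc)
  also have "\<dots> = EY \<bullet> U" unfolding n1 EY_def by (simp add: n2 acmp_assoc)
  finally have "E_map C X V m l (f \<cdot> u) = mor (EY \<bullet> U)" using EX by simp
  then show ?thesis using parD(1-3)[OF EYp] by (simp add: EYm) (simp add: U_def)
qed

lemma E_map_hom:
  assumes "V \<in> obj C" "X \<in> obj (center C)" "f \<in> hom C (fst X) (vpow C V m)"
  shows "E_map C X V m l f \<in> hom C (fst X) (vpow C V m)"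
  using E_map_arrow[OF assms(1,2), of m "Arr (fst X) f (vpow C V m)" l] parD(6) assms
  by (fastforce simp: par_Arr)

lemma ptr_sum_cyclic:
  assumes A: "A \<in> obj C" and I: "\<And>i. i \<in> I \<Longrightarrow> S i \<in> obj C" "\<And>i. i \<in> I \<Longrightarrow> f i \<in> hom C (S i) A" "\<And>i. i \<in> I \<Longrightarrow> g i \<in> hom C A (S i)"
    and c: "\<And>i. i \<in> I \<Longrightarrow> g i \<cdot> f i = scl C (c i) (\<one> (S i))"
  shows "ptr C A (\<Sum>i\<in>I. f i \<cdot> g i) = (\<Sum>i\<in>I. c i * qdim C (S i))"
proof -
  define F where "F = (\<lambda>i. Arr (S i) (f i) A)"
  define G where "G = (\<lambda>i. Arr A (g i) (S i))"
  have FG: "par (S i) A (F i)" "par A (S i) (G i)" if "i \<in> I" for i using that A I by (auto simp: F_def G_def par_Arr)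
  have m: "mor (F i \<bullet> G i) = f i \<cdot> g i" "mor (G i \<bullet> F i) = g i \<cdot> f i" if "i \<in> I" for i
    using parD[OF FG(1)[OF that]] parD[OF FG(2)[OF that]] by (auto simp: F_def G_def)
  have "(\<Sum>i\<in>I. f i \<cdot> g i) = mor (LC A A I (\<lambda>_. 1) (\<lambda>i. F i \<bullet> G i))"
    using m by (simp add: LC_def)
  then have "ptr C A (\<Sum>i\<in>I. f i \<cdot> g i) = tr (LC A A I (\<lambda>_. 1) (\<lambda>i. F i \<bullet> G i))"
    by (simp add: tr_def) (simp add: LC_def)
  also have "\<dots> = (\<Sum>i\<in>I. tr (F i \<bullet> G i))"
    using tr_LC[OF A, of I "\<lambda>i. F i \<bullet> G i" "\<lambda>_. 1"] par_cmp[OF FG(2,1)] by simp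
  also have "\<dots> = (\<Sum>i\<in>I. c i * qdim C (S i))"
  proof (rule sum.cong[OF refl])
    fix i assume i: "i \<in> I"
    have "G i \<bullet> F i = sA (c i) (aid (S i))"
      using par_cmp[OF FG(1)[OF i] FG(2)[OF i]] c[OF i] m[OF i] I(1)[OF i] by (intro par_eqI[of "S i" "S i"]) (auto simp: mor_sA)
    then show "tr (F i \<bullet> G i) = c i * qdim C (S i)"
      using tr_cyclic[OF FG(1)[OF i] FG(2)[OF i]] I(1)[OF i] by (simp add: tr_sA[of "S i"] d_qdim)
  qed
  finally show ?thesis .
qed

text \<open>In the basis \<open>\<psi> \<iota> i \<phi> i\<close> of \<open>C(X, V\<^sup>m)\<close>, where \<open>\<iota> i \<phi> i : X \<rightarrow> K(V\<^sup>m)\<close> runs over the summands isomorphic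
  to \<open>X\<close>, the diagonal entry of \<open>E\<close> is the scalar \<open>c i\<close> by which \<open>\<pi> i \<kappa> \<iota> i\<close> acts; the trace of \<open>\<kappa> z\<close> is
  the sum of the \<open>c i\<close>, each multiplied by \<open>d X\<close>.\<close>

lemma fs_indicator_center_trace:
  fixes K :: "'o \<Rightarrow> 'o \<times> ('o \<Rightarrow> 'm)" and Km :: "'o \<Rightarrow> 'o \<Rightarrow> 'm \<Rightarrow> 'm"
    and \<Psi> :: "'o \<times> ('o \<Rightarrow> 'm) \<Rightarrow> 'o \<Rightarrow> 'm \<Rightarrow> 'm"
    and \<X> :: "'o \<times> ('o \<Rightarrow> 'm)" and V :: 'o and m l :: int and z :: 'm
  assumes "two_sided_adjoint_of_forgetful C K Km \<Psi>"
    and "simple (center C) \<X>"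
    and "V \<in> obj C"
    and "isotypic_projection (center C) \<X> (K (vpow C V m)) z"
  shows "fs_indicator C \<X> V m l =
    1 / qdim (center C) \<X> * ptr (center C) (K (vpow C V m)) (cmp (center C) (kappa C K \<Psi> V m l) z)"
proof -
  have adj: "adjunction (center C) C fst (\<lambda>_ _ f. f) K Km \<Psi>"
    using assms(1) by (simp add: two_sided_adjoint_of_forgetful_def)
  then have lin: "linear_category (center C)"
    by (simp add: adjunction_def category_functor_def)
  interpret D: schur_category "center C" using center_schur_category[OF lin] .
  interpret adj: adjunction "center C" C fst "\<lambda>_ _ f. f" K Km \<Psi> by (rule adj)
  let ?W = "vpow C V m" and ?D = "center C"
  define A where "A = K ?W"
  note V = assms(3)
  have W: "?W \<in> obj C" using V by simp
  have X: "\<X> \<in> obj ?D" using assms(2) D.simple_obj by blast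
  have A: "A \<in> obj ?D" unfolding A_def using W by (rule adj.G.F_obj)
  define a where "a = fst A"
  have a: "a \<in> obj C" using A by (simp add: a_def)
  define \<psi> where "\<psi> = \<Psi> A ?W (idn ?D A)"
  have bij: "bij_betw (\<Psi> Y ?W) (hom ?D Y A) (hom C (fst Y) ?W)" if "Y \<in> obj ?D" for Y
    unfolding A_def using adj.adj_bij[OF that W] .
  have \<psi>: "\<psi> \<in> hom C a ?W"
    unfolding \<psi>_def a_def using bij[OF A] D.idn_hom[OF A] by (rule bij_betwE[THEN bspec])
  \<comment> \<open>Naturality of the adjunction: \<open>\<psi>\<close> is the universal morphism \<open>K(V\<^sup>m) \<rightarrow> V\<^sup>m\<close>.\<close>
  have \<Psi>: "\<Psi> Y ?W u = \<psi> \<cdot> u" if Y: "Y \<in> obj ?D" and u: "u \<in> hom ?D Y A" for Y u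
  proof -
    have "\<Psi> Y ?W (cmp ?D (Km ?W ?W (\<one> ?W)) (cmp ?D (idn ?D A) u)) = \<one> ?W \<cdot> (\<psi> \<cdot> u)"
      unfolding \<psi>_def using adj.adj_natural[OF A Y W W, of "idn ?D A" u "\<one> ?W"] D.idn_hom[OF A] idn_hom[OF W] u
      unfolding A_def by simp
    moreover have "Km ?W ?W (\<one> ?W) = idn ?D A" unfolding A_def by (rule adj.G.Fm_idn[OF W])
    moreover have "cmp ?D (idn ?D A) u = u" using D.idn_cmp[OF Y A u] .
    moreover have "\<psi> \<cdot> u \<in> hom C (fst Y) ?W" using cmp_hom[of "fst Y" a ?W u \<psi>] u Y \<psi> a W by (simp add: a_def)
    ultimately show ?thesis using idn_cmp[of "fst Y" ?W "\<psi> \<cdot> u"] Y W by simp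
  qed
  define \<kappa> where "\<kappa> = kappa C K \<Psi> V m l"
  have E\<psi>: "E_map C A V m l \<psi> \<in> hom C a ?W"
    unfolding a_def by (rule E_map_hom[OF V A \<psi>[unfolded a_def]])
  have "\<kappa> = inv_into (hom ?D A A) (\<Psi> A ?W) (E_map C A V m l \<psi>)"
    unfolding \<kappa>_def kappa_def Let_def A_def \<psi>_def ..
  then have \<kappa>: "\<kappa> \<in> hom ?D A A" and "\<Psi> A ?W \<kappa> = E_map C A V m l \<psi>"
    using bij[OF A] E\<psi> unfolding a_def
    by (auto simp: bij_betw_def simp del: center_simps intro: inv_into_into f_inv_into_f)
  then have \<kappa>\<psi>: "\<psi> \<cdot> \<kappa> = E_map C A V m l \<psi>" using \<Psi>[OF A] by simp
  \<comment> \<open>Under the adjunction, \<open>E\<close> becomes composition with \<open>\<kappa>\<close>.\<close>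
  have E\<Psi>: "E_map C \<X> V m l (\<Psi> \<X> ?W u) = \<Psi> \<X> ?W (\<kappa> \<cdot> u)" if u: "u \<in> hom ?D \<X> A" for u
  proof -
    have \<kappa>u: "\<kappa> \<cdot> u \<in> hom ?D \<X> A" using D.cmp_hom[OF X A A u \<kappa>] by simp
    have "E_map C \<X> V m l (\<psi> \<cdot> u) = (\<psi> \<cdot> \<kappa>) \<cdot> u"
      unfolding \<kappa>\<psi> by (rule E_map_natural[OF V X A u \<psi>[unfolded a_def]])
    also have "\<dots> = \<psi> \<cdot> (\<kappa> \<cdot> u)"
      using cmp_assoc[of "fst \<X>" a a ?W u \<kappa> \<psi>] X a W u \<kappa> \<psi> by (simp add: a_def)
    finally show ?thesis using \<Psi>[OF X u] \<Psi>[OF X \<kappa>u] by simp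
  qed
  obtain n S \<iota> \<pi> where dec: "direct_sum ?D n S \<iota> \<pi> A" and S: "\<forall>i<n. simple ?D (S i)"
    and z: "z = (\<Sum>i | i < n \<and> isomorphic ?D (S i) \<X>. \<iota> i \<cdot> \<pi> i)"
    using assms(4) unfolding isotypic_projection_def A_def by auto
  note ds = D.direct_sum_parts[OF dec]
  define I where "I = {i. i < n \<and> isomorphic ?D (S i) \<X>}"
  have In: "\<And>i. i \<in> I \<Longrightarrow> i < n" by (auto simp: I_def)
  obtain \<phi> \<zeta> where \<phi>: "\<And>i. i \<in> I \<Longrightarrow> is_iso ?D \<X> (S i) (\<phi> i)"
    and \<zeta>: "\<And>u i. u \<in> hom ?D \<X> A \<Longrightarrow> i \<in> I \<Longrightarrow> \<pi> i \<cdot> u = scl C (\<zeta> i u) (\<phi> i)"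
    and sum: "\<And>u. u \<in> hom ?D \<X> A \<Longrightarrow> u = (\<Sum>i\<in>I. scl C (\<zeta> i u) (\<iota> i \<cdot> \<phi> i))"
    and \<zeta>_eq: "\<And>i u c. i \<in> I \<Longrightarrow> u \<in> hom ?D \<X> A \<Longrightarrow> \<pi> i \<cdot> u = scl C c (\<phi> i) \<Longrightarrow> \<zeta> i u = c"
    using D.isotypic_coordinates[OF assms(2) dec _ I_def] S unfolding center_simps(2,4) by blast
  have \<phi>h: "\<phi> i \<in> hom ?D \<X> (S i)" if "i \<in> I" for i using \<phi>[OF that] by (simp add: is_iso_def del: center_simps)
  have \<iota>\<phi>: "\<iota> i \<cdot> \<phi> i \<in> hom ?D \<X> A" if "i \<in> I" for i
    using D.cmp_hom[OF X ds(2)[OF In[OF that]] A \<phi>h[OF that] ds(3)[OF In[OF that]]] by simp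
  have "\<exists>c. \<pi> i \<cdot> \<kappa> \<cdot> \<iota> i = scl C c (\<one> (fst (S i)))" if i: "i \<in> I" for i
  proof -
    note di = ds(2-4)[OF In[OF i]]
    have "\<pi> i \<cdot> \<kappa> \<cdot> \<iota> i \<in> hom ?D (S i) (S i)"
      using D.cmp_hom[OF di(1) A di(1) D.cmp_hom[OF di(1) A A di(2) \<kappa>] di(3)] by simp
    then show ?thesis using D.schur_scalar[of "S i" "\<pi> i \<cdot> \<kappa> \<cdot> \<iota> i"] S In[OF i] by (metis center_simps(3,4))
  qed
  then obtain c where c: "\<And>i. i \<in> I \<Longrightarrow> \<pi> i \<cdot> \<kappa> \<cdot> \<iota> i = scl C (c i) (\<one> (fst (S i)))" by metis
  \<comment> \<open>\<open>R\<close> is the inverse of the adjunction, \<open>\<psi> \<cdot> u \<mapsto> u\<close>.\<close>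
  define R where "R = inv_into (hom ?D \<X> A) (\<Psi> \<X> ?W)"
  have R: "R x \<in> hom ?D \<X> A" "\<psi> \<cdot> R x = x" if "x \<in> hom C (fst \<X>) ?W" for x
  proof -
    have im: "x \<in> \<Psi> \<X> ?W ` hom ?D \<X> A" using bij[OF X] that by (simp add: bij_betw_def)
    show 1: "R x \<in> hom ?D \<X> A" unfolding R_def by (rule inv_into_into[OF im])
    have "\<Psi> \<X> ?W (R x) = x" unfolding R_def by (rule f_inv_into_f[OF im])
    then show "\<psi> \<cdot> R x = x" using \<Psi>[OF X 1] by simp
  qed
  have R\<psi>: "R (\<psi> \<cdot> u) = u" if "u \<in> hom ?D \<X> A" for u
    unfolding R_def \<Psi>[OF X that, symmetric] using bij[OF X] that by (simp add: bij_betw_def inv_into_f_f del: center_simps)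
  have x: "fst \<X> \<in> obj C" using X by simp
  have homD: "u \<in> hom C (fst \<X>) a" if "u \<in> hom ?D \<X> A" for u using that by (simp add: a_def)
  have R_add: "R (p + q) = R p + R q" if pq: "p \<in> hom C (fst \<X>) ?W" "q \<in> hom C (fst \<X>) ?W" for p q
  proof -
    have "\<psi> \<cdot> (R p + R q) = p + q"
      using cmp_add_right[OF x a W homD[OF R(1)[OF pq(1)]] homD[OF R(1)[OF pq(2)]] \<psi>] R(2) pq by simp
    then show ?thesis using R\<psi>[OF D.hom_add[OF X A R(1)[OF pq(1)] R(1)[OF pq(2)]]] by simp
  qed
  have R_scl: "R (scl C k p) = scl C k (R p)" if p: "p \<in> hom C (fst \<X>) ?W" for k p
  proof -
    have "\<psi> \<cdot> scl C k (R p) = scl C k p"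
      using cmp_scl_right[OF x a W homD[OF R(1)[OF p]] \<psi>] R(2) p by simp
    moreover have "scl C k (R p) \<in> hom ?D \<X> A" using D.hom_scl[OF X A R(1)[OF p], of k] by (simp only: center_simps(4))
    ultimately show ?thesis using R\<psi> by metis
  qed
  have \<phi>C: "\<phi> i \<in> hom C (fst \<X>) (fst (S i))" and SC: "fst (S i) \<in> obj C" and \<iota>C: "\<iota> i \<in> hom C (fst (S i)) a" and \<pi>C: "\<pi> i \<in> hom C a (fst (S i))"
    if "i \<in> I" for i using \<phi>h[OF that] ds(2-4)[OF In[OF that]] by (simp_all add: a_def)
  have \<zeta>_add: "\<zeta> i (u + v) = \<zeta> i u + \<zeta> i v" if i: "i \<in> I" and uv: "u \<in> hom ?D \<X> A" "v \<in> hom ?D \<X> A" for i u v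
  proof (rule \<zeta>_eq[OF i D.hom_add[OF X A uv]])
    show "\<pi> i \<cdot> (u + v) = scl C (\<zeta> i u + \<zeta> i v) (\<phi> i)"
      using cmp_add_right[OF x a SC[OF i] homD[OF uv(1)] homD[OF uv(2)] \<pi>C[OF i]] \<zeta>[OF uv(1) i] \<zeta>[OF uv(2) i]
      by (simp add: vs.scale_left_distrib)
  qed
  have \<zeta>_scl: "\<zeta> i (scl C k u) = k * \<zeta> i u" if i: "i \<in> I" and u: "u \<in> hom ?D \<X> A" for i k u
  proof (rule \<zeta>_eq[OF i])
    show "scl C k u \<in> hom ?D \<X> A" using D.hom_scl[OF X A u, of k] by (simp only: center_simps(4))
    show "\<pi> i \<cdot> scl C k u = scl C (k * \<zeta> i u) (\<phi> i)"
      using cmp_scl_right[OF x a SC[OF i] homD[OF u] \<pi>C[OF i]] \<zeta>[OF u i] by simp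
  qed
  have E: "E_map C \<X> V m l p = \<psi> \<cdot> (\<kappa> \<cdot> R p)" and \<kappa>R: "\<kappa> \<cdot> R p \<in> hom ?D \<X> A" if p: "p \<in> hom C (fst \<X>) ?W" for p
  proof -
    show \<kappa>R: "\<kappa> \<cdot> R p \<in> hom ?D \<X> A" using D.cmp_hom[OF X A A R(1)[OF p] \<kappa>] by simp
    show "E_map C \<X> V m l p = \<psi> \<cdot> (\<kappa> \<cdot> R p)"
      using E\<Psi>[OF R(1)[OF p]] \<Psi>[OF X R(1)[OF p]] \<Psi>[OF X \<kappa>R] R(2)[OF p] by simp
  qed
  have \<kappa>C: "\<kappa> \<in> hom C a a" using \<kappa> by (simp add: a_def)
  have "fs_indicator C \<X> V m l = (\<Sum>i\<in>I. \<zeta> i (R (E_map C \<X> V m l (\<psi> \<cdot> (\<iota> i \<cdot> \<phi> i)))))"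
      unfolding fs_indicator_def
  proof (rule lin_trace_coords[where \<xi> = "\<lambda>i p. \<zeta> i (R p)" and e = "\<lambda>i. \<psi> \<cdot> (\<iota> i \<cdot> \<phi> i)"])
    show "vector_space (scl C)" by (rule scl_vector_space)
    show "vs.subspace (hom C (fst \<X>) ?W)" using hom_subspace x W by blast
    show "finite I" by (simp add: I_def)
    show e: "\<psi> \<cdot> (\<iota> i \<cdot> \<phi> i) \<in> hom C (fst \<X>) ?W" if "i \<in> I" for i
      using cmp_hom[OF x a W homD[OF \<iota>\<phi>[OF that]] \<psi>] .
    show "p = (\<Sum>i\<in>I. scl C (\<zeta> i (R p)) (\<psi> \<cdot> (\<iota> i \<cdot> \<phi> i)))" if p: "p \<in> hom C (fst \<X>) ?W" for p
    proof -
      have "p = \<psi> \<cdot> (\<Sum>i\<in>I. scl C (\<zeta> i (R p)) (\<iota> i \<cdot> \<phi> i))" using sum[OF R(1)[OF p]] R(2)[OF p] by simp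
      also have "\<dots> = (\<Sum>i\<in>I. \<psi> \<cdot> scl C (\<zeta> i (R p)) (\<iota> i \<cdot> \<phi> i))"
        using homD[OF \<iota>\<phi>] x a by (intro cmp_sum_right[OF x a W _ \<psi>] hom_scl) auto
      also have "\<dots> = (\<Sum>i\<in>I. scl C (\<zeta> i (R p)) (\<psi> \<cdot> (\<iota> i \<cdot> \<phi> i)))"
        using cmp_scl_right[OF x a W homD[OF \<iota>\<phi>] \<psi>] by (intro sum.cong) auto
      finally show ?thesis .
    qed
    show "\<zeta> i (R (p + q)) = \<zeta> i (R p) + \<zeta> i (R q)"
      if "i \<in> I" "p \<in> hom C (fst \<X>) ?W" "q \<in> hom C (fst \<X>) ?W" for i p q
      using that by (simp add: R_add \<zeta>_add R(1) del: center_simps)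
    show "\<zeta> i (R (scl C k p)) = k * \<zeta> i (R p)" if "i \<in> I" "p \<in> hom C (fst \<X>) ?W" for i k p
      using that by (simp add: R_scl \<zeta>_scl R(1) del: center_simps)
    show "E_map C \<X> V m l p \<in> hom C (fst \<X>) ?W" if "p \<in> hom C (fst \<X>) ?W" for p
      using E_map_hom[OF V X that] .
    show "E_map C \<X> V m l (p + q) = E_map C \<X> V m l p + E_map C \<X> V m l q"
      if pq: "p \<in> hom C (fst \<X>) ?W" "q \<in> hom C (fst \<X>) ?W" for p q
      using E[OF pq(1)] E[OF pq(2)] E[OF hom_add[OF x W pq]] R_add[OF pq]
        cmp_add_right[OF x a a homD[OF R(1)[OF pq(1)]] homD[OF R(1)[OF pq(2)]] \<kappa>C]
        cmp_add_right[OF x a W homD[OF \<kappa>R[OF pq(1)]] homD[OF \<kappa>R[OF pq(2)]] \<psi>] by simp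
    show "E_map C \<X> V m l (scl C k p) = scl C k (E_map C \<X> V m l p)" if p: "p \<in> hom C (fst \<X>) ?W" for k p
      using E[OF p] E[OF hom_scl[OF x W p]] R_scl[OF p, of k]
        cmp_scl_right[OF x a a homD[OF R(1)[OF p]] \<kappa>C, of k] cmp_scl_right[OF x a W homD[OF \<kappa>R[OF p]] \<psi>, of k] by simp
  qed
  also have "\<dots> = (\<Sum>i\<in>I. c i)"
  proof (rule sum.cong[OF refl])
    fix i assume i: "i \<in> I"
    have h: "\<kappa> \<cdot> (\<iota> i \<cdot> \<phi> i) \<in> hom ?D \<X> A" using D.cmp_hom[OF X A A \<iota>\<phi>[OF i] \<kappa>] by simp
    have \<kappa>\<iota>: "\<kappa> \<cdot> \<iota> i \<in> hom C (fst (S i)) a" using cmp_hom[OF SC[OF i] a a \<iota>C[OF i] \<kappa>C] .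
    have "R (E_map C \<X> V m l (\<psi> \<cdot> (\<iota> i \<cdot> \<phi> i))) = \<kappa> \<cdot> (\<iota> i \<cdot> \<phi> i)"
      using E\<Psi>[OF \<iota>\<phi>[OF i]] \<Psi>[OF X \<iota>\<phi>[OF i]] \<Psi>[OF X h] R\<psi>[OF h] by simp
    moreover have "\<pi> i \<cdot> \<kappa> \<cdot> (\<iota> i \<cdot> \<phi> i) = scl C (c i) (\<phi> i)"
    proof -
      have "\<pi> i \<cdot> \<kappa> \<cdot> (\<iota> i \<cdot> \<phi> i) = \<pi> i \<cdot> (\<kappa> \<cdot> \<iota> i) \<cdot> \<phi> i"
        using cmp_assoc[OF x SC[OF i] a a \<phi>C[OF i] \<iota>C[OF i] \<kappa>C] by simp
      also have "\<dots> = (\<pi> i \<cdot> \<kappa> \<cdot> \<iota> i) \<cdot> \<phi> i"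
        using cmp_assoc[OF x SC[OF i] a SC[OF i] \<phi>C[OF i] \<kappa>\<iota> \<pi>C[OF i]] by simp
      also have "\<dots> = scl C (c i) (\<phi> i)"
        unfolding c[OF i] using cmp_scl_left[OF x SC[OF i] SC[OF i] \<phi>C[OF i] idn_hom[OF SC[OF i]], of "c i"]
          idn_cmp[OF x SC[OF i] \<phi>C[OF i]] by simp
      finally show ?thesis .
    qed
    ultimately show "\<zeta> i (R (E_map C \<X> V m l (\<psi> \<cdot> (\<iota> i \<cdot> \<phi> i)))) = c i"
      using \<zeta>_eq[OF i h] by simp
  qed
  finally have ind: "fs_indicator C \<X> V m l = (\<Sum>i\<in>I. c i)" .
  have dS: "qdim C (fst (S i)) = qdim ?D \<X>" if i: "i \<in> I" for i
  proof -
    have "isomorphic C (fst (S i)) (fst \<X>)"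
      using i unfolding I_def isomorphic_def is_iso_def inverse_of_def by auto
    then show ?thesis using d_iso[OF SC[OF i] x] by (simp add: d_qdim qdim_def ptr_center)
  qed
  have "\<kappa> \<cdot> z = (\<Sum>i\<in>I. \<kappa> \<cdot> \<iota> i \<cdot> \<pi> i)"
    unfolding z I_def[symmetric] using \<iota>C \<pi>C SC a \<kappa>C
    by (intro cmp_sum_right[OF a a a]) (auto intro: cmp_hom[OF a SC a])
  also have "\<dots> = (\<Sum>i\<in>I. (\<kappa> \<cdot> \<iota> i) \<cdot> \<pi> i)"
    using cmp_assoc[OF a SC a a \<pi>C \<iota>C \<kappa>C] by (intro sum.cong) auto
  finally have "ptr ?D A (\<kappa> \<cdot> z) = ptr C a (\<Sum>i\<in>I. (\<kappa> \<cdot> \<iota> i) \<cdot> \<pi> i)" by (simp add: ptr_center a_def)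
  also have "\<dots> = (\<Sum>i\<in>I. c i * qdim C (fst (S i)))"
    using c \<pi>C SC cmp_hom[OF SC a a \<iota>C \<kappa>C] by (intro ptr_sum_cyclic[OF a]) auto
  also have "\<dots> = qdim ?D \<X> * (\<Sum>i\<in>I. c i)" unfolding sum_distrib_left using dS by (intro sum.cong) (auto simp: mult.commute)
  finally have "ptr ?D A (\<kappa> \<cdot> z) = qdim ?D \<X> * fs_indicator C \<X> V m l" using ind by simp
  then show ?thesis
    using center_qdim_nonzero[OF lin assms(2)] by (simp add: A_def \<kappa>_def)
qed

end

theorem theorem3p4:
  fixes C :: "('o, 'm::ab_group_add, 'k::{alg_closed_field, field_char_0}) pivotal_category"
    and K :: "'o \<Rightarrow> 'o \<times> ('o \<Rightarrow> 'm)" and Km :: "'o \<Rightarrow> 'o \<Rightarrow> 'm \<Rightarrow> 'm"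
    and \<Psi> :: "'o \<times> ('o \<Rightarrow> 'm) \<Rightarrow> 'o \<Rightarrow> 'm \<Rightarrow> 'm"
    and \<X> :: "'o \<times> ('o \<Rightarrow> 'm)" and V :: 'o and m l :: int and z :: 'm
  assumes "spherical_fusion_category C"
    and "two_sided_adjoint_of_forgetful C K Km \<Psi>"
    and "simple (center C) \<X>"
    and "V \<in> obj C"
    and "isotypic_projection (center C) \<X> (K (vpow C V m)) z"
  shows "fs_indicator C \<X> V m l =
    1 / qdim (center C) \<X> * ptr (center C) (K (vpow C V m)) (cmp (center C) (kappa C K \<Psi> V m l) z)"
proof -
  interpret closed_spherical_fusion_category C
    by (rule closed_spherical_fusion_category.intro) fact
  show ?thesis using fs_indicator_center_trace[OF assms(2-5)] .
qed

end
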